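(* Suppose that $1\le p<\infty$, $t>-1$ and $\lambda\in\mathbb{R}$ satisfy $\lambda>\frac{t+1}{p}-1$ if $1<p<\infty$, and $\lambda\ge t$ if $p=1$. If $f\in A_t^p(\mathcal{U})$, then $$f=\frac{(2i)^N\,\Gamma(1+\lambda)}{\Gamma(1+\lambda+N)}\,\mathcal{P}_{\lambda}\left(\rho^N\mathcal{L}_n^N f\right)$$ for any $N\in\mathbb{N}_0$.
   Context: Let $n$ be a positive integer. $\mathbb{N}_0$ denotes the set of nonnegative integers. Write $z=(z',z_n)\in\mathbb{C}^n$ with $z'=(z_1,\dots,z_{n-1})\in\mathbb{C}^{n-1}$ and $z_n\in\mathbb{C}$. The Siegel upper half-space is $\mathcal{U}=\{z\in\mathbb{C}^n:\mathrm{Im}\,z_n>|z'|^2\}$. Put $\rho(z,w)=\frac{i}{2}(\overline{w}_n-z_n)-z'\cdot\overline{w'}$, where $z'\cdot\overline{w'}=\sum_{j=1}^{n-1}z_j\overline{w_j}$, and $\rho(z)=\rho(z,z)=\mathrm{Im}\,z_n-|z'|^2$. For $z,w\in\mathcal{U}$ one has $\mathrm{Re}\,\rho(z,w)>0$, and powers of $\rho(z,w)$ are taken with the principal branch. For $1\le p<\infty$ and $t>-1$, $L_t^p(\mathcal{U})$ is the space of Lebesgue measurable functions $f$ on $\mathcal{U}$ with $\|f\|_{p,t}=\left(\int_{\mathcal{U}}|f(z)|^p\rho(z)^t\,dV(z)\right)^{1/p}<\infty$, where $dV$ is Lebesgue measure on $\mathbb{C}^n$. The weighted Bergman space $A_t^p(\mathcal{U})$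 is the closed subspace of $L_t^p(\mathcal{U})$ consisting of holomorphic functions. $\mathcal{L}_n=\frac{\partial}{\partial z_n}$. The integral operator $\mathcal{P}_\lambda$ is given by $$\mathcal{P}_{\lambda}f(z)=c_{\lambda}\int_{\mathcal{U}}\frac{\rho(w)^{\lambda}}{\rho(z,w)^{n+1+\lambda}}f(w)\,dV(w),\qquad c_{\lambda}=\frac{\Gamma(n+1+\lambda)}{4\pi^n\,\Gamma(1+\lambda)}.$$
   Formalization: The factor (2i)^N is replaced by (-2i)^N: with the stated definitions the formula with (2i)^N fails for odd N (n=1, p=1, t=0, λ=2, N=1, f(w)=ρ(w,i)^{-3} at z=i gives a negative right side, but f(i)=1); for even N the two agree. *)

theory Defs
  imports "HOL-Analysis.Analysis"
begin

text \<open>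
  Points of \<open>\<complex>\<^sup>n\<close> are vectors of type \<open>complex ^ 'n\<close>, where \<open>'n\<close> is a finite linearly ordered type
  with \<open>n = CARD('n)\<close> elements (so \<open>n \<ge> 1\<close>); the coordinate \<open>z\<^sub>n\<close> is the one at the largest index.
\<close>

type_synonym 'n cvec = "(complex, 'n) vec"

definition last_ix :: "'n :: {finite, linorder}" where
  "last_ix = Max UNIV"

definition rho2 :: "('n :: {finite, linorder}) cvec \<Rightarrow> 'n cvec \<Rightarrow> complex" where
  "rho2 z w = (\<i> / 2) * (cnj (w $ last_ix) - z $ last_ix)
                - (\<Sum>j\<in>UNIV - {last_ix}. z $ j * cnj (w $ j))"

definition rho :: "('n :: {finite, linorder}) cvec \<Rightarrow> real" where
  "rho z = Im (z $ last_ix) - (\<Sum>j\<in>UNIV - {last_ix}. (cmod (z $ j))\<^sup>2)"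

lemma rho2_diag: "rho2 z z = complex_of_real (rho z)"
proof -
  have "(\<Sum>j\<in>UNIV - {last_ix}. z $ j * cnj (z $ j))
          = complex_of_real (\<Sum>j\<in>UNIV - {last_ix}. (cmod (z $ j))\<^sup>2)"
    by (simp add: complex_norm_square flip: of_real_power)
  moreover have "(\<i> / 2) * (cnj (z $ last_ix) - z $ last_ix) = complex_of_real (Im (z $ last_ix))"
    by (simp add: complex_eq_iff)
  ultimately show ?thesis
    by (simp add: rho2_def rho_def)
qed

definition siegel :: "(('n :: {finite, linorder}) cvec) set" where
  "siegel = {z. Im (z $ last_ix) > (\<Sum>j\<in>UNIV - {last_ix}. (cmod (z $ j))\<^sup>2)}"

text \<open>Holomorphy in several variables: complex (Frechet) differentiability at every point.\<close>

definition holomorphic_sv :: "(('n :: finite) cvec \<Rightarrow> complex) \<Rightarrow> ('n cvec) set \<Rightarrow> bool" where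
  "holomorphic_sv f S \<longleftrightarrow>
     (\<forall>z\<in>S. \<exists>D. (f has_derivative D) (at z) \<and> (\<forall>c v. D (c *s v) = c * D v))"

text \<open>Since \<open>p > 0\<close>, the norm is finite iff the integral of \<open>\<bar>f\<bar>\<^sup>p \<rho>\<^sup>t\<close> is.\<close>

definition Lp_weighted :: "real \<Rightarrow> real \<Rightarrow> (('n :: {finite, linorder}) cvec \<Rightarrow> complex) set" where
  "Lp_weighted p t =
     {f \<in> borel_measurable (lebesgue_on siegel).
        (\<integral>\<^sup>+z. ennreal (cmod (f z) powr p * rho z powr t) \<partial>lebesgue_on siegel) < \<infinity>}"

definition bergman :: "real \<Rightarrow> real \<Rightarrow> (('n :: {finite, linorder}) cvec \<Rightarrow> complex) set" where
  "bergman p t = {f \<in> Lp_weighted p t. holomorphic_sv f siegel}"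

text \<open>
  \<open>\<partial>/\<partial>z\<^sub>n\<close>. Since \<open>\<partial>\<rho>/\<partial>z\<^sub>n = 1/(2\<i>)\<close>, each integration by parts in \<open>z\<^sub>n\<close> against \<open>\<rho>\<^sup>\<lambda>\<^sup>+\<^sup>1\<close>
  contributes \<open>-2\<i> / (1 + \<lambda>)\<close>. The factor in the representation formula is therefore \<open>(-2\<i>)\<^sup>N\<close>;
  with the present definitions the formula with \<open>(2\<i>)\<^sup>N\<close> fails for odd \<open>N\<close>.
\<close>

definition Lop :: "(('n :: {finite, linorder}) cvec \<Rightarrow> complex) \<Rightarrow> 'n cvec \<Rightarrow> complex" where
  "Lop f z = deriv (\<lambda>\<zeta>. f (\<chi> j. if j = last_ix then \<zeta> else z $ j)) (z $ last_ix)"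

text \<open>The integrand of \<open>P\<^sub>\<lambda> f(z)\<close>, as a function of \<open>w\<close>. Complex \<open>powr\<close> is the principal branch.\<close>

definition P_integrand ::
    "real \<Rightarrow> (('n :: {finite, linorder}) cvec \<Rightarrow> complex) \<Rightarrow> 'n cvec \<Rightarrow> 'n cvec \<Rightarrow> complex" where
  "P_integrand l f z w =
     complex_of_real (rho w powr l)
       / (rho2 z w powr complex_of_real (real CARD('n) + 1 + l)) * f w"

definition P_op ::
    "real \<Rightarrow> (('n :: {finite, linorder}) cvec \<Rightarrow> complex) \<Rightarrow> 'n cvec \<Rightarrow> complex" where
  "P_op l f z =
     complex_of_real (Gamma (real CARD('n) + 1 + l) / (4 * pi ^ CARD('n) * Gamma (1 + l)))
       * (\<integral>w. P_integrand l f z w \<partial>lebesgue_on siegel)"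

end

theory Submission
  imports Defs "HOL-Complex_Analysis.Complex_Analysis" "HOL-Real_Asymp.Real_Asymp"
begin

text \<open>
  The case \<open>N = 0\<close> comes first. A Heisenberg translation moves the point \<open>z\<close> over the origin of
  \<open>\<complex>\<^sup>n\<^sup>-\<^sup>1\<close>, and a point \<open>w\<close> of the Siegel domain is described by the translated first coordinates
  \<open>v\<close>, by \<open>s = \<rho>(w)\<close>, and by the real part \<open>u\<close> of the translated last coordinate, whose imaginary part is
  then \<open>s + |v|\<^sup>2\<close>. Lebesgue measure becomes the product measure \<open>dv ds du\<close> (\<open>distr_hcoord\<close>), the
  weight becomes \<open>s\<^sup>\<lambda>\<close>, and the kernel depends on \<open>(s + |v|\<^sup>2, u)\<close> alone. So the integral does not
  change when \<open>v\<close> is multiplied by a unimodular number, and the average over all these rotations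
  replaces \<open>f\<close> by its restriction to the slice \<open>v = 0\<close>, by the mean value property
  (\<open>hrot_circle_average\<close>). Now the integrand depends on \<open>v\<close> only through \<open>|v|\<^sup>2\<close>, and in terms of
  \<open>r = s + |v|\<^sup>2\<close> the measure \<open>s\<^sup>\<lambda> ds dv\<close> is a multiple of \<open>r\<^sup>\<mu> dr\<close> with \<open>\<mu> = \<lambda> + n - 1\<close>
  (\<open>nn_integral_radial\<close>). What is left is the weighted reproducing formula of the upper half-plane
  (\<open>half_plane_reproducing\<close>).

  For that formula, note that \<open>\<omega>\<close> and its conjugate differ by \<open>2ir\<close> on the line \<open>Im \<omega> = r\<close>. On this line
  the kernel is therefore the restriction of a holomorphic function of \<open>\<omega>\<close>, and the line can be moved
  to a height that does not depend on \<open>r\<close> (\<open>horizontal_line_shift\<close>). Then \<open>r\<close> occurs in the kernel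
  only, a beta integral gives \<open>\<integral> r\<^sup>\<mu> (r + B)\<^sup>-\<^sup>2\<^sup>-\<^sup>\<mu> dr = 1 / ((1 + \<mu>) B)\<close>, and Cauchy's formula on a
  horizontal line remains (\<open>Cauchy_integral_horizontal_line\<close>). The function is first divided by powers
  of \<open>1 - i\<epsilon>\<omega>\<close>, which have modulus at least 1 on the half-plane and force decay; \<open>\<epsilon>\<close> tends to 0 at
  the end by dominated convergence.

  For \<open>N > 0\<close>, the operator \<open>\<L>\<^sub>n\<close> is \<open>d/du\<close> on every line with \<open>v\<close> and \<open>s\<close> fixed. Each integration by
  parts moves one derivative to the kernel and raises its exponent by one (\<open>wint_by_parts\<close>). After \<open>N\<close>
  steps this is the case \<open>N = 0\<close> with \<open>\<lambda> + N\<close> in place of \<open>\<lambda>\<close>; the factors \<open>i/2\<close> that arise cancel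
  \<open>(-2i)\<^sup>N\<close>, and the Gamma factors telescope.

  All this needs a single integrability property, namely that \<open>|f| \<rho>\<^sup>\<lambda> / |\<rho>(z,\<cdot>)|\<^sup>n\<^sup>+\<^sup>1\<^sup>+\<^sup>\<lambda>\<close> is integrable.
  For \<open>f\<close> in the Bergman space it follows from Young's inequality and the integrability of weighted
  powers of the kernel (\<open>bergman_wint_integrable\<close>, \<open>nn_integral_hker_finite\<close>). It is inherited by
  \<open>\<rho>\<^sup>k \<L>\<^sub>n\<^sup>k f\<close>: Cauchy's formula on the circle of radius \<open>\<rho>(w)/2\<close> about \<open>w\<^sub>n\<close> writes this function as an
  average of \<open>f\<close> over images of \<open>w\<close> under linear maps of \<open>(s, u)\<close> which distort the measure, the weight
  and the kernel by bounded factors only (\<open>wint_Lop_integrable\<close>).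
\<close>

section \<open>Lebesgue measure under rotations\<close>

text \<open>
  Parameters \<open>(r, u)\<close>: in applications \<open>r\<close> is an imaginary and \<open>u\<close> a real part, in this order
  because the outer integration is over the heights of horizontal lines.
\<close>

abbreviation plane :: "(real \<times> real) measure" where
  "plane \<equiv> lborel \<Otimes>\<^sub>M lborel"

lemma Complex_measurable: "(\<lambda>(r, u). Complex u r) \<in> borel_measurable plane"
  unfolding case_prod_beta Complex_eq by measurable

lemma distr_plane_Complex: "distr plane borel (\<lambda>(r, u). Complex u r) = lborel"
proof (rule lborel_eqI[symmetric])
  fix l u :: complex
  assume le: "\<And>b. b \<in> Basis \<Longrightarrow> l \<bullet> b \<le> u \<bullet> b"
  then have le': "Re l \<le> Re u" "Im l \<le> Im u"
    using le[of 1] le[of \<i>] by (auto simp: Basis_complex_def)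
  have "(\<lambda>(r, u). Complex u r) -` box l u = {Im l<..<Im u} \<times> {Re l<..<Re u}"
    by (auto simp: box_def Basis_complex_def)
  then have "emeasure (distr plane borel (\<lambda>(r, u). Complex u r)) (box l u)
      = emeasure plane ({Im l<..<Im u} \<times> {Re l<..<Re u})"
    using Complex_measurable by (subst emeasure_distr) (auto simp: space_pair_measure)
  also have "\<dots> = ennreal (prod ((\<bullet>) (u - l)) Basis)"
    using le' by (simp add: lborel.emeasure_pair_measure_Times Basis_complex_def ennreal_mult mult.commute)
  finally show "emeasure (distr plane borel (\<lambda>(r, u). Complex u r)) (box l u)
      = ennreal (prod ((\<bullet>) (u - l)) Basis)" .
qed simp

lemma nn_integral_complex_lborel:
  fixes F :: "complex \<Rightarrow> ennreal"
  assumes [measurable]: "F \<in> borel_measurable borel"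
  shows "(\<integral>\<^sup>+z. F z \<partial>lborel) = (\<integral>\<^sup>+y. \<integral>\<^sup>+x. F (Complex x y) \<partial>lborel \<partial>lborel)"
proof -
  have "(\<integral>\<^sup>+z. F z \<partial>lborel) = (\<integral>\<^sup>+p. F (case p of (r, u) \<Rightarrow> Complex u r) \<partial>plane)"
    using Complex_measurable by (subst distr_plane_Complex[symmetric], subst nn_integral_distr) auto
  also have "\<dots> = (\<integral>\<^sup>+y. \<integral>\<^sup>+x. F (Complex x y) \<partial>lborel \<partial>lborel)"
    using measurable_compose[OF Complex_measurable assms]
    by (subst lborel.nn_integral_fst[symmetric]) auto
  finally show ?thesis .
qed

lemma nn_integral_lborel_plus:
  fixes F :: "'a::euclidean_space \<Rightarrow> ennreal"
  assumes [measurable]: "F \<in> borel_measurable borel"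
  shows "(\<integral>\<^sup>+x. F (c + x) \<partial>lborel) = (\<integral>\<^sup>+x. F x \<partial>lborel)"
  by (subst lborel_distr_plus[symmetric, of c]) (simp add: nn_integral_distr)

lemma nn_integral_horizontal_shear:
  fixes F :: "complex \<Rightarrow> ennreal"
  assumes [measurable]: "F \<in> borel_measurable borel"
  shows "(\<integral>\<^sup>+z. F (Complex (Re z + k * Im z) (Im z)) \<partial>lborel) = (\<integral>\<^sup>+z. F z \<partial>lborel)"
proof -
  have "(\<integral>\<^sup>+z. F (Complex (Re z + k * Im z) (Im z)) \<partial>lborel)
      = (\<integral>\<^sup>+y. \<integral>\<^sup>+x. F (Complex (k * y + x) y) \<partial>lborel \<partial>lborel)"
    by (subst nn_integral_complex_lborel) (auto simp: add.commute Complex_eq)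
  also have "\<dots> = (\<integral>\<^sup>+y. \<integral>\<^sup>+x. F (Complex x y) \<partial>lborel \<partial>lborel)"
  proof (rule nn_integral_cong)
    show "(\<integral>\<^sup>+x. F (Complex (k * y + x) y) \<partial>lborel) = (\<integral>\<^sup>+x. F (Complex x y) \<partial>lborel)" for y
      by (rule nn_integral_lborel_plus[of "\<lambda>x. F (Complex x y)"]) (simp add: Complex_eq)
  qed
  finally show ?thesis
    by (simp add: nn_integral_complex_lborel)
qed

lemma nn_integral_vertical_shear:
  fixes F :: "complex \<Rightarrow> ennreal"
  assumes [measurable]: "F \<in> borel_measurable borel"
  shows "(\<integral>\<^sup>+z. F (Complex (Re z) (Im z + k * Re z)) \<partial>lborel) = (\<integral>\<^sup>+z. F z \<partial>lborel)"
proof -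
  have "(\<integral>\<^sup>+z. F (Complex (Re z) (Im z + k * Re z)) \<partial>lborel)
      = (\<integral>\<^sup>+y. \<integral>\<^sup>+x. F (Complex x (k * x + y)) \<partial>lborel \<partial>lborel)"
    by (subst nn_integral_complex_lborel) (auto simp: add.commute Complex_eq)
  also have "\<dots> = (\<integral>\<^sup>+x. \<integral>\<^sup>+y. F (Complex x (k * x + y)) \<partial>lborel \<partial>lborel)"
    by (subst lborel_pair.Fubini') (auto simp: Complex_eq case_prod_beta)
  also have "\<dots> = (\<integral>\<^sup>+x. \<integral>\<^sup>+y. F (Complex x y) \<partial>lborel \<partial>lborel)"
  proof (rule nn_integral_cong)
    show "(\<integral>\<^sup>+y. F (Complex x (k * x + y)) \<partial>lborel) = (\<integral>\<^sup>+y. F (Complex x y) \<partial>lborel)" for x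
      by (rule nn_integral_lborel_plus[of "\<lambda>y. F (Complex x y)"]) (simp add: Complex_eq)
  qed
  also have "\<dots> = (\<integral>\<^sup>+y. \<integral>\<^sup>+x. F (Complex x y) \<partial>lborel \<partial>lborel)"
    by (subst lborel_pair.Fubini') (auto simp: Complex_eq case_prod_beta)
  finally show ?thesis
    by (simp add: nn_integral_complex_lborel)
qed

text \<open>
  A rotation by an angle other than \<open>\<pi>\<close> is a product of three shears, and shears preserve Lebesgue
  measure by Fubini and translation invariance. The rotation by \<open>\<pi>\<close> is the square of the rotation by \<open>\<pi>/2\<close>.
\<close>

lemma nn_integral_rotation:
  fixes F :: "complex \<Rightarrow> ennreal"
  assumes [measurable]: "F \<in> borel_measurable borel" and c: "cmod c = 1"
  shows "(\<integral>\<^sup>+z. F (c * z) \<partial>lborel) = (\<integral>\<^sup>+z. F z \<partial>lborel)"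
proof -
  have *: "(\<integral>\<^sup>+z. G (c * z) \<partial>lborel) = (\<integral>\<^sup>+z. G z \<partial>lborel)"
    if c: "cmod c = 1" "c \<noteq> -1" and [measurable]: "G \<in> borel_measurable borel" for G c
  proof -
    \<comment> \<open>With \<open>c = cis \<theta>\<close> this is \<open>- tan (\<theta>/2)\<close>, the slope of the first and last shear.\<close>
    define k where "k = - Im c / (1 + Re c)"
    have 1: "(Re c)\<^sup>2 + (Im c)\<^sup>2 = 1"
      using c by (simp add: cmod_power2[symmetric])
    have nz: "1 + Re c \<noteq> 0"
    proof
      assume "1 + Re c = 0"
      then have "Re c = -1" by simp
      with 1 have "Im c = 0" by simp
      with \<open>Re c = -1\<close> c show False by (simp add: complex_eq_iff)
    qed
    have kb: "k * Im c = Re c - 1" "k * (1 + Re c) = - Im c"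
    proof -
      have "- (Im c)\<^sup>2 = (Re c - 1) * (1 + Re c)"
        using 1 by (simp add: algebra_simps power2_eq_square)
      then show "k * Im c = Re c - 1" "k * (1 + Re c) = - Im c"
        using nz by (simp_all add: k_def field_simps power2_eq_square)
    qed
    define h v where "h z = Complex (Re z + k * Im z) (Im z)"
      and "v z = Complex (Re z) (Im z + Im c * Re z)" for z
    have [measurable]: "h \<in> borel_measurable borel" "v \<in> borel_measurable borel"
      unfolding h_def v_def Complex_eq by measurable
    have eq: "c * z = h (v (h z))" for z
    proof (rule complex_eqI)
      have "Re (h (v (h z))) = (1 + k * Im c) * Re z + k * (2 + k * Im c) * Im z"
        by (simp add: h_def v_def algebra_simps)
      also have "\<dots> = Re c * Re z - Im c * Im z"
        using kb(2) unfolding kb(1) by (simp add: algebra_simps)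
      finally show "Re (c * z) = Re (h (v (h z)))" by simp
      have "Im (h (v (h z))) = (1 + k * Im c) * Im z + Im c * Re z"
        by (simp add: h_def v_def algebra_simps)
      then show "Im (c * z) = Im (h (v (h z)))"
        unfolding kb(1) by (simp add: algebra_simps)
    qed
    have "(\<integral>\<^sup>+z. G (c * z) \<partial>lborel) = (\<integral>\<^sup>+z. G (h (v (h z))) \<partial>lborel)"
      by (simp add: eq)
    also have "\<dots> = (\<integral>\<^sup>+z. G (h (v z)) \<partial>lborel)"
      by (subst nn_integral_horizontal_shear[of "\<lambda>z. G (h (v z))" k, symmetric])
         (measurable, simp add: h_def)
    also have "\<dots> = (\<integral>\<^sup>+z. G (h z) \<partial>lborel)"
      by (subst nn_integral_vertical_shear[of "\<lambda>z. G (h z)" "Im c", symmetric])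
         (simp_all add: v_def)
    also have "\<dots> = (\<integral>\<^sup>+z. G z \<partial>lborel)"
      by (subst nn_integral_horizontal_shear[of "\<lambda>z. G z" k, symmetric])
         (simp_all add: h_def)
    finally show ?thesis .
  qed
  show ?thesis
  proof (cases "c = -1")
    case True
    have "(\<integral>\<^sup>+z. F (\<i> * (\<i> * z)) \<partial>lborel) = (\<integral>\<^sup>+z. F (\<i> * z) \<partial>lborel)"
      by (rule *) (auto simp: complex_eq_iff)
    also have "\<dots> = (\<integral>\<^sup>+z. F z \<partial>lborel)"
      by (rule *) (auto simp: complex_eq_iff)
    finally show ?thesis
      by (simp add: True mult.assoc[symmetric])
  qed (auto simp: c intro!: *)
qed

lemma distr_PiM_rotation:
  fixes I :: "'i set"
  assumes I: "finite I" and c: "cmod c = 1"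
  shows "distr (PiM I (\<lambda>_. lborel)) (PiM I (\<lambda>_. lborel)) (\<lambda>v. \<lambda>i\<in>I. c * v i)
    = PiM I (\<lambda>_. lborel)"
proof -
  interpret product_sigma_finite "\<lambda>_::'i. lborel :: complex measure" ..
  have [measurable]: "(\<lambda>v. \<lambda>i\<in>I. c * v i) \<in> measurable (PiM I (\<lambda>_. lborel)) (PiM I (\<lambda>_. lborel))"
    by (intro measurable_restrict) measurable
  show ?thesis
  proof (rule PiM_eqI)
    fix A :: "'i \<Rightarrow> complex set"
    assume A: "\<And>i. i \<in> I \<Longrightarrow> A i \<in> sets lborel"
    have rot: "emeasure lborel ((\<lambda>z. c * z) -` B) = emeasure lborel B"
      if [measurable]: "B \<in> sets lborel" for B
    proof -
      have m: "(\<lambda>z. c * z) -` B \<in> sets lborel"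
        using measurable_sets[of "\<lambda>z. c * z" lborel lborel B] that by simp
      have "emeasure lborel ((\<lambda>z. c * z) -` B) = (\<integral>\<^sup>+z. indicator ((\<lambda>z. c * z) -` B) z \<partial>lborel)"
        using m by simp
      also have "\<dots> = (\<integral>\<^sup>+z. indicator B (c * z) \<partial>lborel)"
        by (intro nn_integral_cong) (simp add: indicator_def)
      also have "\<dots> = emeasure lborel B"
        by (subst nn_integral_rotation) (use that c in auto)
      finally show ?thesis .
    qed
    have *: "(\<lambda>v. \<lambda>i\<in>I. c * v i) -` Pi\<^sub>E I A \<inter> space (PiM I (\<lambda>_. lborel))
        = Pi\<^sub>E I (\<lambda>i. (\<lambda>z. c * z) -` A i)"
      by (auto simp: space_PiM PiE_def Pi_def extensional_def)
    have m: "(\<lambda>z. c * z) -` A i \<in> sets lborel" if "i \<in> I" for i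
      using measurable_sets[of "\<lambda>z. c * z" lborel lborel "A i"] A[OF that] by simp
    show "emeasure (distr (PiM I (\<lambda>_. lborel)) (PiM I (\<lambda>_. lborel)) (\<lambda>v. \<lambda>i\<in>I. c * v i)) (Pi\<^sub>E I A)
        = (\<Prod>i\<in>I. emeasure lborel (A i))"
      using A I m
      by (subst emeasure_distr) (auto simp: * emeasure_PiM rot intro!: sets_PiM_I_finite prod.cong)
  qed (use I in auto)
qed

section \<open>Heisenberg coordinates\<close>

definition sqn :: "('n :: {finite, linorder} \<Rightarrow> complex) \<Rightarrow> real" where
  "sqn v = (\<Sum>j\<in>UNIV - {last_ix}. (cmod (v j))\<^sup>2)"

text \<open>
  The image of \<open>(v, \<omega>)\<close> under the Heisenberg translation that carries the origin to
  \<open>(z', i|z'|\<^sup>2)\<close>. It preserves \<open>\<rho>\<close>.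
\<close>

definition heis :: "('n :: {finite, linorder}) cvec \<Rightarrow> ('n \<Rightarrow> complex) \<Rightarrow> complex \<Rightarrow> 'n cvec" where
  "heis z v \<omega> = (\<chi> j. if j = last_ix
     then \<omega> + 2 * \<i> * (\<Sum>j\<in>UNIV - {last_ix}. v j * cnj (z $ j)) + \<i> * complex_of_real (sqn (($) z))
     else v j + z $ j)"

text \<open>
  The last coordinate of the preimage of \<open>z\<close> under this translation; the other coordinates
  of the preimage are 0.
\<close>

definition base :: "('n :: {finite, linorder}) cvec \<Rightarrow> complex" where
  "base z = z $ last_ix - \<i> * complex_of_real (sqn (($) z))"

text \<open>
  Lebesgue measure on \<open>\<complex>\<^sup>n\<^sup>-\<^sup>1\<close>, realised on functions so that induction on the set of coordinates is possible.
\<close>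

abbreviation hmeas :: "('n :: {finite, linorder} \<Rightarrow> complex) measure" where
  "hmeas \<equiv> PiM (UNIV - {last_ix}) (\<lambda>_. lborel)"

lemma sqn_nonneg [simp]: "0 \<le> sqn v"
  by (simp add: sqn_def sum_nonneg)

lemma rho_eq: "rho z = Im (z $ last_ix) - sqn (($) z)"
  by (simp add: rho_def sqn_def)

lemma mem_siegel_iff: "z \<in> siegel \<longleftrightarrow> 0 < rho z"
  by (simp add: siegel_def rho_def)

lemma Im_base: "Im (base z) = rho z"
  by (simp add: base_def rho_eq)

lemma sqn_add:
  "sqn (\<lambda>j. v j + w j) = sqn v + sqn w + 2 * Re (\<Sum>j\<in>UNIV - {last_ix}. v j * cnj (w j))"
proof -
  have "(cmod (a + b))\<^sup>2 = (cmod a)\<^sup>2 + (cmod b)\<^sup>2 + 2 * Re (a * cnj b)" for a b :: complex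
    unfolding cmod_power2 by (simp add: power2_eq_square algebra_simps)
  then show ?thesis
    by (simp add: sqn_def sum.distrib sum_distrib_left Re_sum)
qed

lemma sqn_cong: "(\<And>j. j \<noteq> last_ix \<Longrightarrow> v j = w j) \<Longrightarrow> sqn v = sqn w"
  by (simp add: sqn_def)

lemma rho_heis: "rho (heis z v \<omega>) = Im \<omega> - sqn v"
proof -
  have "sqn (($) (heis z v \<omega>)) = sqn (\<lambda>j. v j + z $ j)"
    by (rule sqn_cong) (simp add: heis_def)
  then show ?thesis
    by (simp add: rho_eq sqn_add) (simp add: heis_def)
qed

text \<open>
  This identity is the purpose of the translation: the terms of the kernel that involve \<open>v\<close> and
  \<open>z'\<close> together cancel.
\<close>

lemma rho2_heis: "rho2 z (heis z v \<omega>) = (\<i> / 2) * (cnj \<omega> - base z)"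
proof -
  define S where "S = (\<Sum>j\<in>UNIV - {last_ix}. v j * cnj (z $ j))"
  have "(\<Sum>j\<in>UNIV - {last_ix}. z $ j * cnj (heis z v \<omega> $ j))
      = (\<Sum>j\<in>UNIV - {last_ix}. z $ j * cnj (v j) + z $ j * cnj (z $ j))"
    by (intro sum.cong) (auto simp: heis_def algebra_simps)
  also have "\<dots> = cnj S + complex_of_real (sqn (($) z))"
    by (simp add: sum.distrib S_def sqn_def complex_norm_square mult.commute flip: of_real_power)
  finally have 1: "(\<Sum>j\<in>UNIV - {last_ix}. z $ j * cnj (heis z v \<omega> $ j)) = cnj S + complex_of_real (sqn (($) z))" .
  have 2: "heis z v \<omega> $ last_ix = \<omega> + 2 * \<i> * S + \<i> * complex_of_real (sqn (($) z))"
    by (simp add: heis_def S_def)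
  show ?thesis
    unfolding rho2_def 1 2 by (simp add: base_def algebra_simps)
qed

lemma heis_base: "heis z (\<lambda>_. 0) (base z) = z"
  by (simp add: heis_def base_def vec_eq_iff)

lemma sqn_measurable [measurable]: "sqn \<in> borel_measurable hmeas"
  unfolding sqn_def by measurable

lemma distr_PiM_vec:
  "distr (PiM UNIV (\<lambda>_. lborel)) borel (\<lambda>v. \<chi> j. v j) = (lborel :: ('n :: finite) cvec measure)"
proof -
  interpret product_sigma_finite "\<lambda>_::'n. lborel :: complex measure" ..
  have [measurable]: "(\<lambda>v. \<chi> j. v j) \<in> borel_measurable (PiM UNIV (\<lambda>_::'n. lborel :: complex measure))"
    by (subst borel_measurable_euclidean_space) (auto simp: Basis_vec_def inner_axis)
  show ?thesis
  proof (rule lborel_eqI[symmetric])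
    fix l u :: "'n cvec"
    assume le: "\<And>b. b \<in> Basis \<Longrightarrow> l \<bullet> b \<le> u \<bullet> b"
    have le': "l $ i \<bullet> b \<le> u $ i \<bullet> b" if "b \<in> Basis" for i b
      using le[of "axis i b"] that by (auto simp: Basis_vec_def inner_axis)
    have "(\<lambda>v. \<chi> j. v j) -` box l u \<inter> space (PiM UNIV (\<lambda>_. lborel)) = Pi\<^sub>E UNIV (\<lambda>i. box (l $ i) (u $ i))"
      by (auto simp: box_def Basis_vec_def inner_axis space_PiM PiE_def Pi_def)
    then have "emeasure (distr (PiM UNIV (\<lambda>_. lborel)) borel (\<lambda>v. \<chi> j. v j)) (box l u)
        = (\<Prod>i\<in>UNIV. emeasure lborel (box (l $ i) (u $ i)))"
      by (subst emeasure_distr) (auto simp: emeasure_PiM)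
    also have "\<dots> = (\<Prod>i\<in>UNIV. ennreal (\<Prod>b\<in>Basis. (u $ i - l $ i) \<bullet> b))"
      using le' by (intro prod.cong) (auto simp: emeasure_lborel_box_eq inner_diff_left)
    also have "\<dots> = ennreal (\<Prod>i\<in>UNIV. \<Prod>b\<in>Basis. (u $ i - l $ i) \<bullet> b)"
      using le' by (intro prod_ennreal prod_nonneg) (auto simp: inner_diff_left)
    also have "(\<Prod>i\<in>UNIV. \<Prod>b\<in>Basis. (u $ i - l $ i) \<bullet> b) = prod ((\<bullet>) (u - l)) (Basis :: 'n cvec set)"
    proof -
      have B: "(Basis :: 'n cvec set) = (\<Union>i\<in>UNIV. axis i ` Basis)"
        by (auto simp: Basis_vec_def)
      have "prod ((\<bullet>) (u - l)) (Basis :: 'n cvec set) = (\<Prod>i\<in>UNIV. prod ((\<bullet>) (u - l)) (axis i ` Basis))"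
        unfolding B
        by (rule prod.UNION_disjoint) (auto simp: axis_eq_axis)
      also have "\<dots> = (\<Prod>i\<in>UNIV. \<Prod>b\<in>Basis. (u $ i - l $ i) \<bullet> b)"
        by (intro prod.cong refl, subst prod.reindex)
           (auto simp: inner_axis inj_on_def axis_eq_axis)
      finally show ?thesis by simp
    qed
    finally show "emeasure (distr (PiM UNIV (\<lambda>_. lborel)) borel (\<lambda>v. \<chi> j. v j)) (box l u)
        = ennreal (prod ((\<bullet>) (u - l)) Basis)" .
  qed simp
qed

lemma heis_measurable [measurable]:
  assumes [measurable]: "g \<in> measurable M hmeas" "h \<in> borel_measurable M"
  shows "(\<lambda>x. heis z (g x) (h x)) \<in> borel_measurable M"
proof -
  have [measurable]: "(\<lambda>x. g x j) \<in> borel_measurable M" if "j \<noteq> last_ix" for j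
    using measurable_compose[OF assms(1) measurable_component_singleton[of j]] that by simp
  have "(\<lambda>x. (heis z (g x) (h x) $ j) \<bullet> b) \<in> borel_measurable M" for j b
    by (cases "j = last_ix") (simp_all add: heis_def)
  then show ?thesis
    by (subst borel_measurable_euclidean_space) (auto simp: Basis_vec_def inner_axis)
qed

text \<open>
  For fixed \<open>v\<close> the translation moves \<open>\<omega>\<close> by an amount that depends on \<open>v\<close> alone, so translation
  invariance applies first in the last coordinate and then in the others.
\<close>

lemma nn_integral_heis:
  fixes F :: "('n :: {finite, linorder}) cvec \<Rightarrow> ennreal"
  assumes [measurable]: "F \<in> borel_measurable borel"
  shows "(\<integral>\<^sup>+w. F w \<partial>lborel) = (\<integral>\<^sup>+v. \<integral>\<^sup>+\<omega>. F (heis z v \<omega>) \<partial>lborel \<partial>hmeas)"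
proof -
  interpret product_sigma_finite "\<lambda>_::'n. lborel :: complex measure" ..
  define c :: "'n cvec" where "c = (\<chi> j. if j = last_ix then 0 else z $ j)"
  define d where "d v = 2 * \<i> * (\<Sum>j\<in>UNIV - {last_ix}. v j * cnj (z $ j)) + \<i> * complex_of_real (sqn (($) z))" for v
  have [measurable]: "(\<lambda>v. \<chi> j. v j) \<in> borel_measurable (PiM UNIV (\<lambda>_::'n. lborel :: complex measure))"
    by (subst borel_measurable_euclidean_space) (auto simp: Basis_vec_def inner_axis)
  have ins: "insert last_ix (UNIV - {last_ix}) = (UNIV :: 'n set)"
    by auto
  have "(\<integral>\<^sup>+w. F w \<partial>lborel) = (\<integral>\<^sup>+w. F (c + w) \<partial>lborel)"
    by (simp add: nn_integral_lborel_plus)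
  also have "\<dots> = (\<integral>\<^sup>+v. F (c + (\<chi> j. v j)) \<partial>PiM UNIV (\<lambda>_. lborel))"
    by (subst distr_PiM_vec[symmetric]) (simp add: nn_integral_distr)
  also have "\<dots> = (\<integral>\<^sup>+v. \<integral>\<^sup>+\<omega>. F (c + (\<chi> j. (v(last_ix := \<omega>)) j)) \<partial>lborel \<partial>hmeas)"
    using product_nn_integral_insert[of "UNIV - {last_ix}" last_ix "\<lambda>v. F (c + (\<chi> j. v j))"]
    unfolding ins by simp
  also have "\<dots> = (\<integral>\<^sup>+v. \<integral>\<^sup>+\<omega>. F (heis z v \<omega>) \<partial>lborel \<partial>hmeas)"
  proof (rule nn_integral_cong)
    fix v :: "'n \<Rightarrow> complex" assume v: "v \<in> space hmeas"
    have eq: "c + (\<chi> j. (v(last_ix := d v + \<omega>)) j) = heis z v \<omega>" for \<omega>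
      by (simp add: vec_eq_iff c_def d_def heis_def)
    have "(\<lambda>\<omega>. c + (\<chi> j. (v(last_ix := \<omega>)) j)) \<in> borel_measurable borel"
    proof -
      have "(\<lambda>\<omega>. ((c + (\<chi> j. (v(last_ix := \<omega>)) j)) $ j) \<bullet> b) \<in> borel_measurable borel" for j b
        by (cases "j = last_ix") (simp_all add: c_def)
      then show ?thesis
        by (subst borel_measurable_euclidean_space) (auto simp: Basis_vec_def inner_axis)
    qed
    from measurable_compose[OF this assms]
    have "(\<integral>\<^sup>+\<omega>. F (c + (\<chi> j. (v(last_ix := d v + \<omega>)) j)) \<partial>lborel)
        = (\<integral>\<^sup>+\<omega>. F (c + (\<chi> j. (v(last_ix := \<omega>)) j)) \<partial>lborel)"
      by (rule nn_integral_lborel_plus)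
    then show "(\<integral>\<^sup>+\<omega>. F (c + (\<chi> j. (v(last_ix := \<omega>)) j)) \<partial>lborel) = (\<integral>\<^sup>+\<omega>. F (heis z v \<omega>) \<partial>lborel)"
      by (simp only: eq)
  qed
  finally show ?thesis .
qed

text \<open>
  The coordinates \<open>(v, s, u)\<close> adapted to \<open>z\<close>, in which \<open>s\<close> is the value of \<open>\<rho>\<close>.
\<close>

definition hcoord :: "('n :: {finite, linorder}) cvec \<Rightarrow> ('n \<Rightarrow> complex) \<times> real \<times> real \<Rightarrow> 'n cvec" where
  "hcoord z = (\<lambda>(v, s, u). heis z v (Complex u (s + sqn v)))"

abbreviation cmeas :: "(('n :: {finite, linorder} \<Rightarrow> complex) \<times> real \<times> real) measure" where
  "cmeas \<equiv> hmeas \<Otimes>\<^sub>M plane"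

lemma hcoord_measurable [measurable]: "hcoord z \<in> borel_measurable cmeas"
  unfolding hcoord_def case_prod_beta Complex_eq by measurable

lemma sigma_finite_hmeas: "sigma_finite_measure (hmeas :: ('n :: {finite, linorder} \<Rightarrow> complex) measure)"
proof -
  interpret product_sigma_finite "\<lambda>_::'n. lborel :: complex measure" ..
  show ?thesis by (rule sigma_finite) simp
qed

lemma sigma_finite_plane: "sigma_finite_measure plane"
  unfolding lborel_prod ..

lemma nn_integral_cmeas:
  fixes F :: "('n :: {finite, linorder} \<Rightarrow> complex) \<times> real \<times> real \<Rightarrow> ennreal"
  assumes [measurable]: "F \<in> borel_measurable cmeas"
  shows "(\<integral>\<^sup>+q. F q \<partial>cmeas) = (\<integral>\<^sup>+v. \<integral>\<^sup>+s. \<integral>\<^sup>+u. F (v, s, u) \<partial>lborel \<partial>lborel \<partial>hmeas)"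
proof -
  have "(\<integral>\<^sup>+q. F q \<partial>cmeas) = (\<integral>\<^sup>+v. \<integral>\<^sup>+p. F (v, p) \<partial>plane \<partial>hmeas)"
    by (rule sigma_finite_measure.nn_integral_fst[OF sigma_finite_plane, symmetric]) measurable
  also have "\<dots> = (\<integral>\<^sup>+v. \<integral>\<^sup>+s. \<integral>\<^sup>+u. F (v, s, u) \<partial>lborel \<partial>lborel \<partial>hmeas)"
    by (intro nn_integral_cong lborel.nn_integral_fst[symmetric]) measurable
  finally show ?thesis .
qed

lemma distr_hcoord: "distr cmeas borel (hcoord z) = (lborel :: ('n :: {finite, linorder}) cvec measure)"
proof (rule measure_eqI)
  fix A assume "A \<in> sets (distr cmeas borel (hcoord z))"
  then have [measurable]: "A \<in> sets borel" by simp
  have "emeasure (distr cmeas borel (hcoord z)) A = (\<integral>\<^sup>+w. indicator A w \<partial>distr cmeas borel (hcoord z))"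
    by simp
  also have "\<dots> = (\<integral>\<^sup>+q. indicator A (hcoord z q) \<partial>cmeas)"
    by (rule nn_integral_distr) measurable
  also have "\<dots> = (\<integral>\<^sup>+v. \<integral>\<^sup>+s. \<integral>\<^sup>+u. indicator A (hcoord z (v, s, u)) \<partial>lborel \<partial>lborel \<partial>hmeas)"
    by (rule nn_integral_cmeas) measurable
  also have "\<dots> = (\<integral>\<^sup>+v. \<integral>\<^sup>+\<omega>. indicator A (heis z v \<omega>) \<partial>lborel \<partial>hmeas)"
  proof (rule nn_integral_cong)
    fix v :: "'n \<Rightarrow> complex" assume [simp]: "v \<in> space hmeas"
    have [measurable]: "(\<lambda>\<omega>. heis z v \<omega>) \<in> borel_measurable borel"
      by (rule heis_measurable) auto
    have "(\<integral>\<^sup>+\<omega>. indicator A (heis z v \<omega>) \<partial>lborel)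
        = (\<integral>\<^sup>+s. \<integral>\<^sup>+u. indicator A (heis z v (Complex u s)) \<partial>lborel \<partial>lborel)"
      by (rule nn_integral_complex_lborel) measurable
    also have "\<dots> = (\<integral>\<^sup>+s. \<integral>\<^sup>+u. indicator A (heis z v (Complex u (sqn v + s))) \<partial>lborel \<partial>lborel)"
    proof (rule nn_integral_lborel_plus[symmetric])
      have "(\<lambda>(s, u). indicator A (heis z v (Complex u s)) :: ennreal) \<in> borel_measurable (borel \<Otimes>\<^sub>M borel)"
        unfolding case_prod_beta Complex_eq by measurable
      from lborel.borel_measurable_nn_integral[of "\<lambda>s u. indicator A (heis z v (Complex u s))" borel] this
      show "(\<lambda>s. \<integral>\<^sup>+u. indicator A (heis z v (Complex u s)) \<partial>lborel) \<in> borel_measurable borel"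
        by (simp cong: measurable_cong_sets)
    qed
    finally show "(\<integral>\<^sup>+s. \<integral>\<^sup>+u. indicator A (hcoord z (v, s, u)) \<partial>lborel \<partial>lborel)
        = (\<integral>\<^sup>+\<omega>. indicator A (heis z v \<omega>) \<partial>lborel)"
      by (simp add: hcoord_def add.commute)
  qed
  also have "\<dots> = (\<integral>\<^sup>+w. indicator A w \<partial>lborel)"
    by (rule nn_integral_heis[symmetric]) measurable
  finally show "emeasure (distr cmeas borel (hcoord z)) A = emeasure lborel A"
    by simp
qed simp

section \<open>Radial integration and averages over measure-preserving maps\<close>

text \<open>
  In polar coordinates \<open>dA = \<pi> d(|z|\<^sup>2)\<close> after integration over the angle. Here it is read off
  from the areas of discs, since the sets \<open>{..b}\<close> generate the Borel sets.
\<close>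

lemma distr_cmod_squared:
  "distr lborel borel (\<lambda>z::complex. (cmod z)\<^sup>2) = density lborel (\<lambda>q. ennreal pi * indicator {0<..} q)"
proof (rule measure_eqI_generator_eq[where \<Omega> = UNIV and E = "range (\<lambda>b::real. {..b})" and A = "\<lambda>i. {..real i}"])
  show "Int_stable (range (\<lambda>b::real. {..b}))"
    by (auto simp: Int_stable_def Int_atMost)
  have s: "sets borel = sigma_sets UNIV (range (\<lambda>b::real. {..b}))"
    by (simp add: borel_eq_atMost)
  show "sets (distr lborel borel (\<lambda>z::complex. (cmod z)\<^sup>2)) = sigma_sets UNIV (range (\<lambda>b::real. {..b}))"
    "sets (density lborel (\<lambda>q. ennreal pi * indicator {0<..} q)) = sigma_sets UNIV (range (\<lambda>b::real. {..b}))"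
    by (simp_all add: s)
  have e1: "emeasure (distr lborel borel (\<lambda>z::complex. (cmod z)\<^sup>2)) {..b} = ennreal pi * ennreal b" for b
  proof (cases "b < 0")
    case True
    then have "\<not> (cmod z)\<^sup>2 \<le> b" for z
      using zero_le_power2[of "cmod z"] by linarith
    then have "(\<lambda>z::complex. (cmod z)\<^sup>2) -` {..b} = {}"
      by auto
    with True show ?thesis
      by (subst emeasure_distr) (auto simp: ennreal_neg)
  next
    case False
    have "((cmod z)\<^sup>2 \<le> b) \<longleftrightarrow> cmod z \<le> sqrt b" for z
      using False real_le_rsqrt[of "cmod z" b] real_sqrt_le_iff[of "(cmod z)\<^sup>2" b] by auto
    then have "(\<lambda>z::complex. (cmod z)\<^sup>2) -` {..b} = cball 0 (sqrt b)"
      by auto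
    then show ?thesis
      using False
      by (subst emeasure_distr)
         (auto simp: emeasure_cball unit_ball_vol_2 ennreal_mult' real_sqrt_pow2)
  qed
  have e2: "emeasure (density lborel (\<lambda>q. ennreal pi * indicator {0<..} q)) {..b} = ennreal pi * ennreal b" for b
  proof -
    have "emeasure (density lborel (\<lambda>q. ennreal pi * indicator {0<..} q)) {..b}
        = (\<integral>\<^sup>+q. ennreal pi * indicator {0<..b} q \<partial>lborel)"
      by (subst emeasure_density) (auto intro!: nn_integral_cong simp: indicator_def)
    also have "\<dots> = ennreal pi * ennreal b"
      by (cases "0 \<le> b") (auto simp: nn_integral_cmult ennreal_neg)
    finally show ?thesis .
  qed
  show "emeasure (distr lborel borel (\<lambda>z::complex. (cmod z)\<^sup>2)) X
      = emeasure (density lborel (\<lambda>q. ennreal pi * indicator {0<..} q)) X" if "X \<in> range (\<lambda>b::real. {..b})" for X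
    using that e1 e2 by auto
  show "emeasure (distr lborel borel (\<lambda>z::complex. (cmod z)\<^sup>2)) {..real i} \<noteq> \<infinity>" for i
    by (simp add: e1 ennreal_mult_eq_top_iff)
  show "(\<Union>i. {..real i}) = UNIV"
    using real_arch_simple by auto
qed auto

lemma nn_integral_powr_from_0:
  fixes l r :: real
  assumes "l > -1" "0 \<le> r"
  shows "(\<integral>\<^sup>+s. indicator {0<..<r} s * ennreal (s powr l) \<partial>lborel) = ennreal (r powr (l + 1) / (l + 1))"
proof -
  have "(\<integral>\<^sup>+s. indicator {0<..<r} s * ennreal (s powr l) \<partial>lborel)
      = (\<integral>\<^sup>+s. indicator {0..r} s * ennreal (s powr l) \<partial>lborel)"
  proof (rule nn_integral_cong_AE)
    show "AE s in lborel. indicator {0<..<r} s * ennreal (s powr l) = indicator {0..r} s * ennreal (s powr l)"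
      using AE_lborel_singleton[of 0] AE_lborel_singleton[of r]
      by eventually_elim (auto simp: indicator_def)
  qed
  also have "\<dots> = ennreal (r powr (l + 1) / (l + 1))"
    using nn_integral_has_integral_lebesgue'[OF _ has_integral_powr_from_0[OF assms]]
    by (simp add: mult.commute)
  finally show ?thesis .
qed

text \<open>
  The substitution \<open>r = s + |z|\<^sup>2\<close>, where \<open>|z|\<^sup>2\<close> has density \<open>\<pi>\<close>: for fixed \<open>r\<close> the variable \<open>s\<close>
  ranges over \<open>(0, r)\<close>, and the integral of \<open>s\<^sup>l\<close> over this interval is \<open>r\<^sup>l\<^sup>+\<^sup>1/(l + 1)\<close>.
\<close>

lemma nn_integral_radial_step:
  fixes l :: real and \<phi> :: "real \<Rightarrow> ennreal"
  assumes l: "l > -1" and [measurable]: "\<phi> \<in> borel_measurable borel"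
  shows "(\<integral>\<^sup>+z. \<integral>\<^sup>+s. indicator {0<..} s * ennreal (s powr l) * \<phi> (s + (cmod z)\<^sup>2) \<partial>lborel \<partial>(lborel :: complex measure))
    = ennreal (pi / (l + 1)) * (\<integral>\<^sup>+r. indicator {0<..} r * ennreal (r powr (l + 1)) * \<phi> r \<partial>lborel)"
proof -
  define \<psi> where "\<psi> q = (\<integral>\<^sup>+s. indicator {0<..} s * ennreal (s powr l) * \<phi> (s + q) \<partial>lborel)" for q
  have [measurable]: "\<psi> \<in> borel_measurable borel"
    unfolding \<psi>_def by measurable
  have "(\<integral>\<^sup>+z. \<psi> ((cmod z)\<^sup>2) \<partial>lborel) = (\<integral>\<^sup>+q. \<psi> q \<partial>distr lborel borel (\<lambda>z::complex. (cmod z)\<^sup>2))"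
    by (simp add: nn_integral_distr)
  also have "\<dots> = (\<integral>\<^sup>+q. ennreal pi * (indicator {0<..} q * \<psi> q) \<partial>lborel)"
    unfolding distr_cmod_squared by (subst nn_integral_density) (auto simp: mult.assoc)
  also have "\<dots> = ennreal pi * (\<integral>\<^sup>+q. indicator {0<..} q * \<psi> q \<partial>lborel)"
    by (rule nn_integral_cmult) measurable
  also have "(\<integral>\<^sup>+q. indicator {0<..} q * \<psi> q \<partial>lborel)
      = (\<integral>\<^sup>+q. \<integral>\<^sup>+s. indicator {0<..} q * (indicator {0<..} s * ennreal (s powr l) * \<phi> (s + q)) \<partial>lborel \<partial>lborel)"
    unfolding \<psi>_def by (intro nn_integral_cong nn_integral_cmult[symmetric]) measurable
  also have "\<dots> = (\<integral>\<^sup>+s. \<integral>\<^sup>+q. indicator {0<..} q * (indicator {0<..} s * ennreal (s powr l) * \<phi> (s + q)) \<partial>lborel \<partial>lborel)"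
    by (rule lborel_pair.Fubini') measurable
  also have "\<dots> = (\<integral>\<^sup>+s. \<integral>\<^sup>+r. indicator {0<..<r} s * ennreal (s powr l) * \<phi> r \<partial>lborel \<partial>lborel)"
  proof (rule nn_integral_cong)
    fix s :: real
    have "(\<integral>\<^sup>+r. indicator {0<..<r} s * ennreal (s powr l) * \<phi> r \<partial>lborel)
        = (\<integral>\<^sup>+q. indicator {0<..<s + q} s * ennreal (s powr l) * \<phi> (s + q) \<partial>lborel)"
      by (rule nn_integral_lborel_plus[symmetric]) (simp add: greaterThanLessThan_def lessThan_def)
    then show "(\<integral>\<^sup>+q. indicator {0<..} q * (indicator {0<..} s * ennreal (s powr l) * \<phi> (s + q)) \<partial>lborel)
        = (\<integral>\<^sup>+r. indicator {0<..<r} s * ennreal (s powr l) * \<phi> r \<partial>lborel)"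
      by (auto intro!: nn_integral_cong simp: indicator_def)
  qed
  also have "\<dots> = (\<integral>\<^sup>+r. \<integral>\<^sup>+s. indicator {0<..<r} s * ennreal (s powr l) * \<phi> r \<partial>lborel \<partial>lborel)"
    by (rule lborel_pair.Fubini') (simp add: greaterThanLessThan_def lessThan_def)
  also have "\<dots> = (\<integral>\<^sup>+r. ennreal (1 / (l + 1)) * (indicator {0<..} r * ennreal (r powr (l + 1)) * \<phi> r) \<partial>lborel)"
  proof (rule nn_integral_cong)
    fix r :: real
    have "(\<integral>\<^sup>+s. indicator {0<..<r} s * ennreal (s powr l) * \<phi> r \<partial>lborel)
        = (\<integral>\<^sup>+s. indicator {0<..<r} s * ennreal (s powr l) \<partial>lborel) * \<phi> r"
      by (rule nn_integral_multc) measurable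
    also have "\<dots> = ennreal (1 / (l + 1)) * (indicator {0<..} r * ennreal (r powr (l + 1)) * \<phi> r)"
    proof (cases "r > 0")
      case True
      then show ?thesis
        using l by (simp add: nn_integral_powr_from_0 mult.assoc[symmetric] flip: ennreal_mult')
    qed auto
    finally show "(\<integral>\<^sup>+s. indicator {0<..<r} s * ennreal (s powr l) * \<phi> r \<partial>lborel)
        = ennreal (1 / (l + 1)) * (indicator {0<..} r * ennreal (r powr (l + 1)) * \<phi> r)" .
  qed
  also have "\<dots> = ennreal (1 / (l + 1)) * (\<integral>\<^sup>+r. indicator {0<..} r * ennreal (r powr (l + 1)) * \<phi> r \<partial>lborel)"
    by (rule nn_integral_cmult) measurable
  finally have "(\<integral>\<^sup>+z. \<psi> ((cmod z)\<^sup>2) \<partial>lborel)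
     = ennreal pi * (ennreal (1 / (l + 1)) * (\<integral>\<^sup>+r. indicator {0<..} r * ennreal (r powr (l + 1)) * \<phi> r \<partial>lborel))" .
  then show ?thesis
    using l by (simp add: \<psi>_def mult.assoc[symmetric] flip: ennreal_mult')
qed

text \<open>
  Each complex coordinate raises the exponent by one and contributes \<open>\<pi>/(l + 1)\<close> with the
  current exponent \<open>l\<close>; the product of these factors is a quotient of Gamma values.
\<close>

lemma nn_integral_radial:
  fixes l :: real and \<phi> :: "real \<Rightarrow> ennreal" and I :: "'i set"
  assumes "finite I" and "l > -1" and "\<phi> \<in> borel_measurable borel"
  shows "(\<integral>\<^sup>+v. \<integral>\<^sup>+s. indicator {0<..} s * ennreal (s powr l) * \<phi> (s + (\<Sum>j\<in>I. (cmod (v j))\<^sup>2)) \<partial>lborel \<partial>PiM I (\<lambda>_. lborel))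
    = ennreal (pi ^ card I * Gamma (1 + l) / Gamma (1 + l + real (card I)))
        * (\<integral>\<^sup>+r. indicator {0<..} r * ennreal (r powr (l + real (card I))) * \<phi> r \<partial>lborel)"
  using assms
proof (induction I arbitrary: l rule: finite_induct)
  case empty
  then have "Gamma (1 + l) > 0"
    by (intro Gamma_real_pos) auto
  interpret product_sigma_finite "\<lambda>_::'i. lborel :: complex measure" ..
  from \<open>Gamma (1 + l) > 0\<close> show ?case by (subst nn_integral_empty) simp_all
next
  case (insert i I)
  note [measurable] = insert.prems(2)
  interpret product_sigma_finite "\<lambda>_::'i. lborel :: complex measure" ..
  let ?c = "ennreal (pi / (l + 1))"
  let ?d = "ennreal (pi ^ card I * Gamma (2 + l) / Gamma (2 + l + real (card I)))"
  let ?R = "\<integral>\<^sup>+r. indicator {0<..} r * ennreal (r powr (l + 1 + real (card I))) * \<phi> r \<partial>lborel"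
  have "(\<integral>\<^sup>+v. \<integral>\<^sup>+s. indicator {0<..} s * ennreal (s powr l) * \<phi> (s + (\<Sum>j\<in>insert i I. (cmod (v j))\<^sup>2)) \<partial>lborel \<partial>PiM (insert i I) (\<lambda>_. lborel))
    = (\<integral>\<^sup>+v. \<integral>\<^sup>+z. \<integral>\<^sup>+s. indicator {0<..} s * ennreal (s powr l) * \<phi> (s + (\<Sum>j\<in>insert i I. (cmod ((v(i := z)) j))\<^sup>2)) \<partial>lborel \<partial>lborel \<partial>PiM I (\<lambda>_. lborel))"
    using insert.hyps by (intro product_nn_integral_insert) measurable
  also have "\<dots> = (\<integral>\<^sup>+v. ?c * (\<integral>\<^sup>+s. indicator {0<..} s * ennreal (s powr (l + 1)) * \<phi> (s + (\<Sum>j\<in>I. (cmod (v j))\<^sup>2)) \<partial>lborel) \<partial>PiM I (\<lambda>_. lborel))"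
  proof (rule nn_integral_cong)
    fix v :: "'i \<Rightarrow> complex"
    have "(\<Sum>j\<in>insert i I. (cmod ((v(i := z)) j))\<^sup>2) = (cmod z)\<^sup>2 + (\<Sum>j\<in>I. (cmod (v j))\<^sup>2)" for z
    proof -
      have "(\<Sum>j\<in>I. (cmod ((v(i := z)) j))\<^sup>2) = (\<Sum>j\<in>I. (cmod (v j))\<^sup>2)"
        using insert.hyps by (intro sum.cong) auto
      then show ?thesis using insert.hyps by simp
    qed
    then show "(\<integral>\<^sup>+z. \<integral>\<^sup>+s. indicator {0<..} s * ennreal (s powr l) * \<phi> (s + (\<Sum>j\<in>insert i I. (cmod ((v(i := z)) j))\<^sup>2)) \<partial>lborel \<partial>lborel)
        = ?c * (\<integral>\<^sup>+s. indicator {0<..} s * ennreal (s powr (l + 1)) * \<phi> (s + (\<Sum>j\<in>I. (cmod (v j))\<^sup>2)) \<partial>lborel)"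
      using nn_integral_radial_step[OF insert.prems(1), of "\<lambda>r. \<phi> (r + (\<Sum>j\<in>I. (cmod (v j))\<^sup>2))"]
      by (simp add: add.assoc)
  qed
  also have "\<dots> = ?c * (\<integral>\<^sup>+v. \<integral>\<^sup>+s. indicator {0<..} s * ennreal (s powr (l + 1)) * \<phi> (s + (\<Sum>j\<in>I. (cmod (v j))\<^sup>2)) \<partial>lborel \<partial>PiM I (\<lambda>_. lborel))"
    by (rule nn_integral_cmult) measurable
  also have "\<dots> = ?c * (?d * ?R)"
    using insert.IH[of "l + 1"] insert.prems by (simp add: add.assoc[symmetric])
  also have "\<dots> = ennreal ((pi / (l + 1)) * (pi ^ card I * Gamma (2 + l) / Gamma (2 + l + real (card I)))) * ?R"
    using insert.prems(1)
    by (simp add: mult.assoc[symmetric] ennreal_mult'[symmetric])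
  also have "(pi / (l + 1)) * (pi ^ card I * Gamma (2 + l) / Gamma (2 + l + real (card I)))
      = pi ^ card (insert i I) * Gamma (1 + l) / Gamma (1 + l + real (card (insert i I)))"
  proof -
    have "1 + l \<notin> \<int>\<^sub>\<le>\<^sub>0"
      using insert.prems(1) nonpos_Ints_nonpos[of "1 + l"] by auto
    then have "Gamma (1 + l + 1) = (1 + l) * Gamma (1 + l)"
      by (rule Gamma_plus1)
    then have "Gamma (2 + l) = (l + 1) * Gamma (1 + l)"
      by (simp add: add_ac)
    then show ?thesis
      using insert.hyps insert.prems(1) by (simp add: add_ac)
  qed
  finally show ?case
    using insert.hyps by (simp add: add_ac)
qed

text \<open>
  The preceding lemma as an identity of measures. In this form it also applies to complex-valued
  integrands.
\<close>

lemma distr_cmeas_radial: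
  fixes l :: real
  assumes l: "l > -1"
  defines "m \<equiv> CARD('n :: {finite, linorder}) - 1"
  shows "distr (density (cmeas :: (('n \<Rightarrow> complex) \<times> real \<times> real) measure) (\<lambda>(v, s, u). indicator {0<..} s * ennreal (s powr l)))
           plane (\<lambda>(v, s, u). (s + sqn v, u))
    = density plane (\<lambda>(r, u). ennreal (pi ^ m * Gamma (1 + l) / Gamma (1 + l + real m))
         * (indicator {0<..} r * ennreal (r powr (l + real m))))"
    (is "distr ?M ?L ?T = ?D")
proof (rule measure_eqI)
  have m: "m = card (UNIV - {last_ix :: 'n})"
    by (simp add: m_def card_Diff_singleton)
  let ?c = "ennreal (pi ^ m * Gamma (1 + l) / Gamma (1 + l + real m))"
  fix A assume "A \<in> sets (distr ?M ?L ?T)"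
  then have [measurable]: "A \<in> sets (borel \<Otimes>\<^sub>M borel)"
    by (simp cong: sets_pair_measure_cong)
  define \<phi> where "\<phi> r = (\<integral>\<^sup>+u. indicator A (r, u) \<partial>lborel)" for r
  have [measurable]: "\<phi> \<in> borel_measurable borel"
    unfolding \<phi>_def by measurable
  have "emeasure (distr ?M ?L ?T) A = (\<integral>\<^sup>+p. indicator A p \<partial>distr ?M ?L ?T)"
    by (simp cong: sets_pair_measure_cong)
  also have "\<dots> = (\<integral>\<^sup>+q. indicator A (?T q) \<partial>?M)"
    by (rule nn_integral_distr) measurable
  also have "\<dots> = (\<integral>\<^sup>+q. (indicator {0<..} (fst (snd q)) * ennreal (fst (snd q) powr l)) * indicator A (?T q) \<partial>cmeas)"
    unfolding case_prod_beta by (rule nn_integral_density) measurable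
  also have "\<dots> = (\<integral>\<^sup>+v. \<integral>\<^sup>+s. \<integral>\<^sup>+u. indicator {0<..} s * ennreal (s powr l) * indicator A (s + sqn v, u) \<partial>lborel \<partial>lborel \<partial>(hmeas :: ('n \<Rightarrow> complex) measure))"
    by (subst nn_integral_cmeas) (auto simp: case_prod_beta)
  also have "\<dots> = (\<integral>\<^sup>+v. \<integral>\<^sup>+s. indicator {0<..} s * ennreal (s powr l) * \<phi> (s + sqn v) \<partial>lborel \<partial>(hmeas :: ('n \<Rightarrow> complex) measure))"
    unfolding \<phi>_def by (intro nn_integral_cong nn_integral_cmult) measurable
  also have "\<dots> = ?c * (\<integral>\<^sup>+r. indicator {0<..} r * ennreal (r powr (l + real m)) * \<phi> r \<partial>lborel)"
    unfolding sqn_def m by (rule nn_integral_radial) (use l in auto)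
  also have "\<dots> = (\<integral>\<^sup>+r. \<integral>\<^sup>+u. ?c * (indicator {0<..} r * ennreal (r powr (l + real m))) * indicator A (r, u) \<partial>lborel \<partial>lborel)"
    unfolding \<phi>_def by (simp add: nn_integral_cmult mult.assoc)
  also have "\<dots> = (\<integral>\<^sup>+p. ?c * (indicator {0<..} (fst p) * ennreal (fst p powr (l + real m))) * indicator A p \<partial>?L)"
    by (subst lborel.nn_integral_fst[symmetric]) auto
  also have "\<dots> = emeasure ?D A"
    by (subst emeasure_density) (auto simp: case_prod_beta cong: sets_pair_measure_cong)
  finally show "emeasure (distr ?M ?L ?T) A = emeasure ?D A" .
qed simp

text \<open>
  Every \<open>R t\<close> preserves the measure, so the integral of \<open>\<phi> \<circ> R t\<close> does not depend on \<open>t\<close>, and its mean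
  over \<open>t\<close> may be taken under the integral sign. It is used for rotations, where the mean value
  property evaluates the inner integral, and for translations of the real line.
\<close>

lemma integral_flow_average:
  fixes \<phi> :: "'a \<Rightarrow> complex" and R :: "real \<Rightarrow> 'a \<Rightarrow> 'a"
  assumes M: "sigma_finite_measure M"
    and R: "\<And>t. R t \<in> measurable M M" "\<And>t. distr M M (R t) = M"
    and \<phi>: "integrable M \<phi>"
    and meas: "(\<lambda>(t, x). \<phi> (R t x)) \<in> borel_measurable (lborel \<Otimes>\<^sub>M M)"
  shows "integrable M (\<lambda>x. \<integral>t. indicator {0..1} t *\<^sub>R \<phi> (R t x) \<partial>lborel)"
    and "(\<integral>x. (\<integral>t. indicator {0..1} t *\<^sub>R \<phi> (R t x) \<partial>lborel) \<partial>M) = (\<integral>x. \<phi> x \<partial>M)"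
proof -
  interpret M: sigma_finite_measure M by fact
  interpret P: pair_sigma_finite lborel M ..
  note [measurable] = R(1) meas borel_measurable_integrable[OF \<phi>]
  have R'1: "integrable M (\<lambda>x. \<phi> (R t x))" and R'2: "(\<integral>x. \<phi> (R t x) \<partial>M) = (\<integral>x. \<phi> x \<partial>M)"
    and R'3: "(\<integral>x. cmod (\<phi> (R t x)) \<partial>M) = (\<integral>x. cmod (\<phi> x) \<partial>M)" for t
    using \<phi> R(2)[of t] integrable_distr_eq[OF R(1)[of t], of \<phi>] integral_distr[OF R(1)[of t], of \<phi>]
      integral_distr[OF R(1)[of t], of "\<lambda>x. cmod (\<phi> x)"] by simp_all
  have int: "integrable (lborel \<Otimes>\<^sub>M M) (\<lambda>(t, x). indicator {0..1} t *\<^sub>R \<phi> (R t x))"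
  proof (rule P.Fubini_integrable)
    show "(\<lambda>(t, x). indicator {0..1} t *\<^sub>R \<phi> (R t x)) \<in> borel_measurable (lborel \<Otimes>\<^sub>M M)"
      using meas by (simp add: case_prod_beta)
    have "(\<integral>x. norm (case (t, x) of (t, x) \<Rightarrow> indicator {0..1} t *\<^sub>R \<phi> (R t x)) \<partial>M)
        = indicator {0..1} t * (\<integral>x. norm (\<phi> x) \<partial>M)" for t :: real
      using R'3 by simp
    then show "integrable lborel (\<lambda>t. \<integral>x. norm (case (t, x) of (t, x) \<Rightarrow> indicator {0..1} t *\<^sub>R \<phi> (R t x)) \<partial>M)"
      by (simp add: R'3)
    show "AE t in lborel. integrable M (\<lambda>x. case (t, x) of (t, x) \<Rightarrow> indicator {0..1} t *\<^sub>R \<phi> (R t x))"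
      using R'1 by simp
  qed
  show "integrable M (\<lambda>x. \<integral>t. indicator {0..1} t *\<^sub>R \<phi> (R t x) \<partial>lborel)"
    using P.integrable_snd[OF int] .
  have "(\<integral>x. (\<integral>t. indicator {0..1} t *\<^sub>R \<phi> (R t x) \<partial>lborel) \<partial>M)
      = (\<integral>t. (\<integral>x. indicator {0..1} t *\<^sub>R \<phi> (R t x) \<partial>M) \<partial>lborel)"
    using P.Fubini_integral[OF int] .
  also have "\<dots> = (\<integral>t. indicator {0..1::real} t *\<^sub>R (\<integral>x. \<phi> x \<partial>M) \<partial>lborel)"
    by (simp only: integral_scaleR_right R'2)
  also have "\<dots> = (\<integral>x. \<phi> x \<partial>M)"
    by simp
  finally show "(\<integral>x. (\<integral>t. indicator {0..1} t *\<^sub>R \<phi> (R t x) \<partial>lborel) \<partial>M) = (\<integral>x. \<phi> x \<partial>M)" .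
qed

definition hrot :: "real \<Rightarrow> ('n :: {finite, linorder} \<Rightarrow> complex) \<times> real \<times> real \<Rightarrow> ('n \<Rightarrow> complex) \<times> real \<times> real" where
  "hrot t = (\<lambda>(v, s, u). ((\<lambda>j\<in>UNIV - {last_ix}. cis (2 * pi * t) * v j), s, u))"

lemma hrot_measurable [measurable]: "hrot t \<in> measurable cmeas cmeas"
  unfolding hrot_def case_prod_beta by measurable

lemma distr_hrot:
  "distr cmeas cmeas (hrot t) = (cmeas :: (('n :: {finite, linorder} \<Rightarrow> complex) \<times> real \<times> real) measure)"
proof -
  let ?h = "hmeas :: ('n \<Rightarrow> complex) measure"
  have "distr ?h ?h (\<lambda>v. \<lambda>j\<in>UNIV - {last_ix}. cis (2 * pi * t) * v j) \<Otimes>\<^sub>M distr plane plane (\<lambda>x::real\<times>real. x)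
    = distr (?h \<Otimes>\<^sub>M plane) (?h \<Otimes>\<^sub>M plane)
       (\<lambda>(v, p). ((\<lambda>j\<in>UNIV - {last_ix}. cis (2 * pi * t) * v j), p))"
    by (rule pair_measure_distr) (measurable, simp add: distr_id2 sigma_finite_plane)
  then show ?thesis
    by (simp add: distr_PiM_rotation distr_id2 hrot_def case_prod_beta)
qed

section \<open>Averages of holomorphic functions over circles and discs\<close>

text \<open>
  Cauchy's formula for derivatives, with the contour integral written as a Lebesgue integral over
  \<open>[0, 1]\<close> so that Fubini's theorem can be applied to it.
\<close>

lemma higher_deriv_circle_average:
  assumes S: "open S" "f holomorphic_on S" "cball z r \<subseteq> S" and r: "0 < r"
  shows "(deriv ^^ k) f z = of_real (fact k / r ^ k) *
    (\<integral>t. indicator {0..1} t *\<^sub>R (cis (- (2 * pi * real k * t)) * f (z + of_real r * cis (2 * pi * t))) \<partial>lborel)"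
proof -
  have cont: "continuous_on (cball z r) f"
    using S holomorphic_on_imp_continuous_on holomorphic_on_subset by blast
  have exp_cis: "exp (2 * of_real pi * \<i> * of_real t) = cis (2 * pi * t)" for t
    by (simp add: cis_conv_exp mult_ac)
  let ?h = "\<lambda>t. cis (- (2 * pi * real k * t)) * f (z + of_real r * cis (2 * pi * t))"
  have "contour_integral (circlepath z r) (\<lambda>u. f u / (u - z) ^ Suc k)
      = integral {0..1} (\<lambda>t. (2 * pi * \<i> / r ^ k) * ?h t)"
    unfolding contour_integral_integral vector_derivative_circlepath
  proof (rule integral_cong)
    fix t :: real
    have "cis (2 * pi * t) ^ k * cis (- (2 * pi * real k * t)) = 1"
      by (simp add: Complex.DeMoivre cis_mult mult_ac)
    then have "cis (- (2 * pi * real k * t)) = 1 / cis (2 * pi * t) ^ k"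
      by (simp add: field_simps)
    then show "f (circlepath z r t) / (circlepath z r t - z) ^ Suc k
          * (2 * pi * \<i> * r * exp (2 * of_real pi * \<i> * t))
        = (2 * pi * \<i> / r ^ k) * ?h t"
      using r unfolding circlepath exp_cis
      by (simp add: power_mult_distrib field_simps)
  qed
  also have "\<dots> = (2 * pi * \<i> / r ^ k) * integral {0..1} ?h"
    by (rule integral_mult_right)
  also have "integral {0..1} ?h = (\<integral>t. indicator {0..1} t *\<^sub>R ?h t \<partial>lborel)"
  proof -
    have "continuous_on {0..1} (\<lambda>t. f (z + of_real r * cis (2 * pi * t)))"
      by (rule continuous_on_compose2[OF cont])
         (use r in \<open>auto intro!: continuous_intros simp: dist_norm norm_mult\<close>)
    then have "set_integrable lborel {0..1} ?h"
      by (intro borel_integrable_atLeastAtMost' continuous_intros) auto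
    from set_borel_integral_eq_integral(2)[OF this] show ?thesis
      by (simp add: set_lebesgue_integral_def)
  qed
  finally have "contour_integral (circlepath z r) (\<lambda>u. f u / (u - z) ^ Suc k)
      = (2 * pi * \<i> / r ^ k) * (\<integral>t. indicator {0..1} t *\<^sub>R ?h t \<partial>lborel)" .
  note CI = this
  have "(deriv ^^ k) f z = fact k / (2 * pi * \<i>) * contour_integral (circlepath z r) (\<lambda>u. f u / (u - z) ^ Suc k)"
    using r order_trans[OF ball_subset_cball S(3)]
    by (intro Cauchy_higher_derivative_integral_circlepath cont holomorphic_on_subset[OF S(2)]) auto
  also have "\<dots> = fact k / (2 * pi * \<i>) * ((2 * pi * \<i> / r ^ k) * (\<integral>t. indicator {0..1} t *\<^sub>R ?h t \<partial>lborel))"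
    by (simp only: CI)
  also have "fact k / (2 * pi * \<i>) * ((2 * pi * \<i> / r ^ k) * X) = of_real (fact k / r ^ k) * X" for X
    using r by (simp add: field_simps)
  finally show ?thesis .
qed

lemma unit_circle_average:
  assumes "open S" "f holomorphic_on S" "cball 0 1 \<subseteq> S"
  shows "(\<integral>t. indicator {0..1} t *\<^sub>R f (cis (2 * pi * t)) \<partial>lborel) = f 0"
  using higher_deriv_circle_average[OF assms, of 0] by simp

text \<open>
  The rotation average of \<open>f(z + v)\<close> over \<open>|v| \<le> r\<close> is \<open>f(z)\<close> at every \<open>v\<close>.
\<close>

lemma disc_mean_bound:
  assumes S: "open S" "f holomorphic_on S" "cball z r \<subseteq> S" and r: "0 < r"
  shows "pi * r\<^sup>2 * cmod (f z) \<le> (\<integral>w. indicator (cball z r) w * cmod (f w) \<partial>lborel)"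
proof -
  define g where "g w = indicator (cball z r) w *\<^sub>R f w" for w
  have cont: "continuous_on (cball z r) f"
    using S holomorphic_on_imp_continuous_on holomorphic_on_subset by blast
  have int: "integrable lborel g"
    unfolding g_def by (rule borel_integrable_compact) (auto intro: cont)
  then have [measurable]: "g \<in> borel_measurable borel"
    by (auto dest: borel_measurable_integrable)
  have int': "integrable lborel (\<lambda>v. g (z + v))" "(\<integral>v. g (z + v) \<partial>lborel) = (\<integral>w. g w \<partial>lborel)"
    using int integrable_distr_eq[of "(+) z" lborel borel g] integral_distr[of "(+) z" lborel borel g]
    by (simp_all add: lborel_distr_plus)
  have avg: "(\<integral>t. indicator {0..1} t *\<^sub>R g (z + cis (2 * pi * t) * v) \<partial>lborel) = indicator (cball 0 r) v *\<^sub>R f z" for v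
  proof (cases "v \<in> cball 0 r")
    case True
    define T where "T = (\<lambda>\<xi>. z + \<xi> * v) -` S"
    have "open T"
      unfolding T_def using S by (intro continuous_open_vimage) (auto intro!: continuous_intros)
    moreover have "(\<lambda>\<xi>. f (z + \<xi> * v)) holomorphic_on T"
      using S(2) by (intro holomorphic_on_compose_gen[OF _ S(2), unfolded o_def] holomorphic_intros)
        (auto simp: T_def)
    moreover have "cball 0 1 \<subseteq> T"
    proof
      fix \<xi> :: complex assume "\<xi> \<in> cball 0 1"
      then have "cmod \<xi> * cmod v \<le> 1 * r"
        using True by (intro mult_mono) auto
      then show "\<xi> \<in> T"
        using S(3) by (auto simp: T_def dist_norm norm_mult subset_iff)
    qed
    ultimately have "(\<integral>t. indicator {0..1} t *\<^sub>R f (z + cis (2 * pi * t) * v) \<partial>lborel) = f z"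
      using unit_circle_average[of T "\<lambda>\<xi>. f (z + \<xi> * v)"] by simp
    then show ?thesis
      using True by (simp add: g_def dist_norm norm_mult)
  next
    case False
    then show ?thesis by (simp add: g_def dist_norm norm_mult)
  qed
  have rot: "distr lborel lborel (\<lambda>v. cis (2 * pi * t) * v) = (lborel :: complex measure)" for t
  proof (rule measure_eqI)
    fix A assume "A \<in> sets (distr lborel lborel (\<lambda>v. cis (2 * pi * t) * v))"
    then have [measurable]: "A \<in> sets borel" by simp
    have "emeasure (distr lborel lborel (\<lambda>v. cis (2 * pi * t) * v)) A
        = (\<integral>\<^sup>+v. indicator A v \<partial>distr lborel lborel (\<lambda>v. cis (2 * pi * t) * v))"
      by simp
    also have "\<dots> = (\<integral>\<^sup>+v. indicator A (cis (2 * pi * t) * v) \<partial>lborel)"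
      by (rule nn_integral_distr) auto
    also have "\<dots> = emeasure lborel A"
      by (subst nn_integral_rotation) auto
    finally show "emeasure (distr lborel lborel (\<lambda>v. cis (2 * pi * t) * v)) A = emeasure lborel A" .
  qed simp
  have "(\<lambda>(t, x). g (z + cis (2 * pi * t) * x)) \<in> borel_measurable (lborel \<Otimes>\<^sub>M lborel)"
  proof -
    have [measurable]: "(\<lambda>p. cis (2 * pi * fst p)) \<in> borel_measurable (borel \<Otimes>\<^sub>M borel :: (real \<times> complex) measure)"
      by (intro borel_measurable_continuous_onI[THEN measurable_compose[OF measurable_fst]]) (auto intro!: continuous_intros)
    show ?thesis
      unfolding case_prod_beta by measurable
  qed
  from integral_flow_average(2)[OF _ _ rot int'(1) this]
  have "(\<integral>v. indicator (cball (0::complex) r) v *\<^sub>R f z \<partial>lborel) = (\<integral>w. g w \<partial>lborel)"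
    unfolding avg by (simp add: int'(2) lborel.sigma_finite_measure_axioms)
  moreover have "(\<integral>v. indicator (cball (0::complex) r) v *\<^sub>R f z \<partial>lborel) = of_real (pi * r\<^sup>2) * f z"
    using r by (simp add: measure_def emeasure_cball unit_ball_vol_2 scaleR_conv_of_real)
  ultimately have "of_real (pi * r\<^sup>2) * f z = (\<integral>w. g w \<partial>lborel)"
    by simp
  then have "pi * r\<^sup>2 * cmod (f z) = cmod (\<integral>w. g w \<partial>lborel)"
    using r by (metis abs_of_nonneg norm_mult norm_of_real mult_nonneg_nonneg pi_ge_zero zero_le_power2)
  also have "\<dots> \<le> (\<integral>w. cmod (g w) \<partial>lborel)"
    by (rule integral_norm_bound)
  also have "\<dots> = (\<integral>w. indicator (cball z r) w * cmod (f w) \<partial>lborel)"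
    by (simp add: g_def)
  finally show ?thesis .
qed

text \<open>
  The integral of \<open>F(x + 1) - F(x)\<close> vanishes by translation invariance, and this difference is the
  average of the translates of \<open>F'\<close> by \<open>t \<in> [0, 1]\<close>, which has the same integral as \<open>F'\<close>.
\<close>

lemma integral_derivative_eq_0:
  fixes F F' :: "real \<Rightarrow> complex"
  assumes F: "\<And>x. (F has_vector_derivative F' x) (at x)" "continuous_on UNIV F'"
    and int: "integrable lborel F" "integrable lborel F'"
  shows "(\<integral>x. F' x \<partial>lborel) = 0"
proof -
  have [measurable]: "F' \<in> borel_measurable borel"
    using F(2) by (rule borel_measurable_continuous_onI)
  have ftc: "(\<integral>t. indicator {0..1} t *\<^sub>R F' (t + x) \<partial>lborel) = F (1 + x) - F x" for x
  proof -
    have d: "((\<lambda>t. F (t + x)) has_vector_derivative F' (t + x)) (at t)" for t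
    proof -
      have "((\<lambda>t. t + x) has_vector_derivative 1) (at t)"
        by (auto intro!: derivative_eq_intros simp: has_real_derivative_iff_has_vector_derivative[symmetric])
      from vector_diff_chain_at[OF this F(1)] show ?thesis
        by (simp add: o_def)
    qed
    have "continuous_on {0..1} (\<lambda>t. F' (t + x))"
      using F(2) by (intro continuous_on_compose2[OF F(2)] continuous_intros) auto
    from integral_FTC_Icc[OF _ _ this, of "\<lambda>t. F (t + x)"] d show ?thesis
      by (simp add: has_vector_derivative_at_within)
  qed
  have "distr lborel lborel ((+) t) = (lborel :: real measure)" for t
    using lborel_distr_plus[of t] by (simp cong: distr_cong)
  then have "(\<integral>x. F (1 + x) - F x \<partial>lborel) = (\<integral>x. F' x \<partial>lborel)"
    using integral_flow_average(2)[of lborel "\<lambda>t x. t + x" F'] int(2)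
    unfolding ftc by (simp add: lborel.sigma_finite_measure_axioms case_prod_beta)
  moreover have "integrable lborel (\<lambda>x. F (1 + x))" "(\<integral>x. F (1 + x) \<partial>lborel) = (\<integral>x. F x \<partial>lborel)"
    using lborel_integrable_real_affine[OF int(1), of 1 1] lborel_integral_real_affine[of 1 F 1] by simp_all
  ultimately show ?thesis
    using int(1) by simp
qed

section \<open>Integrals along horizontal lines\<close>

lemma Cauchy_kernel_integral:
  fixes a b :: real
  assumes b: "0 < b"
  shows "integrable lborel (\<lambda>x. 1 / ((x - a)\<^sup>2 + b\<^sup>2))" "(\<integral>x. 1 / ((x - a)\<^sup>2 + b\<^sup>2) \<partial>lborel) = pi / b"
proof -
  let ?F = "\<lambda>x. arctan ((x - a) / b) / b" and ?f = "\<lambda>x. 1 / ((x - a)\<^sup>2 + b\<^sup>2)"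
  have nz: "(x - a)\<^sup>2 + b\<^sup>2 > 0" for x
    using b by (simp add: add_nonneg_pos)
  have d: "DERIV ?F x :> ?f x" for x
  proof -
    have "b * (b * (1 + ((x - a) / b)\<^sup>2)) = (x - a)\<^sup>2 + b\<^sup>2"
      using b by (simp add: power_divide field_simps power2_eq_square)
    moreover have "inverse (1 + ((x - a) / b)\<^sup>2) * (1 / b) / b = 1 / (b * (b * (1 + ((x - a) / b)\<^sup>2)))"
      by (simp add: inverse_eq_divide)
    moreover have "DERIV ?F x :> inverse (1 + ((x - a) / b)\<^sup>2) * (1 / b) / b"
      using b by (auto intro!: derivative_eq_intros)
    ultimately show ?thesis by simp
  qed
  have c: "isCont ?f x" for x
    using nz[of x] by (intro continuous_intros) auto
  have f0: "AE x in lborel. -\<infinity> < ereal x \<longrightarrow> ereal x < \<infinity> \<longrightarrow> 0 \<le> ?f x"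
    using nz by (simp add: less_imp_le)
  have l1: "((?F \<circ> real_of_ereal) \<longlongrightarrow> - (pi * inverse b / 2)) (at_right (-\<infinity>))"
    unfolding ereal_tendsto_simps using b by real_asymp
  have l2: "((?F \<circ> real_of_ereal) \<longlongrightarrow> pi * inverse b / 2) (at_left \<infinity>)"
    unfolding ereal_tendsto_simps using b by real_asymp
  note * = interval_integral_FTC_nonneg[OF _ d c f0 l1 l2]
  show "integrable lborel ?f"
    using *(1) by (simp add: set_integrable_def)
  show "(\<integral>x. ?f x \<partial>lborel) = pi / b"
    using *(2) by (simp add: interval_lebesgue_integral_def set_lebesgue_integral_def field_simps)
qed

lemma integrable_lborel_times:
  fixes f g :: "real \<Rightarrow> real"
  assumes f: "integrable lborel f" and g: "integrable lborel g"
  shows "integrable plane (\<lambda>(x, y). f x * g y)"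
proof (rule lborel_pair.Fubini_integrable)
  note [measurable] = borel_measurable_integrable[OF f] borel_measurable_integrable[OF g]
  show "(\<lambda>(x, y). f x * g y) \<in> borel_measurable plane"
    by measurable
  show "integrable lborel (\<lambda>x. \<integral>y. norm (case (x, y) of (x, y) \<Rightarrow> f x * g y) \<partial>lborel)"
    using f by (simp add: abs_mult integrable_abs)
  show "AE x in lborel. integrable lborel (\<lambda>y. case (x, y) of (x, y) \<Rightarrow> f x * g y)"
    using g by simp
qed

text \<open>
  The difference of the two integrals is \<open>\<integral>\<integral> i H'(x + iy) dx dy\<close>, in which the inner integral over
  \<open>x\<close> vanishes for each \<open>y\<close>. Cauchy's inequality carries the decay of \<open>H\<close> over to \<open>H'\<close>, which justifies
  Fubini's theorem.
\<close>

lemma horizontal_line_shift: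
  fixes H :: "complex \<Rightarrow> complex"
  assumes hol: "H holomorphic_on {\<omega>. b < Im \<omega> \<and> Im \<omega> < d}"
    and bnd: "\<And>\<omega>. b < Im \<omega> \<Longrightarrow> Im \<omega> < d \<Longrightarrow> cmod (H \<omega>) \<le> C / (1 + (Re \<omega>)\<^sup>2)"
    and y: "b < y1" "y1 \<le> y2" "y2 < d"
  shows "(\<integral>x. H (Complex x y1) \<partial>lborel) = (\<integral>x. H (Complex x y2) \<partial>lborel)"
proof -
  \<comment> \<open>Discs of radius \<open>\<delta>\<close> about points between the two lines stay in the strip; \<open>\<delta> \<le> 1\<close> keeps \<open>1 + x\<^sup>2\<close> comparable on them.\<close>
  define \<delta> where "\<delta> = min 1 (min ((y1 - b) / 2) ((d - y2) / 2))"
  have \<delta>: "0 < \<delta>" "\<delta> \<le> 1" "\<delta> < y1 - b" "\<delta> < d - y2"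
    using y by (auto simp: \<delta>_def min_def)
  let ?S = "{\<omega>. b < Im \<omega> \<and> Im \<omega> < d}"
  have S: "open ?S"
    by (intro open_Collect_conj open_halfspace_Im_gt open_halfspace_Im_lt)
  have C: "0 \<le> C"
  proof -
    have "0 \<le> C / (1 + (Re (\<i> * of_real y1))\<^sup>2)"
      using y by (intro order_trans[OF norm_ge_zero bnd]) auto
    then show ?thesis by simp
  qed
  define D where "D x y = deriv H (Complex x y)" for x y
  define B where "B x = 3 * C / \<delta> * (1 / (1 + x\<^sup>2))" for x :: real
  have I0: "integrable lborel (\<lambda>x::real. 1 / (1 + x\<^sup>2))"
    using Cauchy_kernel_integral(1)[of 1 0] by (simp add: add.commute)
  have IB: "integrable lborel B"
    unfolding B_def by (intro integrable_mult_right I0)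
  have hd: "deriv H holomorphic_on ?S"
    using S hol by (rule holomorphic_deriv[rotated])
  have contD: "continuous_on ?S (deriv H)"
    using hd by (rule holomorphic_on_imp_continuous_on)
  have D: "cmod (D x y) \<le> B x" if "y1 \<le> y" "y \<le> y2" for x y
  proof -
    have sub: "cball (Complex x y) \<delta> \<subseteq> ?S"
    proof
      fix \<omega> assume "\<omega> \<in> cball (Complex x y) \<delta>"
      then have "\<bar>Im (Complex x y - \<omega>)\<bar> \<le> \<delta>"
        using abs_Im_le_cmod[of "Complex x y - \<omega>"] by (simp add: dist_norm)
      with that \<delta> show "\<omega> \<in> ?S" by auto
    qed
    have "cmod ((deriv ^^ 1) H (Complex x y)) \<le> fact 1 * (3 * C / (1 + x\<^sup>2)) / \<delta> ^ 1"
    proof (rule Cauchy_inequality)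
      show "H holomorphic_on ball (Complex x y) \<delta>"
        using hol order_trans[OF ball_subset_cball sub] by (rule holomorphic_on_subset)
      show "continuous_on (cball (Complex x y) \<delta>) H"
        using holomorphic_on_imp_continuous_on[OF hol] sub by (rule continuous_on_subset)
      fix \<omega> assume \<omega>: "cmod (Complex x y - \<omega>) = \<delta>"
      then have "\<omega> \<in> ?S"
        using sub by (auto simp: dist_norm)
      then have "cmod (H \<omega>) \<le> C / (1 + (Re \<omega>)\<^sup>2)"
        using bnd by auto
      also have "\<dots> \<le> 3 * C / (1 + x\<^sup>2)"
      proof -
        have "\<bar>Re (Complex x y - \<omega>)\<bar> \<le> 1"
          using \<omega> \<delta> abs_Re_le_cmod[of "Complex x y - \<omega>"] by simp
        then have "(x - Re \<omega>)\<^sup>2 \<le> 1"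
          by (simp add: abs_square_le_1)
        moreover have "x\<^sup>2 = 2 * (x - Re \<omega>)\<^sup>2 + 2 * (Re \<omega>)\<^sup>2 - (x - 2 * Re \<omega>)\<^sup>2"
          by (simp add: power2_eq_square algebra_simps)
        then have "x\<^sup>2 \<le> 2 * (x - Re \<omega>)\<^sup>2 + 2 * (Re \<omega>)\<^sup>2"
          by simp
        ultimately have "x\<^sup>2 \<le> 2 * 1 + 2 * (Re \<omega>)\<^sup>2"
          by (elim order_trans) (intro add_mono mult_left_mono, auto)
        then have "1 + x\<^sup>2 \<le> 1 + (2 * 1 + 2 * (Re \<omega>)\<^sup>2)"
          by (rule add_left_mono)
        also have "\<dots> \<le> 3 * (1 + (Re \<omega>)\<^sup>2)"
          by (simp add: algebra_simps)
        finally have "1 + x\<^sup>2 \<le> 3 * (1 + (Re \<omega>)\<^sup>2)" .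
        then have "C * (1 + x\<^sup>2) \<le> C * (3 * (1 + (Re \<omega>)\<^sup>2))"
          using C by (rule mult_left_mono)
        moreover have "0 < 1 + x\<^sup>2" "0 < 1 + (Re \<omega>)\<^sup>2"
          by (simp_all add: add_pos_nonneg)
        ultimately show ?thesis
          by (simp add: divide_simps mult_ac)
      qed
      finally show "cmod (H \<omega>) \<le> 3 * C / (1 + x\<^sup>2)" .
    qed (use \<delta> in auto)
    then show ?thesis
      by (simp add: D_def B_def mult_ac)
  qed
  have Hint: "integrable lborel (\<lambda>x. H (Complex x y))" if "b < y" "y < d" for y
  proof (rule Bochner_Integration.integrable_bound[OF integrable_mult_right[OF I0, of C]])
    have "continuous_on UNIV (\<lambda>x. H (Complex x y))"
      by (rule continuous_on_compose2[OF holomorphic_on_imp_continuous_on[OF hol]])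
         (use that in \<open>auto simp: Complex_eq intro!: continuous_intros\<close>)
    then show "(\<lambda>x. H (Complex x y)) \<in> borel_measurable lborel"
      by (simp add: borel_measurable_continuous_onI)
    show "AE x in lborel. norm (H (Complex x y)) \<le> norm (C * (1 / (1 + x\<^sup>2)))"
      using bnd[of "Complex _ y"] that C by auto
  qed
  have Dcont: "continuous_on (UNIV \<times> {y1..y2}) (\<lambda>p. D (fst p) (snd p))"
    unfolding D_def
    by (rule continuous_on_compose2[OF contD])
       (use y in \<open>auto simp: Complex_eq intro!: continuous_intros\<close>)
  let ?G = "\<lambda>(x, y). indicator {y1..y2} y *\<^sub>R (\<i> * D x y)"
  have Gmeas: "?G \<in> borel_measurable plane"
  proof -
    have "(\<lambda>p. indicator (UNIV \<times> {y1..y2}) p *\<^sub>R (\<i> * D (fst p) (snd p))) \<in> borel_measurable borel"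
      by (intro borel_measurable_continuous_on_indicator continuous_intros Dcont)
         (simp add: borel_closed closed_Times)
    then show ?thesis
      by (simp add: lborel_prod case_prod_beta indicator_times)
  qed
  have Gint: "integrable plane ?G"
  proof (rule Bochner_Integration.integrable_bound[OF integrable_lborel_times[OF IB, of "indicator {y1..y2}"] Gmeas])
    show "integrable lborel (indicator {y1..y2} :: real \<Rightarrow> real)"
      using y(2) by (intro integrable_real_indicator) auto
    show "AE p in plane. norm (?G p) \<le> norm (case p of (x, y) \<Rightarrow> B x * indicator {y1..y2} y)"
    proof (rule AE_I2)
      fix p :: "real \<times> real"
      obtain x y where p: "p = (x, y)" by (cases p)
      show "norm (?G p) \<le> norm (case p of (x, y) \<Rightarrow> B x * indicator {y1..y2} y)"
        using D[of y x] by (auto simp: p indicator_def norm_mult intro: order_trans[OF _ abs_ge_self])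
    qed
  qed
  have ftc: "(\<integral>y. indicator {y1..y2} y *\<^sub>R (\<i> * D x y) \<partial>lborel) = H (Complex x y2) - H (Complex x y1)" for x
  proof (rule integral_FTC_Icc[OF y(2)])
    show "continuous_on {y1..y2} (\<lambda>y. \<i> * D x y)"
      by (intro continuous_intros continuous_on_compose2[OF Dcont, of _ "\<lambda>y. (x, y)", simplified]) auto
    fix t assume t: "y1 \<le> t" "t \<le> y2"
    then have "(H has_field_derivative D x t) (at (Complex x t))"
      unfolding D_def using y by (intro holomorphic_derivI[OF hol S]) auto
    moreover have "((\<lambda>t. Complex x t) has_vector_derivative \<i>) (at t)"
      unfolding Complex_eq has_vector_derivative_def
      by (auto intro!: derivative_eq_intros simp: scaleR_conv_of_real)
    ultimately show "((\<lambda>y. H (Complex x y)) has_vector_derivative \<i> * D x t) (at t within {y1..y2})"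
      using field_vector_diff_chain_at[of "\<lambda>t. Complex x t" \<i> t H "D x t"]
      by (simp add: o_def has_vector_derivative_at_within)
  qed
  have zero: "(\<integral>x. indicator {y1..y2} y *\<^sub>R (\<i> * D x y) \<partial>lborel) = 0" for y
  proof (cases "y \<in> {y1..y2}")
    case True
    then have yy: "b < y" "y < d" using y by auto
    have Dc: "continuous_on UNIV (\<lambda>x. D x y)"
      using True by (intro continuous_on_compose2[OF Dcont, of _ "\<lambda>x. (x, y)", simplified] continuous_intros) auto
    have "integrable lborel (\<lambda>x. D x y)"
    proof (rule Bochner_Integration.integrable_bound[OF IB])
      show "AE x in lborel. norm (D x y) \<le> norm (B x)"
        using D[of y] True by (intro AE_I2) (auto intro: order_trans[OF _ abs_ge_self])
    qed (use Dc borel_measurable_continuous_onI in auto)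
    moreover have "((\<lambda>x. H (Complex x y)) has_vector_derivative D x y) (at x)" for x
    proof -
      have "(H has_field_derivative D x y) (at (Complex x y))"
        unfolding D_def using yy by (intro holomorphic_derivI[OF hol S]) auto
      moreover have "((\<lambda>x. Complex x y) has_vector_derivative 1) (at x)"
        unfolding Complex_eq has_vector_derivative_def
        by (auto intro!: derivative_eq_intros simp: scaleR_conv_of_real)
      ultimately show ?thesis
        using field_vector_diff_chain_at[of "\<lambda>x. Complex x y" 1 x H "D x y"] by (simp add: o_def)
    qed
    ultimately have "(\<integral>x. D x y \<partial>lborel) = 0"
      using Dc Hint[OF yy] by (intro integral_derivative_eq_0[of "\<lambda>x. H (Complex x y)"]) auto
    then show ?thesis by simp
  qed auto
  have "(\<integral>x. H (Complex x y2) - H (Complex x y1) \<partial>lborel)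
      = (\<integral>x. (\<integral>y. indicator {y1..y2} y *\<^sub>R (\<i> * D x y) \<partial>lborel) \<partial>lborel)"
    by (simp only: ftc)
  also have "\<dots> = (\<integral>y. (\<integral>x. indicator {y1..y2} y *\<^sub>R (\<i> * D x y) \<partial>lborel) \<partial>lborel)"
    using lborel_pair.Fubini_integral[OF Gint] by simp
  also have "\<dots> = 0"
    by (simp only: zero) simp
  finally show ?thesis
    using Hint[of y1] Hint[of y2] y by simp
qed

text \<open>
  Let \<open>\<eta>\<close> be the mirror image of \<open>\<zeta>\<close> in the line \<open>Im = h\<close>. Subtracting
  \<open>g(\<zeta>) (\<zeta> - \<eta>)/(\<omega> - \<eta>)\<close> from \<open>g\<close> removes the singularity at \<open>\<zeta>\<close>; the remaining integral is moved up to
  infinity, where it tends to 0. On the line itself \<open>(\<omega> - \<eta>)(\<omega> - \<zeta>)\<close> is \<open>|\<omega> - \<zeta>|\<^sup>2\<close>, so the subtracted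
  term contributes the total mass of a Cauchy density.
\<close>

lemma Cauchy_integral_horizontal_line:
  fixes g :: "complex \<Rightarrow> complex"
  assumes hol: "g holomorphic_on {\<omega>. 0 < Im \<omega>}"
    and bnd: "\<And>h. 0 < h \<Longrightarrow> \<exists>C. \<forall>\<omega>. h \<le> Im \<omega> \<longrightarrow> cmod (g \<omega>) \<le> C / (cmod (\<omega> + \<i>))\<^sup>2"
    and h: "0 < h" "h < Im \<zeta>"
  shows "(\<integral>x. g (Complex x h) / (Complex x h - \<zeta>) \<partial>lborel) = 2 * pi * \<i> * g \<zeta>"
proof -
  define x0 y0 where "x0 = Re \<zeta>" and "y0 = Im \<zeta>"
  have \<zeta>: "\<zeta> = Complex x0 y0" by (simp add: x0_def y0_def)
  \<comment> \<open>The mirror image of \<open>\<zeta>\<close> in the line \<open>Im = h\<close>.\<close>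
  define \<eta> where "\<eta> = Complex x0 (2 * h - y0)"
  \<comment> \<open>Above height \<open>b\<close> the bound on \<open>g\<close> holds and the pole \<open>\<eta>\<close> does not occur.\<close>
  define b where "b = max (h / 2) (2 * h - y0)"
  have b: "h / 2 \<le> b" "2 * h - y0 \<le> b" "b < h" "0 < b" "h < y0"
    using h by (auto simp: b_def y0_def)
  define S where "S = {\<omega>. b < Im \<omega>}"
  have S: "open S" unfolding S_def by (rule open_halfspace_Im_gt)
  have \<zeta>S: "\<zeta> \<in> S" using b by (simp add: S_def \<zeta>)
  have \<eta>S: "\<omega> \<noteq> \<eta>" if "\<omega> \<in> S" for \<omega>
    using that b by (auto simp: S_def \<eta>_def)
  define P where "P \<omega> = g \<omega> - g \<zeta> * (\<zeta> - \<eta>) / (\<omega> - \<eta>)" for \<omega>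
  have P\<zeta>: "P \<zeta> = 0"
    using \<eta>S[OF \<zeta>S] by (simp add: P_def)
  have holg: "g holomorphic_on S"
    using hol b by (rule_tac holomorphic_on_subset) (auto simp: S_def)
  have Phol: "P holomorphic_on S"
    unfolding P_def using \<eta>S by (intro holomorphic_intros holg) auto
  define q where "q \<omega> = (if \<omega> = \<zeta> then deriv P \<zeta> else (P \<omega> - P \<zeta>) / (\<omega> - \<zeta>))" for \<omega>
  have qhol: "q holomorphic_on S"
    unfolding q_def by (rule pole_lemma_open[OF Phol S])
  obtain C where C: "\<And>\<omega>. h / 2 \<le> Im \<omega> \<Longrightarrow> cmod (g \<omega>) \<le> C / (cmod (\<omega> + \<i>))\<^sup>2"
    using bnd[of "h / 2"] h by auto
  define K where "K = \<bar>C\<bar> * (1 + cmod (\<i> + \<eta>)) + cmod (g \<zeta>) * cmod (\<zeta> - \<eta>)"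
  have K0: "0 \<le> K" by (simp add: K_def)
  have PK: "cmod (P \<omega>) \<le> K / cmod (\<omega> - \<eta>)" if "\<omega> \<in> S" for \<omega>
  proof -
    have "1 \<le> Im (\<omega> + \<i>)"
      using that b by (simp add: S_def)
    then have 1: "1 \<le> cmod (\<omega> + \<i>)"
      using abs_Im_le_cmod[of "\<omega> + \<i>"] by linarith
    have nz: "0 < cmod (\<omega> - \<eta>)"
      using \<eta>S[OF that] by simp
    have "cmod (\<omega> - \<eta>) \<le> cmod (\<omega> + \<i>) + cmod (\<i> + \<eta>) * 1"
      using norm_triangle_ineq4[of "\<omega> + \<i>" "\<i> + \<eta>"] by simp
    also have "\<dots> \<le> cmod (\<omega> + \<i>) + cmod (\<i> + \<eta>) * cmod (\<omega> + \<i>)"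
      using 1 by (intro add_mono mult_left_mono) auto
    finally have 2: "cmod (\<omega> - \<eta>) \<le> (1 + cmod (\<i> + \<eta>)) * cmod (\<omega> + \<i>)"
      by (simp add: algebra_simps)
    have "cmod (g \<omega>) \<le> C / (cmod (\<omega> + \<i>))\<^sup>2"
      using that b by (intro C) (auto simp: S_def)
    also have "\<dots> \<le> \<bar>C\<bar> / cmod (\<omega> + \<i>)"
    proof (rule frac_le)
      show "cmod (\<omega> + \<i>) \<le> (cmod (\<omega> + \<i>))\<^sup>2"
        using mult_left_mono[OF 1, of "cmod (\<omega> + \<i>)"] by (simp add: power2_eq_square)
    qed (use 1 in auto)
    also have "\<dots> \<le> \<bar>C\<bar> * (1 + cmod (\<i> + \<eta>)) / cmod (\<omega> - \<eta>)"
    proof -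
      have "\<bar>C\<bar> * cmod (\<omega> - \<eta>) \<le> \<bar>C\<bar> * ((1 + cmod (\<i> + \<eta>)) * cmod (\<omega> + \<i>))"
        using 2 by (intro mult_left_mono) auto
      moreover have "0 < cmod (\<omega> + \<i>)" using 1 by linarith
      ultimately have "\<bar>C\<bar> * cmod (\<omega> - \<eta>) / cmod (\<omega> + \<i>) \<le> \<bar>C\<bar> * (1 + cmod (\<i> + \<eta>))"
        by (simp add: pos_divide_le_eq mult.assoc)
      then show ?thesis
        using nz by (simp add: pos_le_divide_eq)
    qed
    finally have "cmod (g \<omega>) \<le> \<bar>C\<bar> * (1 + cmod (\<i> + \<eta>)) / cmod (\<omega> - \<eta>)" .
    moreover have "cmod (P \<omega>) \<le> cmod (g \<omega>) + cmod (g \<zeta>) * cmod (\<zeta> - \<eta>) / cmod (\<omega> - \<eta>)"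
      unfolding P_def using norm_triangle_ineq4[of "g \<omega>" "g \<zeta> * (\<zeta> - \<eta>) / (\<omega> - \<eta>)"]
      by (simp add: norm_mult norm_divide)
    ultimately show ?thesis
      unfolding K_def add_divide_distrib by linarith
  qed
  have qK: "cmod (q \<omega>) \<le> K / (cmod (\<omega> - \<eta>) * cmod (\<omega> - \<zeta>))" if "\<omega> \<in> S" "\<omega> \<noteq> \<zeta>" for \<omega>
    using divide_right_mono[OF PK[OF that(1)], of "cmod (\<omega> - \<zeta>)"] that
    by (simp add: q_def P\<zeta> norm_divide)
  define A where "A = 1 + (1 + \<bar>x0\<bar>)\<^sup>2"
  \<comment> \<open>Near \<open>\<zeta>\<close> the bound comes from compactness, away from it from \<open>qK\<close>.\<close>
  have strip: "\<exists>C. \<forall>\<omega>. b' < Im \<omega> \<longrightarrow> Im \<omega> < d \<longrightarrow> cmod (q \<omega>) \<le> C / (1 + (Re \<omega>)\<^sup>2)" if b': "b < b'" for b' d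
  proof -
    define R where "R = cbox (Complex (x0 - 1) b') (Complex (x0 + 1) d)"
    have "R \<subseteq> S" using b' by (auto simp: R_def S_def in_cbox_complex_iff)
    then have "compact (q ` R)"
      using qhol by (intro compact_continuous_image)
        (auto simp: R_def intro: continuous_on_subset holomorphic_on_imp_continuous_on)
    then obtain M where "M > 0" and M: "\<And>\<omega>. \<omega> \<in> R \<Longrightarrow> cmod (q \<omega>) \<le> M"
      by (metis bounded_pos compact_imp_bounded image_eqI)
    have "cmod (q \<omega>) \<le> (M + K) * A / (1 + (Re \<omega>)\<^sup>2)" if \<omega>: "b' < Im \<omega>" "Im \<omega> < d" for \<omega>
    proof -
      define t where "t = Re \<omega> - x0"
      have tx: "\<bar>Re \<omega>\<bar> \<le> \<bar>t\<bar> + \<bar>x0\<bar>" by (simp add: t_def)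
      have pos: "0 < 1 + (Re \<omega>)\<^sup>2" by (simp add: add_pos_nonneg)
      have "cmod (q \<omega>) * (1 + (Re \<omega>)\<^sup>2) \<le> (M + K) * A"
      proof (cases "\<bar>t\<bar> \<le> 1")
        case True
        then have "\<bar>Re \<omega>\<bar> \<le> 1 + \<bar>x0\<bar>" using tx by linarith
        then have "(Re \<omega>)\<^sup>2 \<le> (1 + \<bar>x0\<bar>)\<^sup>2"
          using power_mono[of "\<bar>Re \<omega>\<bar>" _ 2] by simp
        moreover have "\<omega> \<in> R"
          using True \<omega> by (auto simp: R_def t_def in_cbox_complex_iff)
        ultimately have "cmod (q \<omega>) * (1 + (Re \<omega>)\<^sup>2) \<le> M * A"
          using M by (intro mult_mono) (auto simp: A_def intro: order_trans[OF norm_ge_zero])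
        also have "\<dots> \<le> (M + K) * A"
          using K0 by (intro mult_right_mono) (auto simp: A_def)
        finally show ?thesis .
      next
        case False
        then have t1: "1 \<le> \<bar>t\<bar>" by simp
        have "\<bar>Re \<omega>\<bar> \<le> \<bar>t\<bar> * (1 + \<bar>x0\<bar>)"
          using tx mult_right_mono[OF t1, of "\<bar>x0\<bar>"] by (simp add: algebra_simps)
        then have "(Re \<omega>)\<^sup>2 \<le> t\<^sup>2 * (1 + \<bar>x0\<bar>)\<^sup>2"
          using power_mono[of "\<bar>Re \<omega>\<bar>" "\<bar>t\<bar> * (1 + \<bar>x0\<bar>)" 2] by (simp add: power_mult_distrib)
        moreover have "1 \<le> t\<^sup>2"
          using t1 by (simp add: abs_le_square_iff[of 1 t, simplified])
        ultimately have w: "1 + (Re \<omega>)\<^sup>2 \<le> t\<^sup>2 * A"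
          by (simp add: A_def algebra_simps)
        have ge: "\<bar>t\<bar> \<le> cmod (\<omega> - \<eta>)" "\<bar>t\<bar> \<le> cmod (\<omega> - \<zeta>)"
          using abs_Re_le_cmod[of "\<omega> - \<eta>"] abs_Re_le_cmod[of "\<omega> - \<zeta>"] by (simp_all add: t_def \<eta>_def \<zeta>)
        have "cmod (q \<omega>) \<le> K / (cmod (\<omega> - \<eta>) * cmod (\<omega> - \<zeta>))"
          using t1 \<omega> b' by (intro qK) (auto simp: S_def t_def x0_def)
        also have "\<dots> \<le> K / (\<bar>t\<bar> * \<bar>t\<bar>)"
          using ge t1 K0 by (intro divide_left_mono mult_mono mult_pos_pos) auto
        also have "\<dots> = K / t\<^sup>2"
          by (simp add: power2_eq_square)
        finally have "cmod (q \<omega>) * (1 + (Re \<omega>)\<^sup>2) \<le> K / t\<^sup>2 * (t\<^sup>2 * A)"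
          using w pos K0 by (intro mult_mono) auto
        also have "\<dots> = K * A"
          using t1 by auto
        also have "\<dots> \<le> (M + K) * A"
          using \<open>M > 0\<close> by (intro mult_right_mono) (auto simp: A_def)
        finally show ?thesis .
      qed
      then show ?thesis
        using pos by (simp add: pos_le_divide_eq)
    qed
    then show ?thesis by blast
  qed
  have qint: "integrable lborel (\<lambda>x. q (Complex x y))" if y: "b < y" for y
  proof -
    obtain C where C: "\<And>\<omega>. (b + y) / 2 < Im \<omega> \<Longrightarrow> Im \<omega> < y + 1 \<Longrightarrow> cmod (q \<omega>) \<le> C / (1 + (Re \<omega>)\<^sup>2)"
    proof -
      have "b < (b + y) / 2" using y by simp
      from strip[OF this, of "y + 1"] show ?thesis using that by blast
    qed
    have I0: "integrable lborel (\<lambda>x::real. C * (1 / (1 + x\<^sup>2)))"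
      using Cauchy_kernel_integral(1)[of 1 0] by (intro integrable_mult_right) (simp add: add.commute)
    show ?thesis
    proof (rule Bochner_Integration.integrable_bound[OF I0])
      have "continuous_on UNIV (\<lambda>x. q (Complex x y))"
        by (rule continuous_on_compose2[OF holomorphic_on_imp_continuous_on[OF qhol]])
           (use y in \<open>auto simp: S_def Complex_eq intro!: continuous_intros\<close>)
      then show "(\<lambda>x. q (Complex x y)) \<in> borel_measurable lborel"
        by (simp add: borel_measurable_continuous_onI)
      show "AE x in lborel. norm (q (Complex x y)) \<le> norm (C * (1 / (1 + x\<^sup>2)))"
      proof (rule AE_I2)
        fix x
        have "cmod (q (Complex x y)) \<le> C * (1 / (1 + x\<^sup>2))"
          using C[of "Complex x y"] y by simp
        then show "norm (q (Complex x y)) \<le> norm (C * (1 / (1 + x\<^sup>2)))"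
          unfolding real_norm_def by (rule order_trans[OF _ abs_ge_self])
      qed
    qed
  qed
  have J: "cmod (\<integral>x. q (Complex x h) \<partial>lborel) \<le> K * pi / (real m + 1)" for m
  proof -
    define Y where "Y = y0 + real m + 1"
    have Y: "h \<le> Y" "0 < Y - y0" "b < Y" using b by (auto simp: Y_def)
    obtain C where C: "\<And>\<omega>. (b + h) / 2 < Im \<omega> \<Longrightarrow> Im \<omega> < Y + 1 \<Longrightarrow> cmod (q \<omega>) \<le> C / (1 + (Re \<omega>)\<^sup>2)"
    proof -
      have "b < (b + h) / 2" using b by simp
      from strip[OF this, of "Y + 1"] show ?thesis using that by blast
    qed
    have "q holomorphic_on {\<omega>. (b + h) / 2 < Im \<omega> \<and> Im \<omega> < Y + 1}"
      using qhol b by (rule_tac holomorphic_on_subset) (auto simp: S_def)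
    then have "(\<integral>x. q (Complex x h) \<partial>lborel) = (\<integral>x. q (Complex x Y) \<partial>lborel)"
      by (rule horizontal_line_shift) (use C b Y in auto)
    also have "cmod \<dots> \<le> (\<integral>x. K * (1 / ((x - x0)\<^sup>2 + (Y - y0)\<^sup>2)) \<partial>lborel)"
    proof (rule Bochner_Integration.integral_norm_bound_integral)
      show "integrable lborel (\<lambda>x. q (Complex x Y))"
        using Y by (intro qint)
      show "integrable lborel (\<lambda>x. K * (1 / ((x - x0)\<^sup>2 + (Y - y0)\<^sup>2)))"
        using Y by (intro integrable_mult_right Cauchy_kernel_integral)
      fix x
      have "cmod (q (Complex x Y)) \<le> K / (cmod (Complex x Y - \<eta>) * cmod (Complex x Y - \<zeta>))"
        using Y b by (intro qK) (auto simp: S_def \<zeta>)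
      also have "\<dots> \<le> K / (cmod (Complex x Y - \<zeta>) * cmod (Complex x Y - \<zeta>))"
      proof (intro divide_left_mono mult_right_mono mult_pos_pos)
        have "(Y - y0)\<^sup>2 \<le> (Y - (2 * h - y0))\<^sup>2"
          using Y b by (intro power_mono) auto
        then show "cmod (Complex x Y - \<zeta>) \<le> cmod (Complex x Y - \<eta>)"
          unfolding \<zeta> \<eta>_def cmod_def by simp
        show "0 < cmod (Complex x Y - \<zeta>)" "0 < cmod (Complex x Y - \<zeta>)"
          using Y by (auto simp: \<zeta>)
        show "0 < cmod (Complex x Y - \<eta>)"
          using Y b by (auto simp: \<eta>_def)
      qed (use K0 Y in \<open>auto simp: \<zeta>\<close>)
      also have "cmod (Complex x Y - \<zeta>) * cmod (Complex x Y - \<zeta>) = (x - x0)\<^sup>2 + (Y - y0)\<^sup>2"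
        unfolding power2_eq_square[symmetric] cmod_power2 by (simp add: \<zeta>)
      finally show "cmod (q (Complex x Y)) \<le> K * (1 / ((x - x0)\<^sup>2 + (Y - y0)\<^sup>2))"
        by simp
    qed
    also have "\<dots> = K * pi / (real m + 1)"
      by (simp only: integral_mult_right_zero Cauchy_kernel_integral(2)[OF Y(2)]) (simp add: Y_def)
    finally show ?thesis .
  qed
  have "(\<lambda>m. K * pi / (real m + 1)) \<longlonglongrightarrow> 0"
    by real_asymp
  then have "cmod (\<integral>x. q (Complex x h) \<partial>lborel) \<le> 0"
    by (rule LIMSEQ_le_const) (use J in auto)
  then have q0: "(\<integral>x. q (Complex x h) \<partial>lborel) = 0"
    by simp
  have eq: "g (Complex x h) / (Complex x h - \<zeta>)
      = q (Complex x h) + 2 * \<i> * (y0 - h) * g \<zeta> * of_real (1 / ((x - x0)\<^sup>2 + (y0 - h)\<^sup>2))" for x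
  proof -
    define \<omega> where "\<omega> = Complex x h"
    have nz: "\<omega> - \<zeta> \<noteq> 0" "\<omega> - \<eta> \<noteq> 0"
      using b by (auto simp: \<omega>_def \<zeta> \<eta>_def)
    have "(\<omega> - \<eta>) * (\<omega> - \<zeta>) = of_real ((x - x0)\<^sup>2 + (y0 - h)\<^sup>2)"
      by (simp add: \<omega>_def \<zeta> \<eta>_def complex_eq_iff power2_eq_square algebra_simps)
    moreover have "\<zeta> - \<eta> = 2 * \<i> * (y0 - h)"
      by (simp add: \<zeta> \<eta>_def complex_eq_iff)
    moreover have "G / u = (G - G0 * c / v) / u + c * G0 * (1 / (v * u))" if "u \<noteq> 0" "v \<noteq> 0" for G G0 c u v :: complex
      using that by (simp add: diff_divide_distrib mult_ac)
    from this[OF nz] have "g \<omega> / (\<omega> - \<zeta>) = q \<omega> + (\<zeta> - \<eta>) * g \<zeta> * (1 / ((\<omega> - \<eta>) * (\<omega> - \<zeta>)))"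
      using nz \<eta>S[OF \<zeta>S] unfolding q_def P\<zeta> P_def by simp
    ultimately show ?thesis
      unfolding \<omega>_def by (simp only: of_real_divide of_real_1)
  qed
  have I: "integrable lborel (\<lambda>x. 1 / ((x - x0)\<^sup>2 + (y0 - h)\<^sup>2))"
    "(\<integral>x. 1 / ((x - x0)\<^sup>2 + (y0 - h)\<^sup>2) \<partial>lborel) = pi / (y0 - h)"
    using b by (auto intro!: Cauchy_kernel_integral)
  have "(\<integral>x. g (Complex x h) / (Complex x h - \<zeta>) \<partial>lborel)
      = (\<integral>x. q (Complex x h) \<partial>lborel) + 2 * \<i> * (y0 - h) * g \<zeta> * of_real (pi / (y0 - h))"
    unfolding eq
    by (subst Bochner_Integration.integral_add)
       (use qint[of h] b I in \<open>auto simp flip: of_real_divide simp del: of_real_add of_real_power\<close>)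
  moreover have "2 * \<i> * (y0 - h) * g \<zeta> * of_real (pi / (y0 - h)) = 2 * pi * \<i> * g \<zeta>"
    using b by (simp add: field_simps)
  ultimately show ?thesis
    unfolding q0 by simp
qed

lemma beta_integral_real:
  fixes \<mu> \<delta> :: real
  assumes "\<mu> > -1" "\<delta> > 0"
  shows "integrable lborel (\<lambda>r. indicator {0<..} r * (r powr \<mu> / (r + \<delta>) powr (2 + \<mu>)))"
proof -
  let ?F = "\<lambda>r. (r / (r + \<delta>)) powr (1 + \<mu>) / ((1 + \<mu>) * \<delta>)"
  let ?f = "\<lambda>r. r powr \<mu> / (r + \<delta>) powr (2 + \<mu>)"
  have d: "DERIV ?F r :> ?f r" if "0 < ereal r" "ereal r < \<infinity>" for r
  proof -
    have r: "0 < r" using that by simp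
    have "DERIV (\<lambda>r. r / (r + \<delta>)) r :> \<delta> / (r + \<delta>)\<^sup>2"
      using r assms by (auto intro!: derivative_eq_intros simp: field_simps power2_eq_square)
    from DERIV_fun_powr[OF this, of "1 + \<mu>"]
    have "DERIV (\<lambda>r. (r / (r + \<delta>)) powr (1 + \<mu>)) r :> (1 + \<mu>) * (r / (r + \<delta>)) powr \<mu> * (\<delta> / (r + \<delta>)\<^sup>2)"
      using r assms by simp
    from DERIV_cdivide[OF this, of "(1 + \<mu>) * \<delta>"]
    have "DERIV ?F r :> (r / (r + \<delta>)) powr \<mu> / (r + \<delta>)\<^sup>2"
      using assms by simp
    moreover have "(r / (r + \<delta>)) powr \<mu> / (r + \<delta>)\<^sup>2 = ?f r"
      using r assms by (simp add: powr_divide powr_add powr_numeral)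
    ultimately show ?thesis by simp
  qed
  have c: "isCont ?f r" if "0 < ereal r" "ereal r < \<infinity>" for r
    using that assms by (intro continuous_intros) auto
  have l1: "((?F \<circ> real_of_ereal) \<longlongrightarrow> 0) (at_right 0)"
    unfolding zero_ereal_def ereal_tendsto_simps using assms by real_asymp
  have l2: "((?F \<circ> real_of_ereal) \<longlongrightarrow> 1 / ((1 + \<mu>) * \<delta>)) (at_left \<infinity>)"
  proof -
    have "((\<lambda>r. r / (r + \<delta>)) \<longlongrightarrow> 1) at_top"
      by real_asymp
    then have "(?F \<longlongrightarrow> 1 powr (1 + \<mu>) / ((1 + \<mu>) * \<delta>)) at_top"
      using assms by (intro tendsto_intros) auto
    then show ?thesis
      unfolding ereal_tendsto_simps by simp
  qed
  have "set_integrable lborel (einterval 0 \<infinity>) ?f"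
    by (rule interval_integral_FTC_nonneg(1)[OF _ d c _ l1 l2]) auto
  then show ?thesis
    by (simp add: set_integrable_def einterval_def zero_ereal_def greaterThan_def)
qed

text \<open>
  The antiderivative of the real case works for complex \<open>B\<close>; it is written as a product of powers of
  \<open>r\<close> and \<open>r + B\<close>, which agrees with the power of the quotient because \<open>r\<close> is positive.
\<close>

lemma beta_integral:
  fixes \<mu> :: real and B :: complex
  assumes \<mu>: "\<mu> > -1" and B: "0 < Re B"
  shows "integrable lborel (\<lambda>r. indicator {0<..} r *\<^sub>R (of_real (r powr \<mu>) / (of_real r + B) powr of_real (2 + \<mu>)))" (is "integrable _ (\<lambda>r. _ *\<^sub>R ?f r)")
    and "(\<integral>r. indicator {0<..} r *\<^sub>R (of_real (r powr \<mu>) / (of_real r + B) powr of_real (2 + \<mu>)) \<partial>lborel) = 1 / (of_real (1 + \<mu>) * B)"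
proof -
  have pos: "of_real r + B \<noteq> 0" "of_real r + B \<notin> \<real>\<^sub>\<le>\<^sub>0" if "0 \<le> r" for r
    using that B by (auto simp: complex_eq_iff complex_nonpos_Reals_iff)
  have cont: "isCont ?f r" if "0 < r" for r
    using that pos[of r] by (intro continuous_intros) (auto simp: powr_def)
  have ei: "einterval 0 \<infinity> = {0<..}"
    by (auto simp: einterval_def zero_ereal_def)
  have bound: "cmod (?f r) \<le> r powr \<mu> / (r + Re B) powr (2 + \<mu>)" if "0 < r" for r
  proof -
    have "r + Re B \<le> cmod (of_real r + B)"
      using complex_Re_le_cmod[of "of_real r + B"] by simp
    then have "(r + Re B) powr (2 + \<mu>) \<le> cmod (of_real r + B) powr (2 + \<mu>)"
      using that B \<mu> by (intro powr_mono2) auto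
    then show ?thesis
      using that B by (auto simp: norm_divide norm_powr_real_powr' intro!: divide_left_mono mult_pos_pos)
  qed
  show int: "integrable lborel (\<lambda>r. indicator {0<..} r *\<^sub>R ?f r)"
  proof (rule Bochner_Integration.integrable_bound[OF beta_integral_real[OF \<mu> B]])
    have "continuous_on {0<..} ?f"
      using cont by (auto intro!: continuous_at_imp_continuous_on)
    then show "(\<lambda>r. indicator {0<..} r *\<^sub>R ?f r) \<in> borel_measurable lborel"
      by (simp add: borel_measurable_continuous_on_indicator)
    show "AE r in lborel. norm (indicator {0<..} r *\<^sub>R ?f r) \<le> norm (indicator {0<..} r * (r powr \<mu> / (r + Re B) powr (2 + \<mu>)))"
      using bound by (auto simp: indicator_def intro: order_trans abs_ge_self)
  qed
  define c where "c = complex_of_real (1 + \<mu>) * B"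
  have c: "c \<noteq> 0" using \<mu> B by (auto simp: c_def complex_eq_iff)
  let ?F = "\<lambda>r. of_real (r powr (1 + \<mu>)) * (of_real r + B) powr (- of_real (1 + \<mu>)) / c"
  have d: "(?F has_vector_derivative ?f r) (at r)" if "0 < r" for r
  proof -
    let ?z = "of_real r + B"
    have 1: "((\<lambda>r. complex_of_real (r powr (1 + \<mu>))) has_vector_derivative of_real ((1 + \<mu>) * r powr \<mu>)) (at r)"
      using that has_real_derivative_powr[of r "1 + \<mu>"]
      by (intro has_vector_derivative_of_real) (simp add: has_real_derivative_iff_has_vector_derivative)
    have 2: "((\<lambda>r. (of_real r + B) powr (- of_real (1 + \<mu>))) has_vector_derivative
        - of_real (1 + \<mu>) * ?z powr (- of_real (1 + \<mu>) - 1)) (at r)"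
    proof -
      have "((\<lambda>z. z powr (- of_real (1 + \<mu>))) has_field_derivative - of_real (1 + \<mu>) * ?z powr (- of_real (1 + \<mu>) - 1)) (at ?z)"
        using pos[of r] that by (intro has_field_derivative_powr) auto
      moreover have "((\<lambda>r. of_real r + B) has_vector_derivative 1) (at r)"
        unfolding has_vector_derivative_def by (auto intro!: derivative_eq_intros simp: scaleR_conv_of_real)
      ultimately show ?thesis
        using field_vector_diff_chain_at[of "\<lambda>r. of_real r + B" 1 r "\<lambda>z. z powr (- of_real (1 + \<mu>))"]
        by (simp add: o_def)
    qed
    have e: "?z powr (- of_real (1 + \<mu>)) = ?z / ?z powr of_real (2 + \<mu>)"
      "?z powr (- of_real (1 + \<mu>) - 1) = 1 / ?z powr of_real (2 + \<mu>)"
    proof -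
      have "?z powr (1 - of_real (2 + \<mu>)) = ?z powr 1 / ?z powr of_real (2 + \<mu>)"
        by (rule powr_diff)
      then show "?z powr (- of_real (1 + \<mu>)) = ?z / ?z powr of_real (2 + \<mu>)"
        using pos[of r] that by simp
      have "?z powr (- of_real (2 + \<mu>)) = 1 / ?z powr of_real (2 + \<mu>)"
        by (rule powr_minus_divide)
      moreover have "- complex_of_real (1 + \<mu>) - 1 = - of_real (2 + \<mu>)" by simp
      ultimately show "?z powr (- of_real (1 + \<mu>) - 1) = 1 / ?z powr of_real (2 + \<mu>)"
        by metis
    qed
    have rr: "r powr (1 + \<mu>) = r * r powr \<mu>"
      using that by (simp add: powr_add)
    have "(?F has_vector_derivative
        (of_real (r powr (1 + \<mu>)) * (- of_real (1 + \<mu>) * ?z powr (- of_real (1 + \<mu>) - 1))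
         + of_real ((1 + \<mu>) * r powr \<mu>) * ?z powr (- of_real (1 + \<mu>))) / c) (at r)"
      by (intro has_vector_derivative_divide has_vector_derivative_mult 1 2)
    also have "(of_real (r powr (1 + \<mu>)) * (- of_real (1 + \<mu>) * ?z powr (- of_real (1 + \<mu>) - 1))
         + of_real ((1 + \<mu>) * r powr \<mu>) * ?z powr (- of_real (1 + \<mu>))) / c = ?f r"
      using c unfolding e rr by (simp add: c_def divide_simps) (simp add: algebra_simps)
    finally show ?thesis .
  qed
  have l1: "((?F \<circ> real_of_ereal) \<longlongrightarrow> 0) (at_right 0)"
  proof -
    have "((\<lambda>r. r powr (1 + \<mu>)) \<longlongrightarrow> 0) (at_right 0)"
      using \<mu> by real_asymp
    then have A: "((\<lambda>r. complex_of_real (r powr (1 + \<mu>))) \<longlongrightarrow> of_real 0) (at_right 0)"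
      by (rule tendsto_of_real)
    have A': "((\<lambda>r. (of_real r + B) powr (- of_real (1 + \<mu>))) \<longlongrightarrow> (of_real 0 + B) powr (- of_real (1 + \<mu>))) (at_right 0)"
      using pos[of 0] by (intro tendsto_intros) auto
    have "(?F \<longlongrightarrow> of_real 0 * (of_real 0 + B) powr (- of_real (1 + \<mu>)) / c) (at_right 0)"
      by (rule tendsto_divide[OF tendsto_mult[OF A A'] tendsto_const c])
    then show ?thesis
      unfolding zero_ereal_def ereal_tendsto_simps by simp
  qed
  have l2: "((?F \<circ> real_of_ereal) \<longlongrightarrow> 1 / c) (at_left \<infinity>)"
  proof -
    have L: "((\<lambda>r. of_real (1 / r)) \<longlongrightarrow> complex_of_real 0) at_top"
      by (intro tendsto_of_real) real_asymp
    have "((\<lambda>r. (1 + of_real (1 / r) * B) powr (- of_real (1 + \<mu>)) / c) \<longlongrightarrow> (1 + of_real 0 * B) powr (- of_real (1 + \<mu>)) / c) at_top"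
      by (intro tendsto_divide tendsto_powr_complex tendsto_add tendsto_mult tendsto_const L c) auto
    moreover have "eventually (\<lambda>r. (1 + of_real (1 / r) * B) powr (- of_real (1 + \<mu>)) / c = ?F r) at_top"
      using eventually_gt_at_top[of 0]
    proof eventually_elim
      fix r :: real assume r: "0 < r"
      define z where "z = 1 + of_real (1 / r) * B"
      have "0 < Re z"
        using r B by (simp add: z_def add_pos_pos)
      then have z: "z \<noteq> 0" by auto
      have rz: "of_real r + B = of_real r * z"
        using r by (simp add: z_def field_simps)
      have "Ln (of_real r * z) = of_real (ln r) + Ln z"
        using r z by (simp add: Ln_times_of_real Ln_of_real)
      then have "(of_real r * z) powr (- of_real (1 + \<mu>))
          = exp (of_real (- (1 + \<mu>) * ln r)) * exp (- of_real (1 + \<mu>) * Ln z)"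
        using r z unfolding powr_def by (simp add: exp_add[symmetric] algebra_simps)
      then have "(of_real r * z) powr (- of_real (1 + \<mu>)) = of_real (r powr (- (1 + \<mu>))) * z powr (- of_real (1 + \<mu>))"
        unfolding exp_of_real using r z by (simp add: powr_def)
      moreover have "r powr (1 + \<mu>) * r powr (- (1 + \<mu>)) = 1"
        using r by (simp flip: powr_add)
      ultimately show "z powr (- of_real (1 + \<mu>)) / c = of_real (r powr (1 + \<mu>)) * (of_real r + B) powr (- of_real (1 + \<mu>)) / c"
        unfolding rz by (metis mult.assoc mult_1 of_real_1 of_real_mult)
    qed
    ultimately have "(?F \<longlongrightarrow> 1 / c) at_top"
      by (auto intro: Lim_transform_eventually)
    then show ?thesis
      unfolding ereal_tendsto_simps by simp
  qed
  have "(LBINT r=0..\<infinity>. ?f r) = 1 / c - 0"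
    by (rule interval_integral_FTC_integrable[OF _ _ _ _ l1 l2])
       (use d cont int in \<open>auto simp: ei set_integrable_def\<close>)
  then show "(\<integral>r. indicator {0<..} r *\<^sub>R ?f r \<partial>lborel) = 1 / (of_real (1 + \<mu>) * B)"
    by (simp add: interval_lebesgue_integral_def set_lebesgue_integral_def ei c_def)
qed

section \<open>The reproducing formula of the upper half-plane\<close>

text \<open>
  The kernel \<open>\<rho>(\<zeta>, \<omega>)\<close> of the upper half-plane at \<open>\<omega> = u + ir\<close>. By \<open>rho2_heis\<close> the kernel of the
  Siegel domain is this function, evaluated at \<open>r = s + |v|\<^sup>2\<close>, in the coordinates \<open>(v, s, u)\<close>.
\<close>

definition hker :: "complex \<Rightarrow> real \<Rightarrow> real \<Rightarrow> complex" where
  "hker \<zeta> r u = (\<i> / 2) * (cnj (Complex u r) - \<zeta>)"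

lemma hker_eq: "hker \<zeta> r u = Complex ((r + Im \<zeta>) / 2) ((u - Re \<zeta>) / 2)"
  by (simp add: hker_def complex_eq_iff)

lemma hker_measurable [measurable]:
  assumes [measurable]: "f \<in> borel_measurable M" "g \<in> borel_measurable M"
  shows "(\<lambda>x. hker \<zeta> (f x) (g x)) \<in> borel_measurable M"
  unfolding hker_eq Complex_eq by measurable

lemma powr_real_measurable [measurable]:
  assumes [measurable]: "f \<in> borel_measurable M"
  shows "(\<lambda>x. (f x :: complex) powr complex_of_real a) \<in> borel_measurable M"
  unfolding powr_def by measurable

definition hpint :: "real \<Rightarrow> complex \<Rightarrow> (complex \<Rightarrow> complex) \<Rightarrow> real \<times> real \<Rightarrow> complex" where
  "hpint \<mu> \<zeta> g = (\<lambda>(r, u). indicator {0<..} r *\<^sub>R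
     (of_real (r powr \<mu>) / hker \<zeta> r u powr of_real (2 + \<mu>) * g (Complex u r)))"

text \<open>
  The mean over a disc of radius \<open>h/2\<close> bounds \<open>|g|\<close> by the integral of \<open>|g|\<close>, and on that disc the
  weight is at least a constant times a negative power of \<open>|\<omega> + i|\<close>. The point is that a single exponent \<open>m\<close> serves all
  heights \<open>h\<close>, since the regularisation below depends on \<open>m\<close>.
\<close>

lemma half_plane_growth:
  fixes g :: "complex \<Rightarrow> complex" and \<mu> :: real
  assumes \<mu>: "\<mu> > -1" and \<zeta>: "0 < Im \<zeta>" and hol: "g holomorphic_on {\<omega>. 0 < Im \<omega>}"
    and int: "integrable plane (hpint \<mu> \<zeta> g)"
  shows "\<exists>m. \<forall>h>0. \<exists>C. \<forall>\<omega>. h \<le> Im \<omega> \<longrightarrow> cmod (g \<omega>) \<le> C * cmod (\<omega> + \<i>) ^ m"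
proof -
  define J where "J \<eta> = indicator {0<..} (Im \<eta>) * (Im \<eta> powr \<mu> / cmod (hker \<zeta> (Im \<eta>) (Re \<eta>)) powr (2 + \<mu>) * cmod (g \<eta>))" for \<eta>
  have S: "open {\<omega>. 0 < Im \<omega>}" by (rule open_halfspace_Im_gt)
  have contg: "continuous_on {\<omega>. 0 < Im \<omega>} g"
    using hol by (rule holomorphic_on_imp_continuous_on)
  have Jint: "integrable lborel J"
  proof -
    define gg where "gg \<eta> = indicator {\<omega>. 0 < Im \<omega>} \<eta> *\<^sub>R g \<eta>" for \<eta>
    have [measurable]: "gg \<in> borel_measurable borel"
      unfolding gg_def using S contg by (intro borel_measurable_continuous_on_indicator) auto
    have J: "J = (\<lambda>\<eta>. indicator {0<..} (Im \<eta>) * (Im \<eta> powr \<mu> / cmod (hker \<zeta> (Im \<eta>) (Re \<eta>)) powr (2 + \<mu>) * cmod (gg \<eta>)))"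
      by (auto simp: J_def gg_def indicator_def)
    have [measurable]: "J \<in> borel_measurable borel"
      unfolding J by measurable
    have "integrable plane (\<lambda>p. J (case p of (r, u) \<Rightarrow> Complex u r))"
      using integrable_norm[OF int]
      by (rule Bochner_Integration.integrable_cong[THEN iffD1, rotated -1])
         (auto simp: hpint_def J_def indicator_def norm_mult norm_divide norm_powr_real_powr')
    then show ?thesis
      using integrable_distr_eq[OF Complex_measurable, of J] unfolding distr_plane_Complex by simp
  qed
  \<comment> \<open>\<open>2 + \<mu>\<close> from the kernel and one more power from \<open>r\<^sup>-\<^sup>\<mu> = r r\<^sup>-\<^sup>(\<^sup>1\<^sup>+\<^sup>\<mu>\<^sup>)\<close>, whose second factor is bounded for \<open>r \<ge> h/2\<close>.\<close>
  define m where "m = nat \<lceil>3 + \<mu>\<rceil>"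
  have m: "3 + \<mu> \<le> real m" unfolding m_def by (rule real_nat_ceiling_ge)
  have "\<exists>C. \<forall>\<omega>. h \<le> Im \<omega> \<longrightarrow> cmod (g \<omega>) \<le> C * cmod (\<omega> + \<i>) ^ m" if h: "0 < h" for h
  proof -
    define k where "k = 2 + h + cmod \<zeta>"
    have k: "1 \<le> k" using h by (simp add: k_def add_increasing)
    define K where "K = (h / 2) powr (- (1 + \<mu>)) * k powr (3 + \<mu>)"
    have "cmod (g \<omega>) \<le> (K * (\<integral>\<eta>. J \<eta> \<partial>lborel) / (pi * (h / 2)\<^sup>2)) * cmod (\<omega> + \<i>) ^ m" if \<omega>: "h \<le> Im \<omega>" for \<omega>
    proof -
      have 1: "1 \<le> cmod (\<omega> + \<i>)"
        using abs_Im_le_cmod[of "\<omega> + \<i>"] \<omega> h by simp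
      have sub: "cball \<omega> (h / 2) \<subseteq> {\<omega>. h / 2 \<le> Im \<omega>}"
      proof
        fix \<eta> assume "\<eta> \<in> cball \<omega> (h / 2)"
        then have "\<bar>Im (\<omega> - \<eta>)\<bar> \<le> h / 2"
          using abs_Im_le_cmod[of "\<omega> - \<eta>"] by (simp add: dist_norm)
        with \<omega> show "\<eta> \<in> {\<omega>. h / 2 \<le> Im \<omega>}"
          unfolding mem_Collect_eq minus_complex.simps by linarith
      qed
      then have sub': "cball \<omega> (h / 2) \<subseteq> {\<omega>. 0 < Im \<omega>}"
        using h by fastforce
      have pt: "indicator (cball \<omega> (h / 2)) \<eta> * cmod (g \<eta>) \<le> K * cmod (\<omega> + \<i>) ^ m * J \<eta>" for \<eta>
      proof (cases "\<eta> \<in> cball \<omega> (h / 2)")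
        case True
        define r where "r = Im \<eta>"
        define q where "q = cmod (hker \<zeta> (Im \<eta>) (Re \<eta>))"
        have r: "h / 2 \<le> r" "0 < r" using sub True h by (auto simp: r_def)
        have "0 < Re (hker \<zeta> (Im \<eta>) (Re \<eta>))"
          using r \<zeta> by (simp add: hker_eq r_def)
        then have q: "0 < q" unfolding q_def using complex_Re_le_cmod order_less_le_trans by blast
        have "cmod \<eta> \<le> cmod \<omega> + cmod (\<eta> - \<omega>)"
          using norm_triangle_ineq[of \<omega> "\<eta> - \<omega>"] by simp
        also have "\<dots> \<le> cmod (\<omega> + \<i>) + 1 + h / 2"
          using True norm_triangle_ineq4[of "\<omega> + \<i>" \<i>] by (simp add: dist_norm norm_minus_commute)
        finally have e: "cmod \<eta> + cmod \<zeta> \<le> cmod (\<omega> + \<i>) + (1 + h + cmod \<zeta>) * 1"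
          using h by simp
        also have "\<dots> \<le> cmod (\<omega> + \<i>) + (1 + h + cmod \<zeta>) * cmod (\<omega> + \<i>)"
          using 1 h by (intro add_left_mono mult_left_mono) auto
        also have "\<dots> = k * cmod (\<omega> + \<i>)"
          by (simp add: k_def algebra_simps)
        finally have e: "cmod \<eta> + cmod \<zeta> \<le> k * cmod (\<omega> + \<i>)" .
        have "q = cmod (cnj \<eta> - \<zeta>) / 2"
          by (simp add: q_def hker_def norm_mult)
        also have "\<dots> \<le> cmod \<eta> + cmod \<zeta>"
          using norm_triangle_ineq4[of "cnj \<eta>" \<zeta>] norm_ge_zero[of \<eta>] norm_ge_zero[of \<zeta>]
          unfolding complex_mod_cnj by linarith
        finally have q1: "q \<le> k * cmod (\<omega> + \<i>)" using e by simp
        have r1: "r \<le> k * cmod (\<omega> + \<i>)"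
          using abs_Im_le_cmod[of \<eta>] e norm_ge_zero[of \<zeta>] unfolding r_def by linarith
        have k1: "1 \<le> k * cmod (\<omega> + \<i>)"
          using mult_mono[OF k 1] k by simp
        have "q powr (2 + \<mu>) / r powr \<mu> = q powr (2 + \<mu>) * r * r powr (- (1 + \<mu>))"
        proof -
          have "r powr (1 + - (1 + \<mu>)) = r * r powr (- (1 + \<mu>))"
            using r by (subst powr_add) simp
          moreover have "r powr (1 + - (1 + \<mu>)) = 1 / r powr \<mu>"
            by (simp add: powr_minus_divide)
          ultimately show ?thesis by (simp add: mult.assoc)
        qed
        also have "\<dots> \<le> (k * cmod (\<omega> + \<i>)) powr (2 + \<mu>) * (k * cmod (\<omega> + \<i>)) * (h / 2) powr (- (1 + \<mu>))"
          using q q1 r r1 \<mu> h k1 by (intro mult_mono powr_mono2 powr_mono2') auto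
        also have "(k * cmod (\<omega> + \<i>)) powr (2 + \<mu>) * (k * cmod (\<omega> + \<i>)) = (k * cmod (\<omega> + \<i>)) powr (3 + \<mu>)"
        proof -
          have "(k * cmod (\<omega> + \<i>)) powr (3 + \<mu>) = (k * cmod (\<omega> + \<i>)) powr ((2 + \<mu>) + 1)" by simp
          then show ?thesis
            using k1 by (simp only: powr_add) simp
        qed
        also have "\<dots> * (h / 2) powr (- (1 + \<mu>)) = K * cmod (\<omega> + \<i>) powr (3 + \<mu>)"
          using k by (simp add: K_def powr_mult)
        also have "\<dots> \<le> K * cmod (\<omega> + \<i>) powr (real m)"
          using 1 m by (intro mult_left_mono powr_mono) (auto simp: K_def)
        also have "cmod (\<omega> + \<i>) powr (real m) = cmod (\<omega> + \<i>) ^ m"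
          using 1 by (subst powr_realpow) auto
        finally have "q powr (2 + \<mu>) / r powr \<mu> * J \<eta> \<le> K * cmod (\<omega> + \<i>) ^ m * J \<eta>"
          by (rule mult_right_mono) (simp add: J_def)
        moreover have "q powr (2 + \<mu>) / r powr \<mu> * J \<eta> = cmod (g \<eta>)"
        proof -
          have "J \<eta> = r powr \<mu> / q powr (2 + \<mu>) * cmod (g \<eta>)"
            using r by (simp add: J_def r_def q_def)
          then show ?thesis using r q by simp
        qed
        ultimately show ?thesis using True by simp
      next
        case False
        then show ?thesis by (auto simp: J_def K_def)
      qed
      have "pi * (h / 2)\<^sup>2 * cmod (g \<omega>) \<le> (\<integral>\<eta>. indicator (cball \<omega> (h / 2)) \<eta> * cmod (g \<eta>) \<partial>lborel)"
        using h by (intro disc_mean_bound[OF S hol sub']) auto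
      also have "\<dots> \<le> (\<integral>\<eta>. K * cmod (\<omega> + \<i>) ^ m * J \<eta> \<partial>lborel)"
      proof (rule integral_mono[OF _ integrable_mult_right[OF Jint] pt])
        have "integrable lborel (\<lambda>\<eta>. indicator (cball \<omega> (h / 2)) \<eta> *\<^sub>R cmod (g \<eta>))"
          using contg sub' by (intro borel_integrable_compact continuous_intros) (auto intro: continuous_on_subset)
        then show "integrable lborel (\<lambda>\<eta>. indicator (cball \<omega> (h / 2)) \<eta> * cmod (g \<eta>))" by simp
      qed
      also have "\<dots> = K * cmod (\<omega> + \<i>) ^ m * (\<integral>\<eta>. J \<eta> \<partial>lborel)"
        by (rule integral_mult_right_zero)
      finally have *: "cmod (g \<omega>) * (pi * (h / 2)\<^sup>2) \<le> K * cmod (\<omega> + \<i>) ^ m * (\<integral>\<eta>. J \<eta> \<partial>lborel)"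
        by (simp add: mult_ac)
      have "0 < pi * (h / 2)\<^sup>2" using h by simp
      with * have "cmod (g \<omega>) \<le> K * cmod (\<omega> + \<i>) ^ m * (\<integral>\<eta>. J \<eta> \<partial>lborel) / (pi * (h / 2)\<^sup>2)"
        by (subst pos_le_divide_eq)
      then show ?thesis by (simp add: mult_ac)
    qed
    then show ?thesis by blast
  qed
  then show ?thesis by blast
qed

text \<open>
  On the line \<open>Im \<omega> = r\<close> the kernel equals \<open>(i/2)(\<omega> - 2ir - \<zeta>)\<close>, which has positive real part
  for \<open>Im \<omega> < 2r + Im \<zeta>\<close>. This range contains the height \<open>r\<close> as well as \<open>h = Im \<zeta>/2\<close>, for every \<open>r > 0\<close>.
\<close>

lemma half_plane_reproducing_decaying:
  fixes g :: "complex \<Rightarrow> complex" and \<mu> :: real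
  assumes \<mu>: "\<mu> > -1" and \<zeta>: "0 < Im \<zeta>" and hol: "g holomorphic_on {\<omega>. 0 < Im \<omega>}"
    and bnd: "\<And>h. 0 < h \<Longrightarrow> \<exists>C. \<forall>\<omega>. h \<le> Im \<omega> \<longrightarrow> cmod (g \<omega>) \<le> C / (cmod (\<omega> + \<i>))\<^sup>2"
    and int: "integrable plane (hpint \<mu> \<zeta> g)"
  shows "(\<integral>p. hpint \<mu> \<zeta> g p \<partial>plane) = of_real (4 * pi / (1 + \<mu>)) * g \<zeta>"
proof -
  define h where "h = Im \<zeta> / 2"
  define B where "B u = (\<i> / 2) * (Complex u h - \<zeta>)" for u
  have h: "0 < h" "h < Im \<zeta>" using \<zeta> by (auto simp: h_def)
  have ReB: "Re (B u) = h / 2" for u by (simp add: B_def h_def)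
  have shift: "(\<integral>u. g (Complex u r) / hker \<zeta> r u powr of_real (2 + \<mu>) \<partial>lborel)
      = (\<integral>u. g (Complex u h) / (of_real r + B u) powr of_real (2 + \<mu>) \<partial>lborel)" if r: "0 < r" for r
  proof -
    \<comment> \<open>A strip around both heights in which the real part of the kernel is at least \<open>h/4\<close>.\<close>
    define b d where "b = min r h / 2" and "d = max r h + h / 2"
    have bd: "0 < b" "b < min r h" "max r h < d" "d + h / 2 \<le> 2 * r + Im \<zeta>"
      using r h by (auto simp: b_def d_def h_def)
    define k where "k \<omega> = (\<i> / 2) * (\<omega> - 2 * \<i> * of_real r - \<zeta>)" for \<omega>
    have Rek: "h / 4 \<le> Re (k \<omega>)" if "Im \<omega> < d" for \<omega>
      using that bd by (simp add: k_def)
    have knz: "k \<omega> \<notin> \<real>\<^sub>\<le>\<^sub>0" "k \<omega> \<noteq> 0" if "Im \<omega> < d" for \<omega>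
      using Rek[OF that] h by (auto simp: complex_nonpos_Reals_iff)
    define H where "H \<omega> = g \<omega> / k \<omega> powr of_real (2 + \<mu>)" for \<omega>
    obtain C where C: "\<And>\<omega>. b \<le> Im \<omega> \<Longrightarrow> cmod (g \<omega>) \<le> C / (cmod (\<omega> + \<i>))\<^sup>2"
      using bnd[OF bd(1)] by auto
    have hol': "H holomorphic_on {\<omega>. b < Im \<omega> \<and> Im \<omega> < d}"
    proof -
      have "k holomorphic_on {\<omega>. b < Im \<omega> \<and> Im \<omega> < d}"
        unfolding k_def by (intro holomorphic_intros)
      moreover have "g holomorphic_on {\<omega>. b < Im \<omega> \<and> Im \<omega> < d}"
        using hol bd by (rule_tac holomorphic_on_subset) auto
      ultimately show ?thesis
        unfolding H_def using knz by (intro holomorphic_intros) auto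
    qed
    have bound: "cmod (H \<omega>) \<le> \<bar>C\<bar> / (h / 4) powr (2 + \<mu>) / (1 + (Re \<omega>)\<^sup>2)" if "b < Im \<omega>" "Im \<omega> < d" for \<omega>
    proof -
      have "h / 4 \<le> cmod (k \<omega>)"
        using Rek[OF that(2)] complex_Re_le_cmod[of "k \<omega>"] by linarith
      then have 1: "(h / 4) powr (2 + \<mu>) \<le> cmod (k \<omega>) powr (2 + \<mu>)"
        using h \<mu> by (intro powr_mono2) auto
      have 2: "1 + (Re \<omega>)\<^sup>2 \<le> (cmod (\<omega> + \<i>))\<^sup>2"
      proof -
        have "1\<^sup>2 \<le> (Im \<omega> + 1)\<^sup>2" using that bd by (intro power_mono) auto
        then show ?thesis unfolding cmod_power2 by simp
      qed
      have "0 < 1 + (Re \<omega>)\<^sup>2" by (simp add: add_pos_nonneg)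
      then have "C / (cmod (\<omega> + \<i>))\<^sup>2 \<le> \<bar>C\<bar> / (1 + (Re \<omega>)\<^sup>2)"
        using 2 by (intro frac_le) auto
      then have "cmod (g \<omega>) \<le> \<bar>C\<bar> / (1 + (Re \<omega>)\<^sup>2)"
        using C[of \<omega>] that by simp
      moreover have "cmod (H \<omega>) = cmod (g \<omega>) / cmod (k \<omega>) powr (2 + \<mu>)"
        by (simp add: H_def norm_divide norm_powr_real_powr')
      moreover have "0 < (h / 4) powr (2 + \<mu>)" using h by simp
      ultimately have "cmod (H \<omega>) \<le> (\<bar>C\<bar> / (1 + (Re \<omega>)\<^sup>2)) / (h / 4) powr (2 + \<mu>)"
        using 1 by (simp only:) (rule frac_le, auto)
      then show ?thesis by (simp add: mult.commute)
    qed
    have "(\<integral>x. H (Complex x (min r h)) \<partial>lborel) = (\<integral>x. H (Complex x (max r h)) \<partial>lborel)"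
      by (rule horizontal_line_shift[OF hol' bound]) (use bd in auto)
    then have "(\<integral>x. H (Complex x r) \<partial>lborel) = (\<integral>x. H (Complex x h) \<partial>lborel)"
      by (cases "r \<le> h") (auto simp: min_def max_def)
    moreover have "k (Complex u r) = hker \<zeta> r u" "k (Complex u h) = of_real r + B u" for u
      by (auto simp: k_def hker_def B_def complex_eq_iff)
    ultimately show ?thesis by (simp add: H_def)
  qed
  let ?G = "\<lambda>(r, u). indicator {0<..} r *\<^sub>R (of_real (r powr \<mu>) / (of_real r + B u) powr of_real (2 + \<mu>) * g (Complex u h))"
  obtain C where C: "\<And>\<omega>. h \<le> Im \<omega> \<Longrightarrow> cmod (g \<omega>) \<le> C / (cmod (\<omega> + \<i>))\<^sup>2"
    using bnd[OF h(1)] by auto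
  have gh: "cmod (g (Complex u h)) \<le> \<bar>C\<bar> * (1 / (1 + u\<^sup>2))" for u
  proof -
    have "1\<^sup>2 \<le> (h + 1)\<^sup>2" using h by (intro power_mono) auto
    then have "1 + u\<^sup>2 \<le> (cmod (Complex u h + \<i>))\<^sup>2" unfolding cmod_power2 by simp
    moreover have "0 < 1 + u\<^sup>2" by (simp add: add_pos_nonneg)
    ultimately have "C / (cmod (Complex u h + \<i>))\<^sup>2 \<le> \<bar>C\<bar> / (1 + u\<^sup>2)"
      by (intro frac_le) auto
    then show ?thesis using C[of "Complex u h"] by simp
  qed
  have [measurable]: "(\<lambda>u. g (Complex u h)) \<in> borel_measurable borel"
    by (intro borel_measurable_continuous_onI continuous_on_compose2[OF holomorphic_on_imp_continuous_on[OF hol]])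
       (use h in \<open>auto simp: Complex_eq intro!: continuous_intros\<close>)
  have [measurable]: "B \<in> borel_measurable borel"
    unfolding B_def Complex_eq by measurable
  have Gint: "integrable plane ?G"
  proof (rule Bochner_Integration.integrable_bound)
    show "integrable plane (\<lambda>(r, u). (indicator {0<..} r * (r powr \<mu> / (r + h / 2) powr (2 + \<mu>))) * (\<bar>C\<bar> * (1 / (1 + u\<^sup>2))))"
    proof (rule integrable_lborel_times)
      show "integrable lborel (\<lambda>r. indicator {0<..} r * (r powr \<mu> / (r + h / 2) powr (2 + \<mu>)))"
        using h by (intro beta_integral_real \<mu>) auto
      show "integrable lborel (\<lambda>u::real. \<bar>C\<bar> * (1 / (1 + u\<^sup>2)))"
        using Cauchy_kernel_integral(1)[of 1 0] by (intro integrable_mult_right) (simp add: add.commute)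
    qed
    show "?G \<in> borel_measurable plane"
      by measurable
    show "AE p in plane. norm (?G p) \<le> norm (case p of (r, u) \<Rightarrow> (indicator {0<..} r * (r powr \<mu> / (r + h / 2) powr (2 + \<mu>))) * (\<bar>C\<bar> * (1 / (1 + u\<^sup>2))))"
    proof (rule AE_I2)
      fix p :: "real \<times> real"
      obtain r u where p: "p = (r, u)" by (cases p)
      show "norm (?G p) \<le> norm (case p of (r, u) \<Rightarrow> (indicator {0<..} r * (r powr \<mu> / (r + h / 2) powr (2 + \<mu>))) * (\<bar>C\<bar> * (1 / (1 + u\<^sup>2))))"
      proof (cases "0 < r")
        case True
        have "r + h / 2 \<le> cmod (of_real r + B u)"
          using complex_Re_le_cmod[of "of_real r + B u"] by (simp add: ReB)
        then have "(r + h / 2) powr (2 + \<mu>) \<le> cmod (of_real r + B u) powr (2 + \<mu>)"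
          using True h \<mu> by (intro powr_mono2) auto
        then have "r powr \<mu> / cmod (of_real r + B u) powr (2 + \<mu>) \<le> r powr \<mu> / (r + h / 2) powr (2 + \<mu>)"
          using True h by (intro frac_le) auto
        from mult_mono[OF this gh[of u]] True show ?thesis
          by (simp add: p norm_mult norm_divide norm_powr_real_powr' abs_mult)
      qed (simp add: p)
    qed
  qed
  have "(\<integral>p. hpint \<mu> \<zeta> g p \<partial>plane) = (\<integral>r. \<integral>u. hpint \<mu> \<zeta> g (r, u) \<partial>lborel \<partial>lborel)"
    using lborel_pair.integral_fst'[OF int] by simp
  also have "\<dots> = (\<integral>r. \<integral>u. ?G (r, u) \<partial>lborel \<partial>lborel)"
  proof (rule Bochner_Integration.integral_cong[OF refl])
    fix r :: real
    have "(\<integral>u. hpint \<mu> \<zeta> g (r, u) \<partial>lborel)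
        = indicator {0<..} r *\<^sub>R (of_real (r powr \<mu>) * (\<integral>u. g (Complex u r) / hker \<zeta> r u powr of_real (2 + \<mu>) \<partial>lborel))"
      by (simp add: hpint_def flip: integral_mult_right_zero)
    also have "\<dots> = indicator {0<..} r *\<^sub>R (of_real (r powr \<mu>) * (\<integral>u. g (Complex u h) / (of_real r + B u) powr of_real (2 + \<mu>) \<partial>lborel))"
    proof (cases "0 < r")
      case True
      then show ?thesis by (simp only: shift)
    qed simp
    also have "\<dots> = (\<integral>u. ?G (r, u) \<partial>lborel)"
      by (simp flip: integral_mult_right_zero)
    finally show "(\<integral>u. hpint \<mu> \<zeta> g (r, u) \<partial>lborel)
        = (\<integral>u. ?G (r, u) \<partial>lborel)" .
  qed
  also have "\<dots> = (\<integral>u. \<integral>r. ?G (r, u) \<partial>lborel \<partial>lborel)"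
    using lborel_pair.Fubini_integral[OF Gint] by simp
  also have "\<dots> = (\<integral>u. (- 2 * \<i> / of_real (1 + \<mu>)) * (g (Complex u h) / (Complex u h - \<zeta>)) \<partial>lborel)"
  proof (rule Bochner_Integration.integral_cong[OF refl])
    fix u :: real
    have nz: "Complex u h - \<zeta> \<noteq> 0" using h by (auto simp: complex_eq_iff)
    have "(\<integral>r. ?G (r, u) \<partial>lborel)
       = (\<integral>r. indicator {0<..} r *\<^sub>R (of_real (r powr \<mu>) / (of_real r + B u) powr of_real (2 + \<mu>)) * g (Complex u h) \<partial>lborel)"
      by simp
    also have "\<dots> = (\<integral>r. indicator {0<..} r *\<^sub>R (of_real (r powr \<mu>) / (of_real r + B u) powr of_real (2 + \<mu>)) \<partial>lborel) * g (Complex u h)"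
      by (rule integral_mult_left_zero)
    also have "\<dots> = 1 / (of_real (1 + \<mu>) * B u) * g (Complex u h)"
      using h by (subst beta_integral(2)[OF \<mu>]) (auto simp: ReB)
    also have "1 / B u = - 2 * \<i> / (Complex u h - \<zeta>)"
      using nz by (simp add: B_def field_simps)
    then have "1 / (of_real (1 + \<mu>) * B u) * g (Complex u h) = (- 2 * \<i> / of_real (1 + \<mu>)) * (g (Complex u h) / (Complex u h - \<zeta>))"
      by (metis (no_types, opaque_lifting) mult.commute mult.left_commute times_divide_eq_left times_divide_eq_right mult_1 divide_divide_eq_left)
    finally show "(\<integral>r. ?G (r, u) \<partial>lborel) = (- 2 * \<i> / of_real (1 + \<mu>)) * (g (Complex u h) / (Complex u h - \<zeta>))" .
  qed
  also have "\<dots> = (- 2 * \<i> / of_real (1 + \<mu>)) * (2 * pi * \<i> * g \<zeta>)"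
    by (simp only: integral_mult_right_zero Cauchy_integral_horizontal_line[OF hol bnd h])
  also have "\<dots> = of_real (4 * pi / (1 + \<mu>)) * g \<zeta>"
    by (simp add: mult_ac)
  finally show ?thesis .
qed

text \<open>
  Dividing \<open>g\<close> by \<open>(1 - i\<epsilon>\<omega>)\<^sup>m\<^sup>+\<^sup>2\<close> does not increase its modulus, and brings the growth \<open>|\<omega> + i|\<^sup>m\<close>
  down to the decay required before.
\<close>

theorem half_plane_reproducing:
  fixes g :: "complex \<Rightarrow> complex" and \<mu> :: real
  assumes \<mu>: "\<mu> > -1" and \<zeta>: "0 < Im \<zeta>" and hol: "g holomorphic_on {\<omega>. 0 < Im \<omega>}"
    and int: "integrable plane (hpint \<mu> \<zeta> g)"
  shows "(\<integral>p. hpint \<mu> \<zeta> g p \<partial>plane) = of_real (4 * pi / (1 + \<mu>)) * g \<zeta>"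
proof -
  let ?F = "hpint \<mu> \<zeta>"
  obtain m where m: "\<And>h. 0 < h \<Longrightarrow> \<exists>C. \<forall>\<omega>. h \<le> Im \<omega> \<longrightarrow> cmod (g \<omega>) \<le> C * cmod (\<omega> + \<i>) ^ m"
    using half_plane_growth[OF \<mu> \<zeta> hol int] by blast
  define \<epsilon> where "\<epsilon> k = 1 / (real k + 1)" for k :: nat
  have \<epsilon>: "0 < \<epsilon> k" "\<epsilon> k \<le> 1" for k by (auto simp: \<epsilon>_def)
  define e where "e k \<omega> = (1 - \<i> * of_real (\<epsilon> k) * \<omega>) ^ (m + 2)" for k \<omega>
  define G where "G k \<omega> = g \<omega> / e k \<omega>" for k \<omega>
  have e1: "1 \<le> cmod (e k \<omega>)" and e2: "(\<epsilon> k * cmod (\<omega> + \<i>)) ^ (m + 2) \<le> cmod (e k \<omega>)" if "0 < Im \<omega>" for k \<omega>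
  proof -
    let ?z = "1 - \<i> * of_real (\<epsilon> k) * \<omega>"
    have "1 \<le> Re ?z" using that \<epsilon>[of k] by simp
    then have "1 \<le> cmod ?z" using complex_Re_le_cmod[of ?z] by linarith
    then show "1 \<le> cmod (e k \<omega>)"
      unfolding e_def norm_power by (rule one_le_power)
    have "(\<epsilon> k * cmod (\<omega> + \<i>))\<^sup>2 \<le> (cmod ?z)\<^sup>2"
    proof -
      have "\<epsilon> k * Im \<omega> + \<epsilon> k \<le> 1 + \<epsilon> k * Im \<omega>" using \<epsilon>[of k] by simp
      then have "(\<epsilon> k * Im \<omega> + \<epsilon> k)\<^sup>2 \<le> (1 + \<epsilon> k * Im \<omega>)\<^sup>2"
        using \<epsilon>[of k] that by (intro power_mono) auto
      then show ?thesis
        unfolding power_mult_distrib cmod_power2 by (simp add: power2_eq_square algebra_simps)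
    qed
    then have "\<epsilon> k * cmod (\<omega> + \<i>) \<le> cmod ?z"
      using norm_ge_zero by (rule power2_le_imp_le)
    then show "(\<epsilon> k * cmod (\<omega> + \<i>)) ^ (m + 2) \<le> cmod (e k \<omega>)"
      unfolding e_def norm_power using \<epsilon>[of k] by (intro power_mono) auto
  qed
  have enz: "e k \<omega> \<noteq> 0" if "0 < Im \<omega>" for k \<omega>
    using e1[OF that, of k] by auto
  have [measurable]: "?F g \<in> borel_measurable plane"
    using int by (rule borel_measurable_integrable)
  have [measurable]: "(\<lambda>(r, u). e k (Complex u r)) \<in> borel_measurable plane" for k
    unfolding e_def Complex_eq case_prod_beta by measurable
  have FG: "?F (G k) p = ?F g p / (case p of (r, u) \<Rightarrow> e k (Complex u r))" for k p
    by (simp add: hpint_def G_def case_prod_beta scaleR_conv_of_real)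
  have meas: "?F (G k) \<in> borel_measurable plane" for k
    unfolding FG by measurable
  have dom: "norm (?F (G k) p) \<le> norm (?F g p)" for k p
  proof -
    obtain r u where p: "p = (r, u)" by (cases p)
    show ?thesis
    proof (cases "0 < r")
      case True
      have "norm (?F g p) / cmod (e k (Complex u r)) \<le> norm (?F g p) / 1"
        using e1[of "Complex u r" k] True by (intro divide_left_mono) auto
      then show ?thesis unfolding FG by (simp add: p norm_divide)
    qed (simp add: p hpint_def)
  qed
  have conv: "(\<lambda>k. ?F (G k) p) \<longlonglongrightarrow> ?F g p" for p
  proof -
    have "(\<lambda>k. 1 - \<i> * of_real (\<epsilon> k) * \<omega>) \<longlonglongrightarrow> 1 - \<i> * of_real 0 * \<omega>" for \<omega>
    proof -
      have "\<epsilon> \<longlonglongrightarrow> 0" unfolding \<epsilon>_def by real_asymp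
      then show ?thesis by (intro tendsto_intros)
    qed
    then have "(\<lambda>k. e k \<omega>) \<longlonglongrightarrow> 1 ^ (m + 2)" for \<omega>
      unfolding e_def by (intro tendsto_power) simp
    then have "(\<lambda>k. case p of (r, u) \<Rightarrow> e k (Complex u r)) \<longlonglongrightarrow> 1"
      by (cases p) simp
    from tendsto_divide[OF tendsto_const this, of "?F g p"] show ?thesis
      unfolding FG by simp
  qed
  have G: "(\<integral>p. ?F (G k) p \<partial>plane) = of_real (4 * pi / (1 + \<mu>)) * G k \<zeta>" for k
  proof (rule half_plane_reproducing_decaying[OF \<mu> \<zeta>])
    show "G k holomorphic_on {\<omega>. 0 < Im \<omega>}"
      unfolding G_def using enz hol by (intro holomorphic_intros) (auto simp: e_def intro!: holomorphic_intros)
    show "integrable plane (?F (G k))"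
      by (rule Bochner_Integration.integrable_bound[OF int meas]) (use dom in auto)
    fix h :: real assume h: "0 < h"
    then obtain C where C: "\<And>\<omega>. h \<le> Im \<omega> \<Longrightarrow> cmod (g \<omega>) \<le> C * cmod (\<omega> + \<i>) ^ m"
      using m by blast
    have "cmod (G k \<omega>) \<le> (\<bar>C\<bar> / \<epsilon> k ^ (m + 2)) / (cmod (\<omega> + \<i>))\<^sup>2" if "h \<le> Im \<omega>" for \<omega>
    proof -
      have w: "0 < cmod (\<omega> + \<i>)"
        using that h by (auto simp: complex_eq_iff)
      have "cmod (G k \<omega>) \<le> (\<bar>C\<bar> * cmod (\<omega> + \<i>) ^ m) / (\<epsilon> k * cmod (\<omega> + \<i>)) ^ (m + 2)"
        unfolding G_def norm_divide
      proof (rule frac_le)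
        show "cmod (g \<omega>) \<le> \<bar>C\<bar> * cmod (\<omega> + \<i>) ^ m"
          by (rule order_trans[OF C[OF that]]) (intro mult_right_mono, auto)
        show "(\<epsilon> k * cmod (\<omega> + \<i>)) ^ (m + 2) \<le> cmod (e k \<omega>)"
          using that h by (intro e2) auto
        show "0 < (\<epsilon> k * cmod (\<omega> + \<i>)) ^ (m + 2)"
          using w \<epsilon>[of k] by simp
      qed simp
      also have "\<dots> = (\<bar>C\<bar> / \<epsilon> k ^ (m + 2)) / (cmod (\<omega> + \<i>))\<^sup>2"
        using w unfolding power_mult_distrib power_add by simp
      finally show ?thesis .
    qed
    then show "\<exists>C. \<forall>\<omega>. h \<le> Im \<omega> \<longrightarrow> cmod (G k \<omega>) \<le> C / (cmod (\<omega> + \<i>))\<^sup>2"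
      by blast
  qed
  have "(\<lambda>k. \<integral>p. ?F (G k) p \<partial>plane) \<longlonglongrightarrow> (\<integral>p. ?F g p \<partial>plane)"
  proof (rule integral_dominated_convergence[where w = "\<lambda>p. norm (?F g p)"])
    show "?F g \<in> borel_measurable plane"
      using int by (rule borel_measurable_integrable)
    show "integrable plane (\<lambda>p. norm (?F g p))"
      using int by (rule integrable_norm)
    show "?F (G k) \<in> borel_measurable plane" for k
      by (rule meas)
    show "AE p in plane. (\<lambda>k. ?F (G k) p) \<longlonglongrightarrow> ?F g p"
      by (intro AE_I2 conv)
    show "AE p in plane. norm (?F (G k) p) \<le> norm (?F g p)" for k
      by (intro AE_I2 dom)
  qed
  moreover have "(\<lambda>k. of_real (4 * pi / (1 + \<mu>)) * G k \<zeta>) \<longlonglongrightarrow> of_real (4 * pi / (1 + \<mu>)) * (g \<zeta> / 1)"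
  proof -
    have "\<epsilon> \<longlonglongrightarrow> 0" unfolding \<epsilon>_def by real_asymp
    then have "(\<lambda>k. e k \<zeta>) \<longlonglongrightarrow> (1 - \<i> * of_real 0 * \<zeta>) ^ (m + 2)"
      unfolding e_def by (intro tendsto_intros)
    then have "(\<lambda>k. e k \<zeta>) \<longlonglongrightarrow> 1" by simp
    then show ?thesis
      unfolding G_def by (intro tendsto_mult tendsto_divide tendsto_const) auto
  qed
  ultimately show ?thesis
    unfolding G by (auto dest: LIMSEQ_unique)
qed

section \<open>From the Siegel domain to the half-plane\<close>

lemma open_siegel: "open (siegel :: ('n :: {finite, linorder}) cvec set)"
  unfolding siegel_def by (intro open_Collect_less continuous_intros)

lemma siegel_borel [measurable]: "siegel \<in> sets borel"
  using open_siegel by (rule borel_open)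

lemma holomorphic_sv_continuous_on:
  assumes "holomorphic_sv f S"
  shows "continuous_on S f"
  using assms unfolding holomorphic_sv_def
  by (metis continuous_at_imp_continuous_on has_derivative_continuous)

lemma bounded_linear_smult_vec: "bounded_linear (\<lambda>h. h *s (b :: ('n :: finite) cvec))"
  by (rule linear_conv_bounded_linear[THEN iffD1], rule linearI)
     (auto simp: vec_eq_iff algebra_simps)

text \<open>
  Apart from continuity, holomorphy in several variables enters through restriction to complex lines.
\<close>

lemma holomorphic_sv_line:
  assumes "holomorphic_sv f S"
  shows "(\<lambda>\<xi>. f (a + \<xi> *s b)) holomorphic_on {\<xi>. a + \<xi> *s b \<in> S}"
  unfolding holomorphic_on_def
proof
  fix \<xi> assume "\<xi> \<in> {\<xi>. a + \<xi> *s b \<in> S}"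
  then obtain D where D: "(f has_derivative D) (at (a + \<xi> *s b))" "\<And>c v. D (c *s v) = c * D v"
    using assms unfolding holomorphic_sv_def by auto
  have "bounded_linear (\<lambda>h. h *s b)"
    by (rule bounded_linear_smult_vec)
  then have "((\<lambda>\<xi>. a + \<xi> *s b) has_derivative (\<lambda>h. 0 + h *s b)) (at \<xi>)"
    by (intro has_derivative_add has_derivative_const bounded_linear_imp_has_derivative)
  from has_derivative_compose[OF this D(1)]
  have "((\<lambda>\<xi>. f (a + \<xi> *s b)) has_derivative (\<lambda>h. D b * h)) (at \<xi>)"
    by (simp add: D(2) mult.commute)
  then have "((\<lambda>\<xi>. f (a + \<xi> *s b)) has_field_derivative D b) (at \<xi>)"
    by (simp add: has_field_derivative_def)
  then show "(\<lambda>\<xi>. f (a + \<xi> *s b)) field_differentiable at \<xi> within {\<xi>. a + \<xi> *s b \<in> S}"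
    by (auto simp: field_differentiable_def intro: has_field_derivative_at_within)
qed

lemma open_line_vimage:
  fixes a b :: "('n :: finite) cvec"
  assumes "open S"
  shows "open {\<xi>. a + \<xi> *s b \<in> S}"
proof -
  have "bounded_linear (\<lambda>h. h *s b)"
    by (rule bounded_linear_smult_vec)
  then have "continuous (at \<xi>) (\<lambda>\<xi>. a + \<xi> *s b)" for \<xi>
    by (intro continuous_intros linear_continuous_at)
  then have "open ((\<lambda>\<xi>. a + \<xi> *s b) -` S)"
    using assms by (intro continuous_open_vimage) auto
  then show ?thesis by (simp add: vimage_def)
qed

lemma heis_cong: "(\<And>j. j \<noteq> last_ix \<Longrightarrow> v j = w j) \<Longrightarrow> heis z v \<omega> = heis z w \<omega>"
  by (simp add: heis_def vec_eq_iff)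

lemma heis_vertical: "heis z v (\<omega> + \<xi>) = heis z v \<omega> + \<xi> *s axis last_ix 1"
  by (simp add: heis_def vec_eq_iff axis_def)

lemma heis_radial:
  "heis z (\<lambda>j. \<xi> * v j) \<omega> = heis z (\<lambda>_. 0) \<omega>
     + \<xi> *s (\<chi> j. if j = last_ix then 2 * \<i> * (\<Sum>j\<in>UNIV - {last_ix}. v j * cnj (z $ j)) else v j)"
  by (simp add: heis_def vec_eq_iff sum_distrib_left mult_ac)

lemma sqn_scale: "sqn (\<lambda>j. c * v j) = (cmod c)\<^sup>2 * sqn v"
  by (simp add: sqn_def norm_mult power_mult_distrib sum_distrib_left)

lemma rho_hcoord: "rho (hcoord z (v, s, u)) = s"
  by (simp add: hcoord_def rho_heis)

lemma hcoord_in_siegel: "hcoord z (v, s, u) \<in> siegel \<longleftrightarrow> 0 < s"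
  by (simp add: mem_siegel_iff rho_hcoord)

lemma rho2_hcoord: "rho2 z (hcoord z (v, s, u)) = hker (base z) (s + sqn v) u"
  by (simp add: hcoord_def rho2_heis hker_def)

text \<open>
  Measurability is required of the extension by 0 only, because a holomorphic function on the domain
  has no prescribed values outside it.
\<close>

lemma siegel_integral_hcoord:
  fixes G :: "('n :: {finite, linorder}) cvec \<Rightarrow> complex"
  assumes meas: "(\<lambda>w. indicator siegel w *\<^sub>R G w) \<in> borel_measurable borel"
  shows "integrable (lebesgue_on siegel) G \<longleftrightarrow> integrable cmeas (\<lambda>(v, s, u). indicator {0<..} s *\<^sub>R G (hcoord z (v, s, u)))"
    and "(\<integral>w. G w \<partial>lebesgue_on siegel) = (\<integral>(v, s, u). indicator {0<..} s *\<^sub>R G (hcoord z (v, s, u)) \<partial>cmeas)"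
proof -
  let ?G = "\<lambda>w. indicator siegel w *\<^sub>R G w"
  have eq: "(\<lambda>(v, s, u). indicator {0<..} s *\<^sub>R G (hcoord z (v, s, u))) = (\<lambda>q. ?G (hcoord z q))"
    by (auto simp: indicator_def hcoord_in_siegel)
  have leb: "siegel \<inter> space lebesgue \<in> sets lebesgue"
    using siegel_borel by simp
  have "integrable (lebesgue_on siegel) G \<longleftrightarrow> integrable lebesgue ?G"
    by (rule integrable_restrict_space[OF leb])
  also have "\<dots> \<longleftrightarrow> integrable lborel ?G"
    using meas by (intro integrable_completion) simp
  also have "\<dots> \<longleftrightarrow> integrable cmeas (\<lambda>q. ?G (hcoord z q))"
    using integrable_distr_eq[OF hcoord_measurable meas, of z] unfolding distr_hcoord .
  finally show "integrable (lebesgue_on siegel) G \<longleftrightarrow> integrable cmeas (\<lambda>(v, s, u). indicator {0<..} s *\<^sub>R G (hcoord z (v, s, u)))"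
    unfolding eq .
  have "(\<integral>w. G w \<partial>lebesgue_on siegel) = (\<integral>w. ?G w \<partial>lebesgue)"
    by (rule integral_restrict_space[OF leb])
  also have "\<dots> = (\<integral>w. ?G w \<partial>lborel)"
    using meas by (intro integral_completion) simp
  also have "\<dots> = (\<integral>q. ?G (hcoord z q) \<partial>cmeas)"
    using integral_distr[OF hcoord_measurable meas, of z] unfolding distr_hcoord .
  finally show "(\<integral>w. G w \<partial>lebesgue_on siegel) = (\<integral>(v, s, u). indicator {0<..} s *\<^sub>R G (hcoord z (v, s, u)) \<partial>cmeas)"
    unfolding eq .
qed

lemma sigma_finite_cmeas: "sigma_finite_measure (cmeas :: (('n :: {finite, linorder} \<Rightarrow> complex) \<times> real \<times> real) measure)"
  by (intro sigma_finite_pair_measure sigma_finite_hmeas sigma_finite_plane)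

text \<open>
  The disc \<open>\<xi> v\<close>, \<open>|\<xi>| \<le> 1\<close>, at fixed last coordinate stays in the domain, since \<open>\<rho>\<close> there is
  \<open>s + (1 - |\<xi>|\<^sup>2) |v|\<^sup>2\<close>. Its centre is the point with \<open>v = 0\<close>.
\<close>

lemma hrot_circle_average:
  fixes f :: "('n :: {finite, linorder}) cvec \<Rightarrow> complex"
  assumes hol: "holomorphic_sv f siegel" and s: "0 < s"
  shows "(\<integral>t. indicator {0..1} t *\<^sub>R f (hcoord z (hrot t (v, s, u))) \<partial>lborel)
    = f (heis z (\<lambda>_. 0) (Complex u (s + sqn v)))"
proof -
  define \<omega> where "\<omega> = Complex u (s + sqn v)"
  define a where "a = heis z (\<lambda>_. 0) \<omega>"
  define b where "b = (\<chi> j. if j = last_ix then 2 * \<i> * (\<Sum>j\<in>UNIV - {last_ix}. v j * cnj (z $ j)) else v j)"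
  have line: "heis z (\<lambda>j. \<xi> * v j) \<omega> = a + \<xi> *s b" for \<xi>
    unfolding a_def b_def by (rule heis_radial)
  have sub: "cball 0 1 \<subseteq> {\<xi>. a + \<xi> *s b \<in> siegel}"
  proof
    fix \<xi> :: complex assume "\<xi> \<in> cball 0 1"
    then have "(cmod \<xi>)\<^sup>2 * sqn v \<le> 1 * sqn v"
      by (intro mult_right_mono) (auto simp: abs_square_le_1)
    then show "\<xi> \<in> {\<xi>. a + \<xi> *s b \<in> siegel}"
      using s by (simp add: line[symmetric] mem_siegel_iff rho_heis sqn_scale \<omega>_def)
  qed
  have "hcoord z (hrot t (v, s, u)) = a + cis (2 * pi * t) *s b" for t
  proof -
    let ?w = "\<lambda>j\<in>UNIV - {last_ix}. cis (2 * pi * t) * v j"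
    have "sqn ?w = sqn (\<lambda>j. cis (2 * pi * t) * v j)"
      by (rule sqn_cong) simp
    then have "hcoord z (hrot t (v, s, u)) = heis z ?w \<omega>"
      by (simp add: hrot_def hcoord_def sqn_scale \<omega>_def)
    also have "\<dots> = heis z (\<lambda>j. cis (2 * pi * t) * v j) \<omega>"
      by (rule heis_cong) simp
    finally show ?thesis by (simp only: line)
  qed
  then show ?thesis
    using unit_circle_average[OF open_line_vimage[OF open_siegel] holomorphic_sv_line[OF hol] sub]
    by (simp add: a_def \<omega>_def)
qed

text \<open>
  The integrand of the operator in the coordinates adapted to \<open>z\<close>, for \<open>\<zeta> = base z\<close>. The exponents of
  weight and kernel are independent parameters because integration by parts changes them separately.
\<close>

definition wint :: "complex \<Rightarrow> real \<Rightarrow> real \<Rightarrow> (('n :: {finite, linorder} \<Rightarrow> complex) \<times> real \<times> real \<Rightarrow> complex)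
    \<Rightarrow> ('n \<Rightarrow> complex) \<times> real \<times> real \<Rightarrow> complex" where
  "wint \<zeta> l a F = (\<lambda>(v, s, u). indicator {0<..} s *\<^sub>R
      (of_real (s powr l) / hker \<zeta> (s + sqn v) u powr of_real a * F (v, s, u)))"

text \<open>
  Rotation average, then radial integration, then the half-plane formula with exponent
  \<open>\<mu> = l + n - 1\<close>, for which \<open>2 + \<mu>\<close> is exactly the exponent \<open>n + 1 + l\<close> of the kernel.
\<close>

theorem siegel_reproducing:
  fixes f :: "('n :: {finite, linorder}) cvec \<Rightarrow> complex" and l :: real
  assumes l: "l > -1" and z: "z \<in> siegel" and hol: "holomorphic_sv f siegel"
    and int: "integrable cmeas (wint (base z) l (real CARD('n) + 1 + l) (\<lambda>q. f (hcoord z q)))"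
  shows "(\<integral>q. wint (base z) l (real CARD('n) + 1 + l) (\<lambda>q. f (hcoord z q)) q \<partial>cmeas)
    = of_real (4 * pi ^ CARD('n) * Gamma (1 + l) / Gamma (real CARD('n) + 1 + l)) * f z"
proof -
  define m where "m = CARD('n) - 1"
  have n: "CARD('n) = Suc m"
    using zero_less_card_finite[where 'a='n] by (simp add: m_def)
  define \<mu> where "\<mu> = l + real m"
  have \<mu>: "\<mu> > -1" "real CARD('n) + 1 + l = 2 + \<mu>"
    using l by (auto simp: \<mu>_def n)
  define \<zeta> where "\<zeta> = base z"
  have \<zeta>: "0 < Im \<zeta>" using z by (simp add: \<zeta>_def Im_base mem_siegel_iff)
  define g where "g \<omega> = f (heis z (\<lambda>_. 0) \<omega>)" for \<omega>
  have holg: "g holomorphic_on {\<omega>. 0 < Im \<omega>}"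
  proof -
    have "g = (\<lambda>\<omega>. f (heis z (\<lambda>_. 0) 0 + \<omega> *s axis last_ix 1))"
      by (simp add: g_def fun_eq_iff heis_vertical[symmetric])
    moreover have "{\<omega>. heis z (\<lambda>_. 0) 0 + \<omega> *s axis last_ix 1 \<in> siegel} = {\<omega>. 0 < Im \<omega>}"
    proof -
      have "sqn (\<lambda>_::'n. 0) = 0" by (simp add: sqn_def)
      then show ?thesis
        by (simp add: mem_siegel_iff rho_heis heis_vertical[symmetric])
    qed
    ultimately show ?thesis
      using holomorphic_sv_line[OF hol] by metis
  qed
  define \<phi> where "\<phi> = wint \<zeta> l (2 + \<mu>) (\<lambda>q. f (hcoord z q))"
  have \<phi>: "integrable cmeas \<phi>"
    using int unfolding \<phi>_def \<zeta>_def \<mu>(2) .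
  define \<psi> where "\<psi> = wint \<zeta> l (2 + \<mu>) (\<lambda>(v :: 'n \<Rightarrow> complex, s, u). g (Complex u (s + sqn v)))"
  \<comment> \<open>Weight and kernel are invariant under the rotations, so only \<open>f\<close> is averaged.\<close>
  have avg: "(\<integral>t. indicator {0..1} t *\<^sub>R \<phi> (hrot t q) \<partial>lborel) = \<psi> q" for q
  proof -
    obtain v s u where q: "q = (v, s, u)" by (cases q)
    define c where "c = indicator {0<..} s *\<^sub>R (of_real (s powr l) / hker \<zeta> (s + sqn v) u powr of_real (2 + \<mu>))"
    have "\<phi> (hrot t q) = c * f (hcoord z (hrot t q))" for t
    proof -
      have "sqn (\<lambda>j\<in>UNIV - {last_ix}. cis (2 * pi * t) * v j) = sqn (\<lambda>j. cis (2 * pi * t) * v j)"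
        by (rule sqn_cong) simp
      then show ?thesis
        by (simp add: \<phi>_def wint_def q hrot_def c_def sqn_scale)
    qed
    then have "(\<integral>t. indicator {0..1} t *\<^sub>R \<phi> (hrot t q) \<partial>lborel)
        = c * (\<integral>t. indicator {0..1} t *\<^sub>R f (hcoord z (hrot t q)) \<partial>lborel)"
      by (simp flip: integral_mult_right_zero)
    also have "\<dots> = \<psi> q"
      using hrot_circle_average[OF hol, of s z v u]
      by (cases "0 < s") (simp_all add: c_def q \<psi>_def wint_def g_def)
    finally show ?thesis .
  qed
  have hrot2: "(\<lambda>(t, q). hrot t q) \<in> measurable (lborel \<Otimes>\<^sub>M (cmeas :: (('n \<Rightarrow> complex) \<times> real \<times> real) measure)) cmeas"
  proof -
    have [measurable]: "cis \<in> borel_measurable borel"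
      by (intro borel_measurable_continuous_onI continuous_intros)
    show ?thesis
      unfolding hrot_def case_prod_beta by measurable
  qed
  have "(\<lambda>(t, q). \<phi> (hrot t q)) \<in> borel_measurable (lborel \<Otimes>\<^sub>M cmeas)"
    using measurable_compose[OF hrot2 borel_measurable_integrable[OF \<phi>]] by (simp add: case_prod_beta)
  note mean = integral_flow_average[OF sigma_finite_cmeas hrot_measurable distr_hrot \<phi> this, unfolded avg]
  define W where "W = (\<lambda>(r, u). indicator {0<..} r *\<^sub>R (1 / hker \<zeta> r u powr of_real (2 + \<mu>) * g (Complex u r)))"
  have Wm: "W \<in> borel_measurable plane"
  proof -
    define gg where "gg \<omega> = indicator {\<omega>. 0 < Im \<omega>} \<omega> *\<^sub>R g \<omega>" for \<omega>
    have [measurable]: "gg \<in> borel_measurable borel"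
      unfolding gg_def using holomorphic_on_imp_continuous_on[OF holg] open_halfspace_Im_gt[of 0]
      by (intro borel_measurable_continuous_on_indicator) auto
    have "W = (\<lambda>(r, u). indicator {0<..} r *\<^sub>R (1 / hker \<zeta> r u powr of_real (2 + \<mu>) * gg (u + \<i> * of_real r)))"
      by (auto simp: W_def gg_def indicator_def Complex_eq)
    then show ?thesis
      by (simp only:) measurable
  qed
  let ?T = "\<lambda>(v :: 'n \<Rightarrow> complex, s :: real, u :: real). (s + sqn v, u)"
  have Tm: "?T \<in> measurable cmeas plane"
    by measurable
  define d where "d = (\<lambda>(v :: 'n \<Rightarrow> complex, s :: real, u :: real). indicator {0<..} s * s powr l)"
  have dm: "d \<in> borel_measurable cmeas" unfolding d_def by measurable
  have d0: "AE q in cmeas. 0 \<le> d q" by (auto simp: d_def)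
  define C where "C = pi ^ m * Gamma (1 + l) / Gamma (1 + l + real m)"
  define d' where "d' = (\<lambda>(r :: real, u :: real). C * (indicator {0<..} r * r powr \<mu>))"
  have d'm: "d' \<in> borel_measurable plane" unfolding d'_def by measurable
  have Gpos: "0 < Gamma (1 + l)" "0 < Gamma (1 + l + real m)"
    using l by (auto intro!: Gamma_real_pos)
  then have C: "0 < C" by (simp add: C_def)
  then have d'0: "AE p in plane. 0 \<le> d' p" by (auto simp: d'_def)
  have rad: "distr (density cmeas d) plane ?T = density plane d'"
  proof -
    have "(\<lambda>q. ennreal (d q)) = (\<lambda>(v, s, u). indicator {0<..} s * ennreal (s powr l))"
      by (auto simp: d_def indicator_def)
    moreover have "(\<lambda>p. ennreal (d' p)) = (\<lambda>(r, u). ennreal C * (indicator {0<..} r * ennreal (r powr \<mu>)))"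
      using C by (auto simp: d'_def indicator_def ennreal_mult')
    ultimately show ?thesis
      using distr_cmeas_radial[OF l, where 'n = 'n] by (simp add: C_def \<mu>_def m_def)
  qed
  have WT: "(\<lambda>q. W (?T q)) \<in> borel_measurable cmeas"
    using measurable_compose[OF Tm Wm] .
  have \<psi>: "\<psi> = (\<lambda>q. d q *\<^sub>R W (?T q))"
    by (auto simp: \<psi>_def wint_def d_def W_def fun_eq_iff indicator_def scaleR_conv_of_real add_pos_nonneg)
  have W': "(\<lambda>p. d' p *\<^sub>R W p) = (\<lambda>p. of_real C * hpint \<mu> \<zeta> g p)"
    by (auto simp: hpint_def d'_def W_def fun_eq_iff indicator_def scaleR_conv_of_real)
  have Tm': "?T \<in> measurable (density cmeas d) plane"
    using Tm by simp
  have "integrable cmeas \<psi>" by (rule mean(1))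
  then have "integrable (density cmeas d) (\<lambda>q. W (?T q))"
    unfolding \<psi> using WT dm d0 by (subst integrable_density) auto
  then have "integrable (density plane d') W"
    using integrable_distr_eq[OF Tm', of W] Wm unfolding rad by simp
  then have "integrable plane (\<lambda>p. d' p *\<^sub>R W p)"
    using Wm d'm d'0 by (subst (asm) integrable_density) auto
  then have gint: "integrable plane (hpint \<mu> \<zeta> g)"
  proof -
    have cancel: "of_real (1 / C) * (of_real C * x) = x" for x :: complex
      using C by simp
    assume "integrable plane (\<lambda>p. d' p *\<^sub>R W p)"
    from integrable_mult_right[OF this[unfolded W'], of "of_real (1 / C)"] show ?thesis
      by (simp only: cancel)
  qed
  have "(\<integral>q. \<phi> q \<partial>cmeas) = (\<integral>q. \<psi> q \<partial>cmeas)"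
    by (rule mean(2)[symmetric])
  also have "\<dots> = (\<integral>q. W (?T q) \<partial>density cmeas d)"
    unfolding \<psi> using WT dm d0 by (subst integral_density) auto
  also have "\<dots> = (\<integral>p. W p \<partial>density plane d')"
    using integral_distr[OF Tm', of W] Wm unfolding rad by simp
  also have "\<dots> = (\<integral>p. d' p *\<^sub>R W p \<partial>plane)"
    using Wm d'm d'0 by (subst integral_density) auto
  also have "\<dots> = of_real C * (of_real (4 * pi / (1 + \<mu>)) * g \<zeta>)"
    unfolding W' by (simp only: integral_mult_right_zero half_plane_reproducing[OF \<mu>(1) \<zeta> holg gint])
  also have "\<dots> = of_real (C * (4 * pi / (1 + \<mu>))) * f z"
    by (simp add: g_def \<zeta>_def heis_base)
  also have "C * (4 * pi / (1 + \<mu>)) = 4 * pi ^ CARD('n) * Gamma (1 + l) / Gamma (real CARD('n) + 1 + l)"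
  proof -
    have "1 + \<mu> \<notin> \<int>\<^sub>\<le>\<^sub>0"
      using \<mu>(1) nonpos_Ints_nonpos[of "1 + \<mu>"] by auto
    then have "Gamma (1 + \<mu> + 1) = (1 + \<mu>) * Gamma (1 + \<mu>)"
      by (rule Gamma_plus1)
    moreover have e: "real CARD('n) + 1 + l = 1 + \<mu> + 1" "1 + l + real m = 1 + \<mu>"
      using \<mu>(2) by (auto simp: \<mu>_def)
    ultimately show ?thesis
      unfolding C_def e by (simp only:) (simp add: n mult_ac)
  qed
  finally show ?thesis
    unfolding \<phi>_def \<zeta>_def \<mu>(2) .
qed

section \<open>Derivatives in the last variable\<close>

lemma deriv_translate:
  fixes h :: "complex \<Rightarrow> complex"
  shows "deriv (\<lambda>\<eta>. h (\<eta> - c)) x = deriv h (x - c)"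
  using DERIV_shift[of h _ x "- c"] by (simp add: deriv_def)

text \<open>
  Both sides iterate the total function \<open>deriv\<close>, which commutes with translations of the argument.
\<close>

lemma Lop_iterate_line:
  "(Lop ^^ k) f (w + \<xi> *s axis last_ix 1) = (deriv ^^ k) (\<lambda>\<xi>. f (w + \<xi> *s axis last_ix 1)) \<xi>"
proof (induction k arbitrary: \<xi>)
  case (Suc k)
  let ?F = "\<lambda>\<xi>. f (w + \<xi> *s axis last_ix 1)"
  have upd: "(\<chi> j. if j = last_ix then \<eta> else (w + \<xi> *s axis last_ix 1) $ j) = w + (\<eta> - w $ last_ix) *s axis last_ix 1" for \<eta>
    by (simp add: vec_eq_iff axis_def)
  have "(Lop ^^ Suc k) f (w + \<xi> *s axis last_ix 1)
      = deriv (\<lambda>\<eta>. (deriv ^^ k) ?F (\<eta> - w $ last_ix)) (w $ last_ix + \<xi>)"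
  proof -
    have last: "(w + \<xi> *s axis last_ix 1) $ last_ix = w $ last_ix + \<xi>"
      by (simp add: axis_def)
    show ?thesis
      by (simp only: funpow.simps o_def Lop_def[of "(Lop ^^ k) f"] upd Suc.IH last)
  qed
  also have "\<dots> = (deriv ^^ Suc k) ?F \<xi>"
    by (simp add: deriv_translate)
  finally show ?case .
qed simp

lemma Lop_iterate_heis: "(Lop ^^ k) f (heis z v \<omega>) = (deriv ^^ k) (\<lambda>\<omega>. f (heis z v \<omega>)) \<omega>"
  using Lop_iterate_line[of k f "heis z v 0" \<omega>] by (simp add: heis_vertical[symmetric])

lemma holomorphic_heis_slice:
  assumes "holomorphic_sv f siegel"
  shows "(\<lambda>\<omega>. f (heis z v \<omega>)) holomorphic_on {\<omega>. sqn v < Im \<omega>}"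
  using holomorphic_sv_line[OF assms, of "heis z v 0" "axis last_ix 1"]
  by (simp add: heis_vertical[symmetric] mem_siegel_iff rho_heis)

lemma rho_line: "rho (w + \<xi> *s axis last_ix 1) = rho w + Im \<xi>"
proof -
  have "sqn (($) (w + \<xi> *s axis last_ix 1)) = sqn (($) w)"
    by (rule sqn_cong) (simp add: axis_def)
  then show ?thesis by (simp add: rho_eq)
qed

lemma Lop_iterate_circle_average:
  assumes hol: "holomorphic_sv f siegel" and w: "w \<in> siegel"
  shows "(Lop ^^ k) f w = of_real (fact k / (rho w / 2) ^ k) *
    (\<integral>t. indicator {0..1} t *\<^sub>R (cis (- (2 * pi * real k * t)) *
       f (w + (of_real (rho w / 2) * cis (2 * pi * t)) *s axis last_ix 1)) \<partial>lborel)"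
proof -
  let ?F = "\<lambda>\<xi>. f (w + \<xi> *s axis last_ix 1)"
  have r: "0 < rho w / 2" using w by (simp add: mem_siegel_iff)
  have "cball 0 (rho w / 2) \<subseteq> {\<xi>. w + \<xi> *s axis last_ix 1 \<in> siegel}"
  proof
    fix \<xi> :: complex assume "\<xi> \<in> cball 0 (rho w / 2)"
    then have "- (rho w / 2) \<le> Im \<xi>"
      using abs_Im_le_cmod[of \<xi>] by simp
    then show "\<xi> \<in> {\<xi>. w + \<xi> *s axis last_ix 1 \<in> siegel}"
      using r by (simp add: mem_siegel_iff rho_line)
  qed
  from higher_deriv_circle_average[OF open_line_vimage[OF open_siegel] holomorphic_sv_line[OF hol] this r, of k]
  show ?thesis
    using Lop_iterate_line[of k f w 0] by simp
qed

lemma rho_measurable [measurable]: "rho \<in> borel_measurable borel"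
  unfolding rho_def by (intro borel_measurable_continuous_onI continuous_intros)

text \<open>
  The circle average is a parameter integral of \<open>f\<close> extended by 0, hence measurable by Fubini's theorem.
\<close>

lemma Lop_iterate_measurable:
  fixes f :: "('n :: {finite, linorder}) cvec \<Rightarrow> complex"
  assumes hol: "holomorphic_sv f siegel"
  shows "(\<lambda>w. indicator siegel w *\<^sub>R (Lop ^^ k) f w) \<in> borel_measurable borel"
proof -
  define F where "F w = indicator siegel w *\<^sub>R f w" for w
  have F: "F \<in> borel_measurable borel"
    unfolding F_def using holomorphic_sv_continuous_on[OF hol]
    by (intro borel_measurable_continuous_on_indicator) auto
  define c where "c = (\<lambda>(w :: 'n cvec, t). w + (of_real (rho w / 2) * cis (2 * pi * t)) *s axis last_ix 1)"
  have [measurable]: "cis \<in> borel_measurable borel"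
    by (intro borel_measurable_continuous_onI continuous_intros)
  have [measurable]: "(\<lambda>w :: 'n cvec. w $ j) \<in> borel_measurable borel" for j
    by (intro borel_measurable_continuous_onI continuous_intros)
  have "c \<in> borel_measurable (borel \<Otimes>\<^sub>M lborel)"
  proof -
    have "(\<lambda>p. (c p $ j) \<bullet> b) \<in> borel_measurable (borel \<Otimes>\<^sub>M lborel)" for j b
      unfolding c_def case_prod_beta vector_add_component vector_smult_component by measurable
    then show ?thesis
      by (subst borel_measurable_euclidean_space) (auto simp: Basis_vec_def inner_axis)
  qed
  from measurable_compose[OF this F]
  have [measurable]: "(\<lambda>p. F (c p)) \<in> borel_measurable (borel \<Otimes>\<^sub>M lborel)" .
  have "(\<lambda>w. indicator siegel w *\<^sub>R (of_real (fact k / (rho w / 2) ^ k) *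
      (\<integral>t. indicator {0..1} t *\<^sub>R (cis (- (2 * pi * real k * t)) * F (c (w, t))) \<partial>lborel)))
    \<in> borel_measurable borel"
    by measurable
  also have "(\<lambda>w. indicator siegel w *\<^sub>R (of_real (fact k / (rho w / 2) ^ k) *
      (\<integral>t. indicator {0..1} t *\<^sub>R (cis (- (2 * pi * real k * t)) * F (c (w, t))) \<partial>lborel)))
    = (\<lambda>w. indicator siegel w *\<^sub>R (Lop ^^ k) f w)"
  proof
    fix w :: "'n cvec"
    show "indicator siegel w *\<^sub>R (of_real (fact k / (rho w / 2) ^ k) *
      (\<integral>t. indicator {0..1} t *\<^sub>R (cis (- (2 * pi * real k * t)) * F (c (w, t))) \<partial>lborel))
      = indicator siegel w *\<^sub>R (Lop ^^ k) f w"
    proof (cases "w \<in> siegel")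
      case True
      have "F (c (w, t)) = f (w + (of_real (rho w / 2) * cis (2 * pi * t)) *s axis last_ix 1)" for t
      proof -
        have "0 < rho w * (1 + sin (2 * pi * t) / 2)"
          using True sin_ge_minus_one[of "2 * pi * t"] unfolding mem_siegel_iff by (intro mult_pos_pos) linarith+
        then have "0 < rho (c (w, t))"
          by (simp add: c_def rho_line algebra_simps)
        then show ?thesis
          by (simp add: F_def mem_siegel_iff) (simp add: c_def)
      qed
      then show ?thesis
        using Lop_iterate_circle_average[OF hol True, of k] by simp
    qed simp
  qed
  finally show ?thesis .
qed

text \<open>
  The effect, in the coordinates \<open>(v, s, u)\<close>, of moving the last coordinate to the point with parameter
  \<open>t\<close> on the circle of radius \<open>s/2\<close> around it.
\<close>

definition hdil :: "real \<Rightarrow> ('n \<Rightarrow> complex) \<times> real \<times> real \<Rightarrow> ('n \<Rightarrow> complex) \<times> real \<times> real" where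
  "hdil t = (\<lambda>(v, s, u). (v, s * (1 + sin (2 * pi * t) / 2), u + s * cos (2 * pi * t) / 2))"

lemma hcoord_hdil:
  "hcoord z (v, s, u) + (of_real (s / 2) * cis (2 * pi * t)) *s axis last_ix 1 = hcoord z (hdil t (v, s, u))"
proof -
  have "Complex u (s + sqn v) + of_real (s / 2) * cis (2 * pi * t)
      = Complex (u + s * cos (2 * pi * t) / 2) (s * (1 + sin (2 * pi * t) / 2) + sqn v)"
    by (simp add: complex_eq_iff algebra_simps)
  then show ?thesis
    by (simp add: hcoord_def hdil_def heis_vertical[symmetric])
qed

lemma hdil_measurable2 [measurable]:
  "(\<lambda>(t, q). hdil t q) \<in> measurable (lborel \<Otimes>\<^sub>M (cmeas :: (('n :: {finite, linorder} \<Rightarrow> complex) \<times> real \<times> real) measure)) cmeas"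
  unfolding hdil_def case_prod_beta by measurable

lemma hdil_measurable [measurable]: "hdil t \<in> measurable cmeas cmeas"
  unfolding hdil_def case_prod_beta by measurable

lemma dilation_factor: "1 / 2 \<le> 1 + sin x / (2 :: real)" "1 + sin x / (2 :: real) \<le> 3 / 2"
  using sin_ge_minus_one[of x] sin_le_one[of x] by linarith+

text \<open>
  For fixed \<open>t\<close> the map is a shear in \<open>u\<close> followed by a dilation of \<open>s\<close> by a factor of at least \<open>1/2\<close>.
\<close>

lemma nn_integral_hdil_le:
  fixes W :: "('n :: {finite, linorder} \<Rightarrow> complex) \<times> real \<times> real \<Rightarrow> ennreal"
  assumes [measurable]: "W \<in> borel_measurable cmeas"
  shows "(\<integral>\<^sup>+q. W (hdil t q) \<partial>cmeas) \<le> 2 * (\<integral>\<^sup>+q. W q \<partial>cmeas)"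
proof -
  define m where "m = 1 + sin (2 * pi * t) / 2"
  have m: "1 / 2 \<le> m" using dilation_factor(1) by (simp add: m_def)
  have "(\<integral>\<^sup>+q. W (hdil t q) \<partial>cmeas) = (\<integral>\<^sup>+v. \<integral>\<^sup>+s. \<integral>\<^sup>+u. W (hdil t (v, s, u)) \<partial>lborel \<partial>lborel \<partial>hmeas)"
    by (rule nn_integral_cmeas) measurable
  also have "\<dots> \<le> (\<integral>\<^sup>+v. 2 * (\<integral>\<^sup>+s. \<integral>\<^sup>+u. W (v, s, u) \<partial>lborel \<partial>lborel) \<partial>hmeas)"
  proof (rule nn_integral_mono)
    fix v :: "'n \<Rightarrow> complex" assume [simp]: "v \<in> space hmeas"
    define V where "V s = (\<integral>\<^sup>+u. W (v, s, u) \<partial>lborel)" for s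
    have [measurable]: "V \<in> borel_measurable borel"
      unfolding V_def by measurable
    have "(\<integral>\<^sup>+u. W (hdil t (v, s, u)) \<partial>lborel) = V (0 + m * s)" for s
    proof -
      have "(\<integral>\<^sup>+u. W (v, m * s, s * cos (2 * pi * t) / 2 + u) \<partial>lborel) = (\<integral>\<^sup>+u. W (v, m * s, u) \<partial>lborel)"
        by (rule nn_integral_lborel_plus[of "\<lambda>u. W (v, m * s, u)"]) measurable
      then show ?thesis
        by (simp add: V_def hdil_def m_def mult.commute add.commute)
    qed
    then have "(\<integral>\<^sup>+s. \<integral>\<^sup>+u. W (hdil t (v, s, u)) \<partial>lborel \<partial>lborel) = (\<integral>\<^sup>+s. V (0 + m * s) \<partial>lborel)"
      by simp
    also have "\<dots> = 1 * (\<integral>\<^sup>+s. V (0 + m * s) \<partial>lborel)" by simp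
    also have "\<dots> \<le> ennreal (2 * m) * (\<integral>\<^sup>+s. V (0 + m * s) \<partial>lborel)"
      using m by (intro mult_right_mono) auto
    also have "\<dots> = 2 * (ennreal \<bar>m\<bar> * (\<integral>\<^sup>+s. V (0 + m * s) \<partial>lborel))"
      using m by (simp add: ennreal_mult' mult.assoc)
    also have "\<dots> = 2 * (\<integral>\<^sup>+s. V s \<partial>lborel)"
      using m by (subst nn_integral_real_affine[of V m 0]) auto
    finally show "(\<integral>\<^sup>+s. \<integral>\<^sup>+u. W (hdil t (v, s, u)) \<partial>lborel \<partial>lborel) \<le> 2 * (\<integral>\<^sup>+s. \<integral>\<^sup>+u. W (v, s, u) \<partial>lborel \<partial>lborel)"
      by (simp add: V_def)
  qed
  also have "\<dots> = 2 * (\<integral>\<^sup>+v. \<integral>\<^sup>+s. \<integral>\<^sup>+u. W (v, s, u) \<partial>lborel \<partial>lborel \<partial>hmeas)"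
    by (rule nn_integral_cmult) measurable
  also have "\<dots> = 2 * (\<integral>\<^sup>+q. W q \<partial>cmeas)"
    by (subst nn_integral_cmeas) auto
  finally show ?thesis .
qed

lemma hker_norm_ge:
  assumes "0 \<le> r" "0 \<le> Im \<zeta>"
  shows "r + Im \<zeta> \<le> 2 * cmod (hker \<zeta> r u)"
  using complex_Re_le_cmod[of "hker \<zeta> r u"] by (simp add: hker_eq)

lemma hker_norm_bounds:
  assumes "0 < s" "0 < Im \<zeta>"
  shows "0 < cmod (hker \<zeta> (s + sqn v) u)" "s \<le> 2 * cmod (hker \<zeta> (s + sqn v) u)"
    "Im \<zeta> \<le> 2 * cmod (hker \<zeta> (s + sqn v) u)"
proof -
  have "0 \<le> s + sqn v" using assms by (simp add: add_nonneg_nonneg)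
  then have "s + sqn v + Im \<zeta> \<le> 2 * cmod (hker \<zeta> (s + sqn v) u)"
    using assms by (intro hker_norm_ge) auto
  then show "0 < cmod (hker \<zeta> (s + sqn v) u)" "s \<le> 2 * cmod (hker \<zeta> (s + sqn v) u)"
    "Im \<zeta> \<le> 2 * cmod (hker \<zeta> (s + sqn v) u)"
    using assms sqn_nonneg[of v] by linarith+
qed

text \<open>
  The ratio of the two values of \<open>s\<close> lies between \<open>1/2\<close> and \<open>3/2\<close>. The kernel changes by \<open>s/4\<close> in modulus,
  and its own modulus is at least \<open>s/2\<close>, so it grows by a factor of at most 2.
\<close>

lemma hker_weight_hdil:
  fixes l a :: real
  assumes \<zeta>: "0 < Im \<zeta>" and s: "0 < s" and a: "0 < a" and q': "hdil t (v, s, u) = (v, s', u')"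
  shows "s powr l / cmod (hker \<zeta> (s + sqn v) u) powr a
    \<le> (2 powr \<bar>l\<bar> * 2 powr a) * (s' powr l / cmod (hker \<zeta> (s' + sqn v) u') powr a)"
proof -
  define k k' where "k = cmod (hker \<zeta> (s + sqn v) u)" and "k' = cmod (hker \<zeta> (s' + sqn v) u')"
  have s': "s' = s * (1 + sin (2 * pi * t) / 2)" and u': "u' = u + s * cos (2 * pi * t) / 2"
    using q' by (auto simp: hdil_def)
  have r: "1 / 2 * s \<le> s'" "s' \<le> 3 / 2 * s"
    using dilation_factor[of "2 * pi * t"] s unfolding s' by (simp_all add: mult_ac mult_le_cancel_left_pos)
  have s'0: "0 < s'" using r s by linarith
  have k: "s \<le> 2 * k" "0 < k" "0 < k'"
    using hker_norm_bounds[OF s \<zeta>, of v u] hker_norm_bounds[OF s'0 \<zeta>, of v u'] by (auto simp: k_def k'_def)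
  have d: "hker \<zeta> (s' + sqn v) u' - hker \<zeta> (s + sqn v) u = of_real (s / 4) * (\<i> * cis (- (2 * pi * t)))"
    by (simp add: hker_eq complex_eq_iff s' u' field_simps)
  have "cmod (hker \<zeta> (s' + sqn v) u' - hker \<zeta> (s + sqn v) u) = s / 4"
    unfolding d norm_mult norm_of_real norm_cis using s by simp
  then have "k' \<le> k + s / 4"
    using norm_triangle_ineq[of "hker \<zeta> (s + sqn v) u" "hker \<zeta> (s' + sqn v) u' - hker \<zeta> (s + sqn v) u"]
    by (simp add: k_def k'_def)
  then have "k' \<le> 2 * k" using k by linarith
  then have "k' powr a \<le> (2 * k) powr a"
    using k a by (intro powr_mono2) auto
  then have K: "k' powr a \<le> 2 powr a * k powr a"
    using k by (simp add: powr_mult)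
  have S: "s powr l \<le> 2 powr \<bar>l\<bar> * s' powr l"
  proof -
    have "(s / s') powr l \<le> 2 powr \<bar>l\<bar>"
    proof (cases "0 \<le> l")
      case True
      then show ?thesis using r s s'0 by (intro order_trans[OF powr_mono2[of l "s / s'" 2]]) (auto simp: field_simps)
    next
      case False
      have "(s / s') powr l = (s' / s) powr (- l)"
        using s s'0 by (simp add: powr_minus powr_divide inverse_eq_divide)
      also have "\<dots> \<le> 2 powr (- l)"
        using False r s s'0 by (intro powr_mono2) (auto simp: field_simps)
      finally show ?thesis using False by simp
    qed
    then have "(s / s') powr l * s' powr l \<le> 2 powr \<bar>l\<bar> * s' powr l"
      by (intro mult_right_mono) auto
    then show ?thesis using s s'0 by (simp add: powr_divide)
  qed
  have "s powr l * k' powr a \<le> (2 powr \<bar>l\<bar> * s' powr l) * (2 powr a * k powr a)"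
    using S K by (intro mult_mono) auto
  then have "s powr l / k powr a \<le> (2 powr \<bar>l\<bar> * 2 powr a) * (s' powr l / k' powr a)"
    using k by (simp add: divide_simps mult_ac)
  then show ?thesis by (simp add: k_def k'_def)
qed

lemma Lop_hcoord_measurable:
  assumes "holomorphic_sv f siegel"
  shows "(\<lambda>(v, s, u). indicator {0<..} s *\<^sub>R (Lop ^^ k) f (hcoord z (v, s, u))) \<in> borel_measurable cmeas"
proof -
  have "(\<lambda>q. indicator siegel (hcoord z q) *\<^sub>R (Lop ^^ k) f (hcoord z q)) \<in> borel_measurable cmeas"
    using measurable_compose[OF hcoord_measurable Lop_iterate_measurable[OF assms]] .
  also have "(\<lambda>q. indicator siegel (hcoord z q) *\<^sub>R (Lop ^^ k) f (hcoord z q))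
      = (\<lambda>(v, s, u). indicator {0<..} s *\<^sub>R (Lop ^^ k) f (hcoord z (v, s, u)))"
    by (auto simp: indicator_def hcoord_in_siegel)
  finally show ?thesis .
qed

lemma wint_measurable:
  fixes f :: "('n :: {finite, linorder}) cvec \<Rightarrow> complex"
  assumes "holomorphic_sv f siegel"
  shows "wint \<zeta> l a (\<lambda>q. (Lop ^^ k) f (hcoord z q)) \<in> borel_measurable cmeas"
proof -
  define g where "g = (\<lambda>(v, s, u). indicator {0<..} s *\<^sub>R (Lop ^^ k) f (hcoord z (v, s, u)))"
  have [measurable]: "g \<in> borel_measurable cmeas"
    unfolding g_def by (rule Lop_hcoord_measurable[OF assms])
  have "wint \<zeta> l a (\<lambda>q. (Lop ^^ k) f (hcoord z q))
      = (\<lambda>q. of_real (fst (snd q) powr l) / hker \<zeta> (fst (snd q) + sqn (fst q)) (snd (snd q)) powr of_real a * g q)"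
    by (auto simp: wint_def g_def fun_eq_iff scaleR_conv_of_real)
  also have "\<dots> \<in> borel_measurable cmeas"
    by measurable
  finally show ?thesis .
qed

text \<open>
  The factor \<open>s\<^sup>k\<close> compensates \<open>(s/2)\<^sup>-\<^sup>k\<close> from Cauchy's formula on the circle of radius \<open>s/2\<close>. What
  remains is the average over \<open>t\<close> of functions that arise from the given integrable one by \<open>hdil t\<close>,
  up to a constant factor.
\<close>

lemma wint_Lop_integrable:
  fixes f :: "('n :: {finite, linorder}) cvec \<Rightarrow> complex" and l a :: real
  assumes hol: "holomorphic_sv f siegel" and \<zeta>: "0 < Im \<zeta>" and a: "0 < a"
    and int: "integrable cmeas (wint \<zeta> l a (\<lambda>q. f (hcoord z q)))"
  shows "integrable cmeas (wint \<zeta> (l + real k) a (\<lambda>q. (Lop ^^ k) f (hcoord z q)))"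
proof (rule integrableI_bounded)
  show "wint \<zeta> (l + real k) a (\<lambda>q. (Lop ^^ k) f (hcoord z q)) \<in> borel_measurable cmeas"
    by (rule wint_measurable[OF hol])
  interpret C: sigma_finite_measure "cmeas :: (('n \<Rightarrow> complex) \<times> real \<times> real) measure"
    by (rule sigma_finite_cmeas)
  interpret P: pair_sigma_finite "lborel :: real measure" "cmeas :: (('n \<Rightarrow> complex) \<times> real \<times> real) measure" ..
  define W where "W q = ennreal (cmod (wint \<zeta> l a (\<lambda>q. f (hcoord z q)) q))" for q
  have [measurable]: "W \<in> borel_measurable cmeas"
    unfolding W_def using borel_measurable_integrable[OF int] by measurable
  \<comment> \<open>Cauchy factor \<open>k! 2\<^sup>k\<close> times the distortion constant of \<open>hker_weight_hdil\<close>.\<close>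
  define K where "K = fact k * 2 ^ k * (2 powr \<bar>l\<bar> * 2 powr a)"
  have K: "0 \<le> K" by (simp add: K_def)
  have pt: "ennreal (cmod (wint \<zeta> (l + real k) a (\<lambda>q. (Lop ^^ k) f (hcoord z q)) q))
      \<le> ennreal K * (\<integral>\<^sup>+t. indicator {0..1} t * W (hdil t q) \<partial>lborel)"
    if q_space: "q \<in> space cmeas" for q
  proof -
    obtain v s u where q: "q = (v, s, u)" by (cases q)
    show ?thesis
    proof (cases "0 < s")
      case s: True
      define k0 where "k0 = cmod (hker \<zeta> (s + sqn v) u)"
      have "0 < k0"
        using hker_norm_bounds(1)[OF s \<zeta>] by (simp add: k0_def)
      let ?I = "\<lambda>t. indicator {0..1} t *\<^sub>R (cis (- (2 * pi * real k * t)) * f (hcoord z (hdil t q)))"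
      have L: "(Lop ^^ k) f (hcoord z q) = of_real (fact k / (s / 2) ^ k) * (\<integral>t. ?I t \<partial>lborel)"
        using Lop_iterate_circle_average[OF hol, of "hcoord z q" k] s
        by (simp add: q hcoord_in_siegel rho_hcoord hcoord_hdil del: of_real_divide)
      have "continuous_on {0..1} (\<lambda>t. f (hcoord z (hdil t q)))"
      proof (rule continuous_on_compose2[OF holomorphic_sv_continuous_on[OF hol]])
        have "continuous_on {0..1} (\<lambda>t. (of_real (s / 2) * cis (2 * pi * t)) *s (axis last_ix 1 :: 'n cvec))"
          by (rule bounded_linear.continuous_on[OF bounded_linear_smult_vec]) (intro continuous_intros)
        then have "continuous_on {0..1} (\<lambda>t. hcoord z (v, s, u) + (of_real (s / 2) * cis (2 * pi * t)) *s axis last_ix 1)"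
          by (rule continuous_on_add[OF continuous_on_const])
        then show "continuous_on {0..1} (\<lambda>t. hcoord z (hdil t q))"
          by (simp only: hcoord_hdil q)
        show "(\<lambda>t. hcoord z (hdil t q)) ` {0..1} \<subseteq> siegel"
        proof safe
          fix t :: real
          have "0 < s * (1 + sin (2 * pi * t) / 2)"
            using s dilation_factor(1)[of "2 * pi * t"] by (intro mult_pos_pos) linarith+
          then show "hcoord z (hdil t q) \<in> siegel"
            by (simp add: q hdil_def hcoord_in_siegel)
        qed
      qed
      then have "integrable lborel ?I"
        by (intro borel_integrable_compact continuous_intros) auto
      then have "ennreal (cmod (\<integral>t. ?I t \<partial>lborel)) \<le> (\<integral>\<^sup>+t. ennreal (cmod (?I t)) \<partial>lborel)"
        by (rule integral_norm_bound_ennreal)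
      also have "\<dots> = (\<integral>\<^sup>+t. indicator {0..1} t * ennreal (cmod (f (hcoord z (hdil t q)))) \<partial>lborel)"
        by (intro nn_integral_cong) (simp add: norm_mult indicator_def)
      finally have I: "ennreal (cmod (\<integral>t. ?I t \<partial>lborel)) \<le> (\<integral>\<^sup>+t. indicator {0..1} t * ennreal (cmod (f (hcoord z (hdil t q)))) \<partial>lborel)" .
      have "cmod (wint \<zeta> (l + real k) a (\<lambda>q. (Lop ^^ k) f (hcoord z q)) q)
          = (s powr (l + real k) / k0 powr a) * (fact k / (s / 2) ^ k * cmod (\<integral>t. ?I t \<partial>lborel))"
      proof -
        have "cmod ((Lop ^^ k) f (hcoord z q)) = fact k / (s / 2) ^ k * cmod (\<integral>t. ?I t \<partial>lborel)"
          using s unfolding L norm_mult norm_of_real by simp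
        moreover have "cmod (wint \<zeta> (l + real k) a (\<lambda>q. (Lop ^^ k) f (hcoord z q)) q)
            = (s powr (l + real k) / k0 powr a) * cmod ((Lop ^^ k) f (hcoord z q))"
          using s by (simp add: wint_def q k0_def norm_mult norm_divide norm_powr_real_powr')
        ultimately show ?thesis by (simp only:)
      qed
      also have "\<dots> = (fact k * 2 ^ k) * (s powr l / k0 powr a) * cmod (\<integral>t. ?I t \<partial>lborel)"
        using s by (simp add: powr_add powr_realpow power_divide)
      finally have "ennreal (cmod (wint \<zeta> (l + real k) a (\<lambda>q. (Lop ^^ k) f (hcoord z q)) q))
          = ennreal ((fact k * 2 ^ k) * (s powr l / k0 powr a)) * ennreal (cmod (\<integral>t. ?I t \<partial>lborel))"
        by (simp only:) (rule ennreal_mult, auto)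
      also have "\<dots> \<le> ennreal ((fact k * 2 ^ k) * (s powr l / k0 powr a)) * (\<integral>\<^sup>+t. indicator {0..1} t * ennreal (cmod (f (hcoord z (hdil t q)))) \<partial>lborel)"
        using I by (rule mult_left_mono) simp
      also have "\<dots> \<le> (\<integral>\<^sup>+t. ennreal K * (indicator {0..1} t * W (hdil t q)) \<partial>lborel)"
      proof (subst nn_integral_cmult[symmetric])
        show "(\<lambda>t. indicator {0..1} t * ennreal (cmod (f (hcoord z (hdil t q))))) \<in> borel_measurable lborel"
        proof -
          have "(\<lambda>t. indicator {0..1} t * ennreal (cmod (f (hcoord z (hdil t q))))) = (\<lambda>t. ennreal (cmod (?I t)))"
            by (auto simp: norm_mult indicator_def fun_eq_iff)
          also have "\<dots> \<in> borel_measurable lborel"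
            by (rule measurable_compose[OF measurable_compose[OF
                  borel_measurable_integrable[OF \<open>integrable lborel ?I\<close>] borel_measurable_norm] measurable_ennreal])
          finally show ?thesis .
        qed
        show "(\<integral>\<^sup>+t. ennreal ((fact k * 2 ^ k) * (s powr l / k0 powr a)) * (indicator {0..1} t * ennreal (cmod (f (hcoord z (hdil t q))))) \<partial>lborel)
            \<le> (\<integral>\<^sup>+t. ennreal K * (indicator {0..1} t * W (hdil t q)) \<partial>lborel)"
        proof (rule nn_integral_mono)
          fix t :: real
          obtain s' u' where q': "hdil t (v, s, u) = (v, s', u')"
            by (simp add: hdil_def)
          have "s' = s * (1 + sin (2 * pi * t) / 2)"
            using q' by (auto simp: hdil_def)
          then have s': "0 < s'"
            using s dilation_factor(1)[of "2 * pi * t"] by (simp add: zero_less_mult_iff)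
          have "(fact k * 2 ^ k) * (s powr l / k0 powr a) \<le> (fact k * 2 ^ k) * ((2 powr \<bar>l\<bar> * 2 powr a) * (s' powr l / cmod (hker \<zeta> (s' + sqn v) u') powr a))"
            unfolding k0_def by (intro mult_left_mono hker_weight_hdil[OF \<zeta> s a q']) auto
          then have "(fact k * 2 ^ k) * (s powr l / k0 powr a) * cmod (f (hcoord z (hdil t q)))
              \<le> (fact k * 2 ^ k) * ((2 powr \<bar>l\<bar> * 2 powr a) * (s' powr l / cmod (hker \<zeta> (s' + sqn v) u') powr a)) * cmod (f (hcoord z (hdil t q)))"
            by (rule mult_right_mono) simp
          also have "\<dots> = K * cmod (wint \<zeta> l a (\<lambda>q. f (hcoord z q)) (hdil t q))"
            using s' by (simp add: q q' wint_def K_def norm_mult norm_divide norm_powr_real_powr')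
          finally have "ennreal ((fact k * 2 ^ k) * (s powr l / k0 powr a)) * ennreal (cmod (f (hcoord z (hdil t q))))
              \<le> ennreal K * W (hdil t q)"
            unfolding W_def using K by (simp add: ennreal_mult'[symmetric] ennreal_leI)
          then show "ennreal ((fact k * 2 ^ k) * (s powr l / k0 powr a)) * (indicator {0..1} t * ennreal (cmod (f (hcoord z (hdil t q)))))
              \<le> ennreal K * (indicator {0..1} t * W (hdil t q))"
            by (simp add: indicator_def)
        qed
      qed
      also have "\<dots> = ennreal K * (\<integral>\<^sup>+t. indicator {0..1} t * W (hdil t q) \<partial>lborel)"
      proof (rule nn_integral_cmult)
        have "(\<lambda>t. W (hdil t q)) \<in> borel_measurable lborel"
          using measurable_compose[OF hdil_measurable2 \<open>W \<in> borel_measurable cmeas\<close>] q_space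
          by (auto dest!: measurable_Pair1[where y = q] simp: case_prod_beta)
        then show "(\<lambda>t. indicator {0..1} t * W (hdil t q)) \<in> borel_measurable lborel"
          by measurable
      qed
      finally show ?thesis .
    qed (simp add: wint_def q)
  qed
  have "(\<integral>\<^sup>+q. ennreal (cmod (wint \<zeta> (l + real k) a (\<lambda>q. (Lop ^^ k) f (hcoord z q)) q)) \<partial>cmeas)
      \<le> (\<integral>\<^sup>+q. ennreal K * (\<integral>\<^sup>+t. indicator {0..1} t * W (hdil t q) \<partial>lborel) \<partial>cmeas)"
    by (intro nn_integral_mono pt)
  also have "\<dots> = ennreal K * (\<integral>\<^sup>+q. (\<integral>\<^sup>+t. indicator {0..1} t * W (hdil t q) \<partial>lborel) \<partial>cmeas)"
    by (rule nn_integral_cmult) measurable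
  also have "(\<integral>\<^sup>+q. (\<integral>\<^sup>+t. indicator {0..1} t * W (hdil t q) \<partial>lborel) \<partial>cmeas)
      = (\<integral>\<^sup>+t. (\<integral>\<^sup>+q. indicator {0..1} t * W (hdil t q) \<partial>cmeas) \<partial>lborel)"
    by (rule P.Fubini') measurable
  also have "\<dots> = (\<integral>\<^sup>+t. indicator {0..1} t * (\<integral>\<^sup>+q. W (hdil t q) \<partial>cmeas) \<partial>lborel)"
    by (intro nn_integral_cong nn_integral_cmult) measurable
  also have "\<dots> \<le> (\<integral>\<^sup>+t. indicator {0..1::real} t * (2 * (\<integral>\<^sup>+q. W q \<partial>cmeas)) \<partial>lborel)"
    by (intro nn_integral_mono mult_left_mono nn_integral_hdil_le) auto
  also have "\<dots> = 2 * (\<integral>\<^sup>+q. W q \<partial>cmeas)"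
    by (subst nn_integral_multc) auto
  also have "ennreal K * (2 * (\<integral>\<^sup>+q. W q \<partial>cmeas)) < \<infinity>"
    using int unfolding integrable_iff_bounded W_def by (simp add: ennreal_mult_less_top)
  finally show "(\<integral>\<^sup>+q. ennreal (cmod (wint \<zeta> (l + real k) a (\<lambda>q. (Lop ^^ k) f (hcoord z q)) q)) \<partial>cmeas) < \<infinity>"
    by (simp add: mult_left_mono)
qed

section \<open>Integration by parts\<close>

text \<open>
  The integral over a fibre is evaluated for almost all fibres only, namely those on which both
  functions are integrable. The second function \<open>E\<close> supplies the integrability of an antiderivative.
\<close>

lemma integral_cmeas_eq_0_fiberwise:
  fixes D E :: "('n :: {finite, linorder} \<Rightarrow> complex) \<times> real \<times> real \<Rightarrow> complex"
  assumes D: "integrable cmeas D" and E: "integrable cmeas E"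
    and zero: "\<And>v s. integrable lborel (\<lambda>u. D (v, s, u)) \<Longrightarrow> integrable lborel (\<lambda>u. E (v, s, u))
        \<Longrightarrow> (\<integral>u. D (v, s, u) \<partial>lborel) = 0"
  shows "(\<integral>q. D q \<partial>cmeas) = 0"
proof -
  interpret h: sigma_finite_measure "hmeas :: ('n \<Rightarrow> complex) measure" by (rule sigma_finite_hmeas)
  interpret P: pair_sigma_finite "hmeas :: ('n \<Rightarrow> complex) measure" plane
    by (intro pair_sigma_finite.intro h.sigma_finite_measure_axioms sigma_finite_plane)
  have "AE v in hmeas. (\<integral>p. D (v, p) \<partial>plane) = 0"
    using P.AE_integrable_fst'[OF D] P.AE_integrable_fst'[OF E]
  proof eventually_elim
    fix v assume v: "integrable plane (\<lambda>p. D (v, p))" "integrable plane (\<lambda>p. E (v, p))"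
    have "AE s in lborel. (\<integral>u. D (v, s, u) \<partial>lborel) = 0"
      using lborel_pair.AE_integrable_fst'[OF v(1)] lborel_pair.AE_integrable_fst'[OF v(2)]
      by eventually_elim (rule zero)
    then have "(\<integral>s. \<integral>u. D (v, s, u) \<partial>lborel \<partial>lborel) = 0"
      by (rule integral_eq_zero_AE)
    then show "(\<integral>p. D (v, p) \<partial>plane) = 0"
      using lborel_pair.integral_fst'[OF v(1)] by simp
  qed
  then have "(\<integral>v. \<integral>p. D (v, p) \<partial>plane \<partial>hmeas) = 0"
    by (rule integral_eq_zero_AE)
  then show ?thesis
    using P.integral_fst'[OF D] by simp
qed

text \<open>
  The quotient of \<open>s\<close> and the modulus of the kernel is at most 2.
\<close>

lemma wint_integrable_shift:
  fixes l a d :: real and F :: "('n :: {finite, linorder} \<Rightarrow> complex) \<times> real \<times> real \<Rightarrow> complex"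
  assumes \<zeta>: "0 < Im \<zeta>" and d: "0 \<le> d" and int: "integrable cmeas (wint \<zeta> l a F)"
  shows "integrable cmeas (wint \<zeta> (l + d) (a + d) F)"
proof -
  define c where "c = (\<lambda>(v :: 'n \<Rightarrow> complex, s, u). indicator {0<..} s *\<^sub>R (of_real (s powr d) / hker \<zeta> (s + sqn v) u powr of_real d))"
  have c: "wint \<zeta> (l + d) (a + d) F q = c q * wint \<zeta> l a F q" for q
  proof -
    obtain v s u where q: "q = (v, s, u)" by (cases q)
    show ?thesis
    proof (cases "0 < s")
      case True
      then have "hker \<zeta> (s + sqn v) u \<noteq> 0"
        using hker_norm_bounds(1)[OF True \<zeta>, of v u] by auto
      then show ?thesis
        using True by (simp add: q c_def wint_def powr_add field_simps)
    qed (simp add: q c_def wint_def)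
  qed
  have cm: "c \<in> borel_measurable cmeas"
    unfolding c_def case_prod_beta by measurable
  have cb: "cmod (c q) \<le> 2 powr d" for q
  proof -
    obtain v s u where q: "q = (v, s, u)" by (cases q)
    show ?thesis
    proof (cases "0 < s")
      case True
      define k where "k = cmod (hker \<zeta> (s + sqn v) u)"
      have k: "0 < k" "s \<le> 2 * k"
        using hker_norm_bounds[OF True \<zeta>, of v u] by (auto simp: k_def)
      then have "(s / k) powr d \<le> 2 powr d"
        using True k d by (intro powr_mono2) (auto simp: field_simps)
      then show ?thesis
        using True k by (simp add: q c_def norm_divide norm_powr_real_powr' k_def powr_divide)
    qed (simp add: q c_def)
  qed
  show ?thesis
  proof (rule Bochner_Integration.integrable_bound[OF integrable_mult_right[OF int, of "of_real (2 powr d)"]])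
    show "wint \<zeta> (l + d) (a + d) F \<in> borel_measurable cmeas"
      using cm borel_measurable_integrable[OF int] unfolding c[abs_def] by measurable
    show "AE q in cmeas. norm (wint \<zeta> (l + d) (a + d) F q) \<le> norm (of_real (2 powr d) * wint \<zeta> l a F q)"
      unfolding c norm_mult using cb by (intro AE_I2 mult_right_mono) auto
  qed
qed

text \<open>
  On a line with \<open>v\<close> and \<open>s\<close> fixed, the difference of the two integrands is the derivative in \<open>u\<close> of
  \<open>s\<^sup>l (\<L>\<^sub>n\<^sup>j f) \<rho>(z,\<cdot>)\<^sup>-\<^sup>b\<close>, which is integrable by the third integrability assumption.
\<close>

lemma wint_by_parts:
  fixes f :: "('n :: {finite, linorder}) cvec \<Rightarrow> complex" and l b :: real
  assumes hol: "holomorphic_sv f siegel" and z: "z \<in> siegel"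
    and I1: "integrable cmeas (wint (base z) l b (\<lambda>q. (Lop ^^ Suc j) f (hcoord z q)))"
    and I2: "integrable cmeas (wint (base z) l (b + 1) (\<lambda>q. (Lop ^^ j) f (hcoord z q)))"
    and I3: "integrable cmeas (wint (base z) (l - 1) b (\<lambda>q. (Lop ^^ j) f (hcoord z q)))"
  shows "(\<integral>q. wint (base z) l b (\<lambda>q. (Lop ^^ Suc j) f (hcoord z q)) q \<partial>cmeas)
    = (\<i> / 2) * of_real b * (\<integral>q. wint (base z) l (b + 1) (\<lambda>q. (Lop ^^ j) f (hcoord z q)) q \<partial>cmeas)"
proof -
  define \<zeta> where "\<zeta> = base z"
  have \<zeta>: "0 < Im \<zeta>" using z by (simp add: \<zeta>_def Im_base mem_siegel_iff)
  define A B E where "A = wint \<zeta> l b (\<lambda>q. (Lop ^^ Suc j) f (hcoord z q))"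
    and "B = wint \<zeta> l (b + 1) (\<lambda>q. (Lop ^^ j) f (hcoord z q))"
    and "E = wint \<zeta> (l - 1) b (\<lambda>q. (Lop ^^ j) f (hcoord z q))"
  have int: "integrable cmeas A" "integrable cmeas B" "integrable cmeas E"
    using I1 I2 I3 by (simp_all add: A_def B_def E_def \<zeta>_def)
  let ?c = "(\<i> / 2) * of_real b"
  have "(\<integral>q. A q - ?c * B q \<partial>cmeas) = 0"
  proof (rule integral_cmeas_eq_0_fiberwise[OF _ int(3)])
    show "integrable cmeas (\<lambda>q. A q - ?c * B q)"
      using int by (intro Bochner_Integration.integrable_diff integrable_mult_right)
    fix v :: "'n \<Rightarrow> complex" and s :: real
    assume D: "integrable lborel (\<lambda>u. A (v, s, u) - ?c * B (v, s, u))" and Eu: "integrable lborel (\<lambda>u. E (v, s, u))"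
    show "(\<integral>u. A (v, s, u) - ?c * B (v, s, u) \<partial>lborel) = 0"
    proof (cases "0 < s")
      case False
      then show ?thesis by (simp add: A_def B_def wint_def)
    next
      case s: True
      define y where "y = s + sqn v"
      define F where "F \<omega> = f (heis z v \<omega>)" for \<omega>
      \<comment> \<open>The holomorphic function of \<open>\<omega>\<close> that agrees with the kernel on the line \<open>Im \<omega> = y\<close>.\<close>
      define k where "k \<omega> = (\<i> / 2) * (\<omega> - 2 * \<i> * of_real y - \<zeta>)" for \<omega>
      define S where "S = {\<omega>. sqn v < Im \<omega> \<and> Im \<omega> < 2 * y + Im \<zeta>}"
      have S: "open S"
        unfolding S_def by (intro open_Collect_conj open_halfspace_Im_gt open_halfspace_Im_lt)
      have yS: "Complex u y \<in> S" for u
      proof -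
        have "0 < s + Im \<zeta> + sqn v"
          using s \<zeta> by (intro add_pos_nonneg) auto
        then show ?thesis
          using s by (simp add: S_def y_def algebra_simps)
      qed
      have Fhol: "F holomorphic_on {\<omega>. sqn v < Im \<omega>}"
        unfolding F_def by (rule holomorphic_heis_slice[OF hol])
      then have Fhol: "F holomorphic_on S"
        by (rule holomorphic_on_subset) (auto simp: S_def)
      have kpos: "k \<omega> \<notin> \<real>\<^sub>\<le>\<^sub>0" "k \<omega> \<noteq> 0" if "\<omega> \<in> S" for \<omega>
        using that by (auto simp: S_def k_def complex_nonpos_Reals_iff complex_eq_iff)
      define \<Phi> where "\<Phi> \<omega> = (deriv ^^ j) F \<omega> * k \<omega> powr (- of_real b)" for \<omega>
      define \<Phi>' where "\<Phi>' \<omega> = (deriv ^^ Suc j) F \<omega> * k \<omega> powr (- of_real b)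
          - ?c * ((deriv ^^ j) F \<omega> * k \<omega> powr (- of_real (b + 1)))" for \<omega>
      have d: "(\<Phi> has_field_derivative \<Phi>' \<omega>) (at \<omega>)" if "\<omega> \<in> S" for \<omega>
      proof -
        have 1: "((deriv ^^ j) F has_field_derivative (deriv ^^ Suc j) F \<omega>) (at \<omega>)"
          using has_field_derivative_higher_deriv[OF Fhol S that] .
        have "(k has_field_derivative \<i> / 2) (at \<omega>)"
          unfolding k_def by (auto intro!: derivative_eq_intros)
        from DERIV_chain2[OF has_field_derivative_powr[OF kpos(1)[OF that]] this]
        have 2: "((\<lambda>\<omega>. k \<omega> powr (- of_real b)) has_field_derivative
            (- of_real b) * k \<omega> powr (- of_real b - 1) * (\<i> / 2)) (at \<omega>)" .
        have e: "- complex_of_real b - 1 = - of_real (b + 1)" by simp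
        show ?thesis
          unfolding \<Phi>_def using DERIV_mult[OF 1 2]
          by (rule DERIV_cong) (simp only: e, simp add: \<Phi>'_def algebra_simps)
      qed
      have \<Phi>'c: "continuous_on S \<Phi>'"
      proof -
        have "k holomorphic_on S" unfolding k_def by (intro holomorphic_intros)
        then have "(\<lambda>\<omega>. k \<omega> powr c) holomorphic_on S" for c
          using kpos(1) by (intro holomorphic_intros) auto
        then have 1: "continuous_on S (\<lambda>\<omega>. k \<omega> powr c)" for c
          by (rule holomorphic_on_imp_continuous_on)
        have 2: "continuous_on S ((deriv ^^ i) F)" for i
          by (rule holomorphic_on_imp_continuous_on[OF holomorphic_higher_deriv[OF Fhol S]])
        show ?thesis
          unfolding \<Phi>'_def by (intro continuous_on_diff continuous_on_mult continuous_on_const 1 2)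
      qed
      have kk: "k (Complex u y) = hker \<zeta> (s + sqn v) u" for u
        by (simp add: k_def hker_def y_def complex_eq_iff)
      have Lo: "(Lop ^^ i) f (hcoord z (v, s, u)) = (deriv ^^ i) F (Complex u y)" for i u
        by (simp add: hcoord_def y_def F_def[abs_def] Lop_iterate_heis)
      have AB: "A (v, s, u) - ?c * B (v, s, u) = of_real (s powr l) * \<Phi>' (Complex u y)" for u
        using s unfolding A_def B_def wint_def Lo \<Phi>'_def kk[symmetric] case_prod_conv powr_minus_divide
        by (simp add: algebra_simps)
      have EP: "E (v, s, u) = of_real (s powr (l - 1)) * \<Phi> (Complex u y)" for u
        using s unfolding E_def wint_def Lo \<Phi>_def kk[symmetric] case_prod_conv powr_minus_divide
        by simp
      have "(\<integral>u. \<Phi>' (Complex u y) \<partial>lborel) = 0"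
      proof (rule integral_derivative_eq_0)
        show "((\<lambda>u. \<Phi> (Complex u y)) has_vector_derivative \<Phi>' (Complex u y)) (at u)" for u
        proof -
          have "((\<lambda>u. Complex u y) has_vector_derivative 1) (at u)"
            unfolding Complex_eq has_vector_derivative_def
            by (auto intro!: derivative_eq_intros simp: scaleR_conv_of_real)
          from field_vector_diff_chain_at[OF this d[OF yS]] show ?thesis
            by (simp add: o_def)
        qed
        show "continuous_on UNIV (\<lambda>u. \<Phi>' (Complex u y))"
          by (rule continuous_on_compose2[OF \<Phi>'c]) (use yS in \<open>auto simp: Complex_eq intro!: continuous_intros\<close>)
        have nz: "complex_of_real (s powr l) \<noteq> 0" "complex_of_real (s powr (l - 1)) \<noteq> 0"
          using s by auto
        show "integrable lborel (\<lambda>u. \<Phi> (Complex u y))"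
          using integrable_mult_right[OF Eu[unfolded EP], of "1 / of_real (s powr (l - 1))"] nz by simp
        show "integrable lborel (\<lambda>u. \<Phi>' (Complex u y))"
          using integrable_mult_right[OF D[unfolded AB], of "1 / of_real (s powr l)"] nz by simp
      qed
      then show ?thesis
        unfolding AB by simp
    qed
  qed
  then have "(\<integral>q. A q \<partial>cmeas) = ?c * (\<integral>q. B q \<partial>cmeas)"
    using int by (simp add: Bochner_Integration.integral_diff)
  then show ?thesis
    by (simp add: A_def B_def \<zeta>_def)
qed

text \<open>
  Induction on the number \<open>j\<close> of derivatives that are still on \<open>f\<close>, starting from the reproducing
  formula with exponent \<open>l + N\<close>. The exponents of all integrands that occur arise from
  \<open>wint_Lop_integrable\<close> by raising both exponents by the same amount.
\<close>

theorem wint_Lop_reproducing: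
  fixes f :: "('n :: {finite, linorder}) cvec \<Rightarrow> complex" and l :: real
  defines "a \<equiv> real CARD('n) + 1 + l"
  assumes l: "l > -1" and z: "z \<in> siegel" and hol: "holomorphic_sv f siegel"
    and int: "integrable cmeas (wint (base z) l a (\<lambda>q. f (hcoord z q)))"
  shows "(\<integral>q. wint (base z) (l + real N) a (\<lambda>q. (Lop ^^ N) f (hcoord z q)) q \<partial>cmeas)
    = (\<i> / 2) ^ N * of_real (4 * pi ^ CARD('n) * Gamma (1 + l + real N) / Gamma a) * f z"
proof -
  have \<zeta>: "0 < Im (base z)" using z by (simp add: Im_base mem_siegel_iff)
  have a: "0 < a" using l by (simp add: a_def)
  have I: "integrable cmeas (wint (base z) (l + real k + d) (a + d) (\<lambda>q. (Lop ^^ k) f (hcoord z q)))" if "0 \<le> d" for k d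
    by (rule wint_integrable_shift[OF \<zeta> that wint_Lop_integrable[OF hol \<zeta> a int]])
  have X0: "(\<integral>q. wint (base z) (l + real N) (a + real N) (\<lambda>q. f (hcoord z q)) q \<partial>cmeas)
      = of_real (4 * pi ^ CARD('n) * Gamma (1 + l + real N) / Gamma (a + real N)) * f z"
  proof -
    have e: "real CARD('n) + 1 + (l + real N) = a + real N" "1 + (l + real N) = 1 + l + real N"
      by (simp_all add: a_def)
    have "integrable cmeas (wint (base z) (l + real N) (a + real N) (\<lambda>q. f (hcoord z q)))"
      using I[of "real N" 0] by simp
    then show ?thesis
      using siegel_reproducing[of "l + real N" z f] l z hol unfolding e by simp
  qed
  have "(\<integral>q. wint (base z) (l + real N) (a + real (N - j)) (\<lambda>q. (Lop ^^ j) f (hcoord z q)) q \<partial>cmeas)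
      = (\<i> / 2) ^ j * of_real (4 * pi ^ CARD('n) * Gamma (1 + l + real N) / Gamma (a + real (N - j))) * f z" if "j \<le> N" for j
    using that
  proof (induction j)
    case 0
    then show ?case using X0 by simp
  next
    case (Suc j)
    define b where "b = a + real (N - Suc j)"
    have b: "0 < b" using a by (simp add: b_def)
    have e: "a + real (N - j) = b + 1"
      using Suc.prems by (simp add: b_def of_nat_diff)
    have G: "Gamma (b + 1) = b * Gamma b"
      using b nonpos_Ints_nonpos[of b] by (intro Gamma_plus1) auto
    have "(\<integral>q. wint (base z) (l + real N) b (\<lambda>q. (Lop ^^ Suc j) f (hcoord z q)) q \<partial>cmeas)
        = (\<i> / 2) * of_real b * (\<integral>q. wint (base z) (l + real N) (b + 1) (\<lambda>q. (Lop ^^ j) f (hcoord z q)) q \<partial>cmeas)"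
    proof (rule wint_by_parts[OF hol z])
      have "l + real (Suc j) + real (N - Suc j) = l + real N" "l + real j + real (N - Suc j) = l + real N - 1"
        "l + real j + (real (N - Suc j) + 1) = l + real N"
        using Suc.prems by (simp_all add: of_nat_diff)
      then show "integrable cmeas (wint (base z) (l + real N) b (\<lambda>q. (Lop ^^ Suc j) f (hcoord z q)))"
        "integrable cmeas (wint (base z) (l + real N - 1) b (\<lambda>q. (Lop ^^ j) f (hcoord z q)))"
        "integrable cmeas (wint (base z) (l + real N) (b + 1) (\<lambda>q. (Lop ^^ j) f (hcoord z q)))"
        using I[of "real (N - Suc j)" "Suc j"] I[of "real (N - Suc j)" j] I[of "real (N - Suc j) + 1" j]
        by (simp_all only: b_def add.assoc)
    qed
    also have "\<dots> = (\<i> / 2) * of_real b * ((\<i> / 2) ^ j * of_real (4 * pi ^ CARD('n) * Gamma (1 + l + real N) / Gamma (b + 1)) * f z)"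
      using Suc.IH Suc.prems unfolding e by simp
    also have "\<dots> = (\<i> / 2) ^ Suc j * of_real (4 * pi ^ CARD('n) * Gamma (1 + l + real N) / Gamma b) * f z"
      using b unfolding G by simp
    finally show ?case by (simp only: b_def)
  qed
  from this[of N] show ?thesis by simp
qed

section \<open>Integrability of Bergman functions against the kernel\<close>

text \<open>
  Near 0 the integrand is comparable to \<open>r\<^sup>\<mu>\<close>, near infinity to \<open>r\<^sup>\<mu>\<^sup>-\<^sup>b\<close>.
\<close>

lemma nn_integral_powr_tail:
  fixes \<mu> b \<delta> :: real
  assumes \<mu>: "\<mu> > -1" and b: "1 + \<mu> < b" and \<delta>: "0 < \<delta>"
  shows "(\<integral>\<^sup>+r. indicator {0<..} r * ennreal (r powr \<mu> / (r + \<delta>) powr b) \<partial>lborel) < \<infinity>"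
proof -
  have "(\<integral>\<^sup>+r. indicator {0<..} r * ennreal (r powr \<mu> / (r + \<delta>) powr b) \<partial>lborel)
      \<le> (\<integral>\<^sup>+r. ennreal (1 / \<delta> powr b) * (indicator {0<..<1} r * ennreal (r powr \<mu>))
            + ennreal (r powr (\<mu> - b)) * indicator {1..} r \<partial>lborel)"
  proof (rule nn_integral_mono)
    fix r :: real
    consider "r \<le> 0" | "0 < r" "r < 1" | "1 \<le> r" by linarith
    then show "indicator {0<..} r * ennreal (r powr \<mu> / (r + \<delta>) powr b)
        \<le> ennreal (1 / \<delta> powr b) * (indicator {0<..<1} r * ennreal (r powr \<mu>)) + ennreal (r powr (\<mu> - b)) * indicator {1..} r"
    proof cases
      case 2
      have "\<delta> powr b \<le> (r + \<delta>) powr b"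
        using 2 \<mu> b \<delta> by (intro powr_mono2) auto
      then have "r powr \<mu> / (r + \<delta>) powr b \<le> r powr \<mu> / \<delta> powr b"
        using 2 \<delta> by (intro divide_left_mono mult_pos_pos) auto
      then show ?thesis
        using 2 by (simp add: ennreal_mult'[symmetric] ennreal_leI)
    next
      case 3
      have "r powr b \<le> (r + \<delta>) powr b"
        using 3 \<mu> b \<delta> by (intro powr_mono2) auto
      then have "r powr \<mu> / (r + \<delta>) powr b \<le> r powr \<mu> / r powr b"
        using 3 \<delta> by (intro divide_left_mono mult_pos_pos) auto
      then show ?thesis
        using 3 by (simp add: powr_diff ennreal_leI)
    qed simp
  qed
  also have "\<dots> = ennreal (1 / \<delta> powr b) * (\<integral>\<^sup>+r. indicator {0<..<1} r * ennreal (r powr \<mu>) \<partial>lborel)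
      + (\<integral>\<^sup>+r. ennreal (r powr (\<mu> - b)) * indicator {1..} r \<partial>lborel)"
    by (subst nn_integral_add) (auto simp: nn_integral_cmult)
  also have "\<dots> < \<infinity>"
  proof -
    have "((\<lambda>r. r powr (\<mu> - b)) has_integral -(1 powr (\<mu> - b + 1)) / (\<mu> - b + 1)) {1..}"
      using b by (intro has_integral_powr_to_inf) auto
    then have "(\<integral>\<^sup>+r. ennreal (r powr (\<mu> - b)) * indicator {1..} r \<partial>lborel) = ennreal (-(1 powr (\<mu> - b + 1)) / (\<mu> - b + 1))"
      by (intro nn_integral_has_integral_lebesgue') auto
    then show ?thesis
      using \<mu> nn_integral_powr_from_0[of \<mu> 1] by (simp add: ennreal_mult_less_top)
  qed
  finally show ?thesis .
qed

lemma nn_integral_powr_two_sided: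
  fixes b \<delta> x0 :: real
  assumes b: "1 < b" and \<delta>: "0 < \<delta>"
  shows "(\<integral>\<^sup>+u. ennreal (1 / (\<bar>u - x0\<bar> + \<delta>) powr b) \<partial>lborel) < \<infinity>"
proof -
  define g where "g u = indicator {0<..} u * ennreal (u powr 0 / (u + \<delta>) powr b)" for u :: real
  have [measurable]: "g \<in> borel_measurable borel" unfolding g_def by measurable
  have g: "(\<integral>\<^sup>+u. g u \<partial>lborel) < \<infinity>"
    unfolding g_def using b by (intro nn_integral_powr_tail \<delta>) auto
  have "(\<integral>\<^sup>+u. ennreal (1 / (\<bar>u - x0\<bar> + \<delta>) powr b) \<partial>lborel) = (\<integral>\<^sup>+u. ennreal (1 / (\<bar>u\<bar> + \<delta>) powr b) \<partial>lborel)"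
    using nn_integral_lborel_plus[of "\<lambda>u. ennreal (1 / (\<bar>u - x0\<bar> + \<delta>) powr b)" x0] by simp
  also have "\<dots> = (\<integral>\<^sup>+u. g u + g (0 + (-1) * u) \<partial>lborel)"
    by (intro nn_integral_cong_AE, use AE_lborel_singleton[of 0] in eventually_elim)
       (auto simp: g_def indicator_def)
  also have "\<dots> = (\<integral>\<^sup>+u. g u \<partial>lborel) + (\<integral>\<^sup>+u. g (0 + (-1) * u) \<partial>lborel)"
    by (rule nn_integral_add) measurable
  also have "(\<integral>\<^sup>+u. g (0 + (-1) * u) \<partial>lborel) = (\<integral>\<^sup>+u. g u \<partial>lborel)"
    using nn_integral_real_affine[of g "-1" 0] by simp
  finally show ?thesis using g by simp
qed

text \<open>
  After radial integration the integrand is \<open>r\<^sup>\<alpha>\<^sup>+\<^sup>n\<^sup>-\<^sup>1 |\<rho>(\<zeta>, u + ir)|\<^sup>-\<^sup>\<beta>\<close>. The modulus of the kernel dominates,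
  up to constants, both \<open>r + Im \<zeta>\<close> and \<open>|u - Re \<zeta>| + Im \<zeta>\<close>; splitting \<open>\<beta>\<close> into two exponents bounds the integral by a
  product of two one-dimensional ones. The room in the hypothesis on \<open>\<beta>\<close> is shared equally between them.
\<close>

lemma nn_integral_hker_finite:
  fixes \<alpha> \<beta> :: real and \<zeta> :: complex
  assumes \<zeta>: "0 < Im \<zeta>" and \<alpha>: "\<alpha> > -1" and \<beta>: "real CARD('n :: {finite, linorder}) + 1 + \<alpha> < \<beta>"
  shows "(\<integral>\<^sup>+(v, s, u). indicator {0<..} s * ennreal (s powr \<alpha> / cmod (hker \<zeta> (s + sqn v) u) powr \<beta>)
    \<partial>(cmeas :: (('n \<Rightarrow> complex) \<times> real \<times> real) measure)) < \<infinity>"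
proof -
  define m where "m = CARD('n) - 1"
  have n: "CARD('n) = Suc m"
    using zero_less_card_finite[where 'a='n] by (simp add: m_def)
  \<comment> \<open>Half of the amount by which \<open>\<beta>\<close> exceeds \<open>n + 1 + \<alpha>\<close>.\<close>
  define e where "e = (\<beta> - (real m + 2 + \<alpha>)) / 2"
  have e: "0 < e" using \<beta> by (simp add: e_def n)
  define b1 b2 where "b1 = 1 + e" and "b2 = 1 + (\<alpha> + real m) + e"
  have b: "1 < b1" "1 + (\<alpha> + real m) < b2" "b1 + b2 = \<beta>" "0 < b2" "\<alpha> + real m > -1"
    using e \<alpha> by (auto simp: b1_def b2_def) (simp add: e_def field_simps)
  define x0 y0 where "x0 = Re \<zeta>" and "y0 = Im \<zeta>"
  define W where "W = (\<lambda>(r, u). ennreal (1 / cmod (hker \<zeta> r u) powr \<beta>))"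
  have Wm [measurable]: "W \<in> borel_measurable plane"
    unfolding W_def by measurable
  let ?T = "\<lambda>(v :: 'n \<Rightarrow> complex, s :: real, u :: real). (s + sqn v, u)"
  have Tm: "?T \<in> measurable cmeas plane" by measurable
  let ?d = "\<lambda>(v :: 'n \<Rightarrow> complex, s :: real, u :: real). indicator {0<..} s * ennreal (s powr \<alpha>)"
  have dm: "?d \<in> borel_measurable cmeas" by measurable
  let ?C = "ennreal (pi ^ m * Gamma (1 + \<alpha>) / Gamma (1 + \<alpha> + real m))"
  let ?d' = "\<lambda>(r, u :: real). ?C * (indicator {0<..} r * ennreal (r powr (\<alpha> + real m)))"
  have d'm: "?d' \<in> borel_measurable plane" by measurable
  let ?K = "2 powr b2 * 4 powr b1"
  have "(\<integral>\<^sup>+(v, s, u). indicator {0<..} s * ennreal (s powr \<alpha> / cmod (hker \<zeta> (s + sqn v) u) powr \<beta>)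
    \<partial>(cmeas :: (('n \<Rightarrow> complex) \<times> real \<times> real) measure)) = (\<integral>\<^sup>+q. ?d q * W (?T q) \<partial>cmeas)"
    by (intro nn_integral_cong) (auto simp: W_def mult.assoc ennreal_mult'[symmetric])
  also have "\<dots> = (\<integral>\<^sup>+q. W (?T q) \<partial>density cmeas ?d)"
    using dm measurable_compose[OF Tm Wm] by (rule nn_integral_density[symmetric])
  also have "\<dots> = (\<integral>\<^sup>+p. W p \<partial>distr (density cmeas ?d) plane ?T)"
    using Tm by (intro nn_integral_distr[symmetric]) auto
  also have "\<dots> = (\<integral>\<^sup>+p. W p \<partial>density plane ?d')"
    using distr_cmeas_radial[OF \<alpha>, where 'n = 'n] by (simp add: m_def)
  also have "\<dots> = (\<integral>\<^sup>+p. ?d' p * W p \<partial>plane)"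
    using d'm Wm by (rule nn_integral_density)
  also have "\<dots> = (\<integral>\<^sup>+r. \<integral>\<^sup>+u. ?C * (indicator {0<..} r * ennreal (r powr (\<alpha> + real m))) * W (r, u) \<partial>lborel \<partial>lborel)"
    by (subst lborel.nn_integral_fst[symmetric]) auto
  also have "\<dots> \<le> (\<integral>\<^sup>+r. \<integral>\<^sup>+u. (?C * ennreal ?K * (indicator {0<..} r * ennreal (r powr (\<alpha> + real m) / (r + y0) powr b2)))
       * ennreal (1 / (\<bar>u - x0\<bar> + y0) powr b1) \<partial>lborel \<partial>lborel)"
  proof (intro nn_integral_mono)
    fix r u :: real
    show "?C * (indicator {0<..} r * ennreal (r powr (\<alpha> + real m))) * W (r, u)
      \<le> (?C * ennreal ?K * (indicator {0<..} r * ennreal (r powr (\<alpha> + real m) / (r + y0) powr b2)))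
       * ennreal (1 / (\<bar>u - x0\<bar> + y0) powr b1)"
    proof (cases "0 < r")
      case True
      define k where "k = cmod (hker \<zeta> r u)"
      have k: "r + y0 \<le> 2 * k"
        using True \<zeta> hker_norm_ge[of r \<zeta> u] by (auto simp: k_def y0_def)
      moreover have "0 < r + y0" using True \<zeta> by (simp add: y0_def)
      ultimately have k: "r + y0 \<le> 2 * k" "0 < k" by linarith+
      have "\<bar>(u - x0) / 2\<bar> \<le> k"
        using abs_Im_le_cmod[of "hker \<zeta> r u"] by (simp add: k_def hker_eq x0_def)
      then have k2: "\<bar>u - x0\<bar> + y0 \<le> 4 * k" using k True by simp
      have y0: "0 < y0" using \<zeta> by (simp add: y0_def)
      have "(r + y0) powr b2 * (\<bar>u - x0\<bar> + y0) powr b1 \<le> (2 * k) powr b2 * (4 * k) powr b1"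
        using k k2 True y0 b by (intro mult_mono powr_mono2) auto
      also have "\<dots> = ?K * k powr \<beta>"
        using k b(3) by (simp add: powr_mult powr_add[symmetric] add.commute)
      finally have "r powr (\<alpha> + real m) / k powr \<beta> \<le> ?K * (r powr (\<alpha> + real m) / (r + y0) powr b2) * (1 / (\<bar>u - x0\<bar> + y0) powr b1)"
        using k True y0 by (simp add: divide_simps mult_ac mult_left_mono)
      then have "ennreal (r powr (\<alpha> + real m) / k powr \<beta>) \<le> ennreal (?K * (r powr (\<alpha> + real m) / (r + y0) powr b2) * (1 / (\<bar>u - x0\<bar> + y0) powr b1))"
        by (rule ennreal_leI)
      also have "\<dots> = ennreal ?K * ennreal (r powr (\<alpha> + real m) / (r + y0) powr b2) * ennreal (1 / (\<bar>u - x0\<bar> + y0) powr b1)"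
      proof -
        have *: "ennreal (c1 * c2 * c3) = ennreal c1 * ennreal c2 * ennreal c3" if "0 \<le> c1" "0 \<le> c2" "0 \<le> c3" for c1 c2 c3
          using that by (simp add: ennreal_mult)
        show ?thesis by (rule *) (use True y0 in auto)
      qed
      finally have "ennreal (r powr (\<alpha> + real m)) * W (r, u) \<le> ennreal ?K * ennreal (r powr (\<alpha> + real m) / (r + y0) powr b2) * ennreal (1 / (\<bar>u - x0\<bar> + y0) powr b1)"
        by (simp add: W_def k_def ennreal_mult'[symmetric])
      from mult_left_mono[OF this, of ?C] True show ?thesis
        by (simp add: mult.assoc)
    qed simp
  qed
  also have "\<dots> = (?C * ennreal ?K * (\<integral>\<^sup>+r. indicator {0<..} r * ennreal (r powr (\<alpha> + real m) / (r + y0) powr b2) \<partial>lborel))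
       * (\<integral>\<^sup>+u. ennreal (1 / (\<bar>u - x0\<bar> + y0) powr b1) \<partial>lborel)"
    by (simp add: nn_integral_cmult nn_integral_multc)
  also have "\<dots> < \<infinity>"
    using nn_integral_powr_tail[OF b(5,2), of y0] nn_integral_powr_two_sided[OF b(1), of y0 x0] \<zeta>
    by (simp add: ennreal_mult_less_top y0_def)
  finally show ?thesis .
qed

lemma nn_integral_siegel_hcoord:
  fixes H :: "('n :: {finite, linorder}) cvec \<Rightarrow> ennreal"
  assumes H: "(\<lambda>w. indicator siegel w * H w) \<in> borel_measurable borel"
  shows "(\<integral>\<^sup>+w. H w \<partial>lebesgue_on siegel) = (\<integral>\<^sup>+(v, s, u). indicator {0<..} s * H (hcoord z (v, s, u)) \<partial>cmeas)"
proof -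
  have leb: "siegel \<inter> space lebesgue \<in> sets lebesgue"
    using siegel_borel by simp
  have "(\<integral>\<^sup>+w. H w \<partial>lebesgue_on siegel) = (\<integral>\<^sup>+w. H w * indicator siegel w \<partial>lebesgue)"
    by (rule nn_integral_restrict_space[OF leb])
  also have "\<dots> = (\<integral>\<^sup>+w. indicator siegel w * H w \<partial>lborel)"
    using H by (simp add: nn_integral_completion mult.commute)
  also have "\<dots> = (\<integral>\<^sup>+q. indicator siegel (hcoord z q) * H (hcoord z q) \<partial>cmeas)"
  proof -
    have "(\<integral>\<^sup>+w. indicator siegel w * H w \<partial>distr cmeas borel (hcoord z))
        = (\<integral>\<^sup>+q. indicator siegel (hcoord z q) * H (hcoord z q) \<partial>cmeas)"
      by (rule nn_integral_distr) (use H in auto)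
    then show ?thesis unfolding distr_hcoord .
  qed
  also have "\<dots> = (\<integral>\<^sup>+(v, s, u). indicator {0<..} s * H (hcoord z (v, s, u)) \<partial>cmeas)"
    by (intro nn_integral_cong) (auto simp: indicator_def hcoord_in_siegel)
  finally show ?thesis .
qed

text \<open>
  For \<open>p > 1\<close>, write the integrand as \<open>(|f| s\<^sup>t\<^sup>/\<^sup>p) (s\<^sup>l\<^sup>-\<^sup>t\<^sup>/\<^sup>p |\<rho>(z,\<cdot>)|\<^sup>-\<^sup>a)\<close> and apply Young's inequality with the
  exponents \<open>p\<close> and \<open>r = p/(p - 1)\<close>. The second term is a weighted power of the kernel; its weight
  exponent \<open>\<alpha> = r(l - t/p)\<close> exceeds \<open>-1\<close> exactly when \<open>l > (t + 1)/p - 1\<close>, and the kernel exponent is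
  large enough because \<open>t > -1\<close>. For \<open>p = 1\<close> the second factor is bounded, since
  \<open>0 \<le> l - t < a\<close>.
\<close>

lemma bergman_wint_integrable:
  fixes f :: "('n :: {finite, linorder}) cvec \<Rightarrow> complex" and p t l :: real
  assumes p: "1 \<le> p" and t: "t > -1" and l1: "1 < p \<Longrightarrow> l > (t + 1) / p - 1" and l2: "p = 1 \<Longrightarrow> l \<ge> t"
    and f: "f \<in> bergman p t" and z: "z \<in> siegel"
  shows "integrable cmeas (wint (base z) l (real CARD('n) + 1 + l) (\<lambda>q. f (hcoord z q)))"
proof (rule integrableI_bounded)
  define a where "a = real CARD('n) + 1 + l"
  define \<zeta> where "\<zeta> = base z"
  have \<zeta>: "0 < Im \<zeta>" using z by (simp add: \<zeta>_def Im_base mem_siegel_iff)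
  have hol: "holomorphic_sv f siegel" using f by (simp add: bergman_def)
  have gm: "wint \<zeta> l b (\<lambda>q. f (hcoord z q)) \<in> borel_measurable cmeas" for b
    using wint_measurable[OF hol, where k = 0] by simp
  then show "wint (base z) l (real CARD('n) + 1 + l) (\<lambda>q. f (hcoord z q)) \<in> borel_measurable cmeas"
    by (simp add: \<zeta>_def)
  define J where "J = (\<lambda>(v, s, u). indicator {0<..} s * ennreal (cmod (f (hcoord z (v, s, u))) powr p * s powr t))"
  have Fm: "(\<lambda>w. indicator siegel w *\<^sub>R f w) \<in> borel_measurable borel"
    using Lop_iterate_measurable[OF hol, of 0] by simp
  have Jm: "(\<lambda>w. indicator siegel w * ennreal (cmod (f w) powr p * rho w powr t)) \<in> borel_measurable borel"
  proof -
    define F where "F w = indicator siegel w *\<^sub>R f w" for w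
    have [measurable]: "F \<in> borel_measurable borel" unfolding F_def by (rule Fm)
    have "(\<lambda>w. indicator siegel w * ennreal (cmod (f w) powr p * rho w powr t)) = (\<lambda>w. indicator siegel w * ennreal (cmod (F w) powr p * rho w powr t))"
      by (auto simp: F_def indicator_def)
    also have "\<dots> \<in> borel_measurable borel" by measurable
    finally show ?thesis .
  qed
  have Jm': "J \<in> borel_measurable cmeas"
  proof -
    have "J = (\<lambda>q. indicator siegel (hcoord z q) * ennreal (cmod (f (hcoord z q)) powr p * rho (hcoord z q) powr t))"
      by (auto simp: J_def indicator_def hcoord_in_siegel rho_hcoord)
    then show ?thesis
      using measurable_compose[OF hcoord_measurable Jm] by simp
  qed
  have J: "(\<integral>\<^sup>+q. J q \<partial>cmeas) < \<infinity>"
    using f nn_integral_siegel_hcoord[OF Jm, of z]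
    by (simp add: bergman_def Lp_weighted_def J_def rho_hcoord)
  show "(\<integral>\<^sup>+q. ennreal (norm (wint (base z) l (real CARD('n) + 1 + l) (\<lambda>q. f (hcoord z q)) q)) \<partial>cmeas) < \<infinity>"
    unfolding \<zeta>_def[symmetric] a_def[symmetric]
  proof (cases "p = 1")
    case True
    then have lt: "t \<le> l" using l2 by simp
    define C where "C = 2 powr (l - t) * (2 / Im \<zeta>) powr (a - (l - t))"
    have C: "0 \<le> C" by (simp add: C_def)
    have pt: "ennreal (cmod (wint \<zeta> l a (\<lambda>q. f (hcoord z q)) q)) \<le> ennreal C * J q" for q
    proof -
      obtain v s u where q: "q = (v, s, u)" by (cases q)
      show ?thesis
      proof (cases "0 < s")
        case s: True
        define k where "k = cmod (hker \<zeta> (s + sqn v) u)"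
        have k: "0 < k" and sk: "s \<le> 2 * k" "Im \<zeta> \<le> 2 * k"
          using hker_norm_bounds[OF s \<zeta>, of v u] by (auto simp: k_def)
        have "s powr l / k powr a = s powr t * ((s / k) powr (l - t) * (1 / k) powr (a - (l - t)))"
        proof -
          have "s powr t * s powr (l - t) = s powr l" "k powr (l - t) * k powr (a - (l - t)) = k powr a"
            by (simp_all flip: powr_add)
          then show ?thesis using s k by (simp add: powr_divide)
        qed
        also have "\<dots> \<le> s powr t * C"
          unfolding C_def using sk k s \<zeta> lt t
          by (intro mult_left_mono mult_mono powr_mono2) (auto simp: field_simps a_def)
        finally have "s powr l / k powr a * cmod (f (hcoord z q)) \<le> s powr t * C * cmod (f (hcoord z q))"
          by (rule mult_right_mono) simp
        then have "cmod (wint \<zeta> l a (\<lambda>q. f (hcoord z q)) q) \<le> C * (cmod (f (hcoord z q)) powr p * s powr t)"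
          using s True by (simp add: wint_def q k_def norm_mult norm_divide norm_powr_real_powr' mult_ac)
        then show ?thesis
          using s C by (simp add: J_def q ennreal_mult'[symmetric] ennreal_leI)
      qed (simp add: q wint_def)
    qed
    have "(\<integral>\<^sup>+q. ennreal (cmod (wint \<zeta> l a (\<lambda>q. f (hcoord z q)) q)) \<partial>cmeas) \<le> (\<integral>\<^sup>+q. ennreal C * J q \<partial>cmeas)"
      by (intro nn_integral_mono pt)
    also have "\<dots> = ennreal C * (\<integral>\<^sup>+q. J q \<partial>cmeas)"
      using Jm' by (rule nn_integral_cmult)
    also have "\<dots> < \<infinity>"
      using J by (simp add: ennreal_mult_less_top)
    finally show "(\<integral>\<^sup>+q. ennreal (cmod (wint \<zeta> l a (\<lambda>q. f (hcoord z q)) q)) \<partial>cmeas) < \<infinity>" .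
  next
    case False
    then have p1: "1 < p" using p by simp
    define r where "r = p / (p - 1)"
    have r: "1 < r" "1 / p + 1 / r = 1" using p1 by (auto simp: r_def field_simps)
    define \<alpha> where "\<alpha> = r * (l - t / p)"
    define \<beta> where "\<beta> = r * a"
    have \<alpha>: "\<alpha> > -1"
    proof -
      have "- (1 / r) < l - t / p"
        using l1[OF p1] r(2) by (simp add: add_divide_distrib)
      then have "r * (- (1 / r)) < r * (l - t / p)"
        using r(1) by (intro mult_strict_left_mono) auto
      then show ?thesis using r(1) by (simp add: \<alpha>_def)
    qed
    have \<beta>: "real CARD('n) + 1 + \<alpha> < \<beta>"
    proof -
      have "r * (t / p) = (r - 1) * t"
        using p1 by (simp add: r_def field_simps)
      then have "\<beta> - (real CARD('n) + 1 + \<alpha>) = (r - 1) * (real CARD('n) + 1 + t)"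
        by (simp add: \<beta>_def \<alpha>_def a_def algebra_simps)
      also have "\<dots> > 0"
        using r t by (intro mult_pos_pos) auto
      finally show ?thesis by simp
    qed
    define I where "I = (\<lambda>(v :: 'n \<Rightarrow> complex, s, u). indicator {0<..} s * ennreal (s powr \<alpha> / cmod (hker \<zeta> (s + sqn v) u) powr \<beta>))"
    have I: "(\<integral>\<^sup>+q. I q \<partial>cmeas) < \<infinity>"
      unfolding I_def by (rule nn_integral_hker_finite[OF \<zeta> \<alpha> \<beta>])
    have Im: "I \<in> borel_measurable cmeas"
      unfolding I_def by measurable
    have pt: "ennreal (cmod (wint \<zeta> l a (\<lambda>q. f (hcoord z q)) q)) \<le> J q + I q" for q
    proof -
      obtain v s u where q: "q = (v, s, u)" by (cases q)
      show ?thesis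
      proof (cases "0 < s")
        case s: True
        define k where "k = cmod (hker \<zeta> (s + sqn v) u)"
        have k: "0 < k"
          using hker_norm_bounds(1)[OF s \<zeta>] by (simp add: k_def)
        define x y where "x = cmod (f (hcoord z q)) * s powr (t / p)" and "y = s powr (l - t / p) / k powr a"
        have xy: "0 \<le> x" "0 \<le> y" by (auto simp: x_def y_def)
        have "s powr (t / p) * s powr (l - t / p) = s powr l"
          by (simp flip: powr_add)
        then have "cmod (wint \<zeta> l a (\<lambda>q. f (hcoord z q)) q) = x * y"
          using s by (simp add: wint_def q k_def x_def y_def norm_mult norm_divide norm_powr_real_powr' mult_ac)
        also have "\<dots> \<le> x powr p / p + y powr r / r"
          using p1 r xy by (intro Youngs_inequality) auto
        also have "\<dots> \<le> x powr p + y powr r"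
          using p1 r by (intro add_mono) (auto simp: divide_le_eq mult_le_cancel_left1)
        also have "x powr p = cmod (f (hcoord z q)) powr p * s powr t"
          using s p1 by (simp add: x_def powr_mult powr_powr)
        also have "y powr r = s powr \<alpha> / k powr \<beta>"
          using s k by (simp add: y_def powr_divide powr_powr \<alpha>_def \<beta>_def mult.commute)
        finally show ?thesis
          using s by (simp add: J_def I_def q k_def ennreal_plus[symmetric] ennreal_leI del: ennreal_plus)
      qed (simp add: q wint_def)
    qed
    have "(\<integral>\<^sup>+q. ennreal (cmod (wint \<zeta> l a (\<lambda>q. f (hcoord z q)) q)) \<partial>cmeas) \<le> (\<integral>\<^sup>+q. J q + I q \<partial>cmeas)"
      by (intro nn_integral_mono pt)
    also have "\<dots> = (\<integral>\<^sup>+q. J q \<partial>cmeas) + (\<integral>\<^sup>+q. I q \<partial>cmeas)"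
      using Jm' Im by (rule nn_integral_add)
    also have "\<dots> < \<infinity>"
      using J I by simp
    finally show "(\<integral>\<^sup>+q. ennreal (cmod (wint \<zeta> l a (\<lambda>q. f (hcoord z q)) q)) \<partial>cmeas) < \<infinity>" .
  qed
qed

section \<open>The representation formula\<close>

lemma rho2_measurable [measurable]: "rho2 z \<in> borel_measurable borel"
  unfolding rho2_def by (intro borel_measurable_continuous_onI continuous_intros)

theorem theorem1p3:
  fixes p t l :: real and N :: nat
    and f :: "complex ^ 'n :: {finite, linorder} \<Rightarrow> complex"
  assumes "1 \<le> p" and "t > -1"
    and "1 < p \<Longrightarrow> l > (t + 1) / p - 1"
    and "p = 1 \<Longrightarrow> l \<ge> t"
    and "f \<in> bergman p t"
  shows "\<forall>z\<in>siegel.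
     integrable (lebesgue_on siegel)
       (P_integrand l (\<lambda>w. complex_of_real (rho w ^ N) * (Lop ^^ N) f w) z) \<and>
     f z = (- 2 * \<i>) ^ N * complex_of_real (Gamma (1 + l) / Gamma (1 + l + real N))
             * P_op l (\<lambda>w. complex_of_real (rho w ^ N) * (Lop ^^ N) f w) z"
proof
  fix z :: "'n cvec" assume z: "z \<in> siegel"
  have hol: "holomorphic_sv f siegel" using assms(5) by (simp add: bergman_def)
  have l: "l > -1"
  proof (cases "p = 1")
    case False
    then have "1 < p" using assms(1) by simp
    moreover from this have "0 < (t + 1) / p" using assms(2) by simp
    ultimately show ?thesis using assms(3) by linarith
  qed (use assms in simp)
  define a where "a = real CARD('n) + 1 + l"
  have a: "0 < a" using l by (simp add: a_def)
  have \<zeta>: "0 < Im (base z)" using z by (simp add: Im_base mem_siegel_iff)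
  have int: "integrable cmeas (wint (base z) l a (\<lambda>q. f (hcoord z q)))"
    unfolding a_def by (rule bergman_wint_integrable[OF assms z])
  let ?G = "P_integrand l (\<lambda>w. complex_of_real (rho w ^ N) * (Lop ^^ N) f w) z"
  have meas: "(\<lambda>w. indicator siegel w *\<^sub>R ?G w) \<in> borel_measurable borel"
  proof -
    define g where "g w = indicator siegel w *\<^sub>R (Lop ^^ N) f w" for w
    have [measurable]: "g \<in> borel_measurable borel"
      unfolding g_def by (rule Lop_iterate_measurable[OF hol])
    have "(\<lambda>w. indicator siegel w *\<^sub>R ?G w)
        = (\<lambda>w. of_real (rho w powr l) / rho2 z w powr of_real a * (of_real (rho w ^ N) * g w))"
      by (auto simp: P_integrand_def g_def a_def fun_eq_iff indicator_def)
    also have "\<dots> \<in> borel_measurable borel"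
      by measurable
    finally show ?thesis .
  qed
  have eq: "(\<lambda>(v, s, u). indicator {0<..} s *\<^sub>R ?G (hcoord z (v, s, u)))
      = wint (base z) (l + real N) a (\<lambda>q. (Lop ^^ N) f (hcoord z q))"
    by (auto simp: wint_def P_integrand_def a_def fun_eq_iff rho_hcoord rho2_hcoord indicator_def powr_add powr_realpow)
  have G_int: "integrable (lebesgue_on siegel) ?G"
    unfolding siegel_integral_hcoord(1)[OF meas, of z] eq
    by (rule wint_Lop_integrable[OF hol \<zeta> a int])
  have "(\<integral>w. ?G w \<partial>lebesgue_on siegel)
      = (\<i> / 2) ^ N * of_real (4 * pi ^ CARD('n) * Gamma (1 + l + real N) / Gamma a) * f z"
    unfolding siegel_integral_hcoord(2)[OF meas, of z] eq
    using wint_Lop_reproducing[OF l z hol int[unfolded a_def], of N] by (simp add: a_def)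
  then have main: "(- 2 * \<i>) ^ N * complex_of_real (Gamma (1 + l) / Gamma (1 + l + real N))
        * P_op l (\<lambda>w. complex_of_real (rho w ^ N) * (Lop ^^ N) f w) z
      = ((- 2 * \<i>) ^ N * (\<i> / 2) ^ N)
        * of_real ((Gamma (1 + l) / Gamma (1 + l + real N)) * (Gamma a / (4 * pi ^ CARD('n) * Gamma (1 + l)))
            * (4 * pi ^ CARD('n) * Gamma (1 + l + real N) / Gamma a)) * f z"
    unfolding P_op_def a_def[symmetric] by (simp only: of_real_mult mult_ac)
  have gammas: "(Gamma (1 + l) / Gamma (1 + l + real N)) * (Gamma a / (4 * pi ^ CARD('n) * Gamma (1 + l)))
      * (4 * pi ^ CARD('n) * Gamma (1 + l + real N) / Gamma a) = 1"
  proof -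
    have "0 < Gamma (1 + l)" "0 < Gamma (1 + l + real N)" "0 < Gamma a"
      using l a by (auto intro!: Gamma_real_pos)
    then show ?thesis by simp
  qed
  have phases: "(- 2 * \<i>) ^ N * (\<i> / 2) ^ N = (1 :: complex)"
    unfolding power_mult_distrib[symmetric] by simp
  show "integrable (lebesgue_on siegel) ?G \<and>
     f z = (- 2 * \<i>) ^ N * complex_of_real (Gamma (1 + l) / Gamma (1 + l + real N))
             * P_op l (\<lambda>w. complex_of_real (rho w ^ N) * (Lop ^^ N) f w) z"
    using G_int unfolding main gammas phases by simp
qed

end
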